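(* Let $(A, H, \triangleright, f)$ and $(A', H', \triangleright', f')$ be two crossed systems of Hopf algebras. Then there exists a bijective correspondence between the set of all morphisms of Hopf algebras $\psi : A \#^{\triangleright}_{f} H \to A' \#^{\triangleright'}_{f'} H'$ and the set of all quadruples $(u, p, r, v)$, where $p: A \to H'$ is a morphism of Hopf algebras, and $u: A \to A'$, $r: H \rightarrow A'$ and $v: H \rightarrow H'$ are unitary morphisms of coalgebras satisfying the following compatibility conditions for all $a, b \in A$, $g, h \in H$: (CP1) $u(a_{(1)}) \otimes p(a_{(2)}) = u(a_{(2)}) \otimes p(a_{(1)})$; (CP2) $r(h_{(1)}) \otimes v(h_{(2)}) = r(h_{(2)}) \otimes v(h_{(1)})$; (CP3) $u(ab) = u(a_{(1)}) \, \bigl( p (a_{(2)}) \triangleright' u(b_{(1)}) \bigr) f'\bigl(p(a_{(3)}), \, p(b_{(2)})\bigr)$; (CP4) $v(h) \, v(g) = p\bigl(f(h_{(1)}, g_{(1)})\bigr) \, v(h_{(2)}g_{(2)})$; (CP5) $v(h) \, p(a) = p(h_{(1)} \triangleright a) \, v(h_{(2)})$; (CP6) $r(h_{(1)}) \bigl(v(h_{(2)}) \triangleright' r(g_{(1)})\bigr) f'\bigl(v(h_{(3)}), v(g_{(2)})\bigr) = u \bigl(f(h_{(1)}, g_{(1)})\bigr) \Bigl(p\bigl(f(h_{(2)}, g_{(2)})\bigr) \triangleright' r(h_{(4)} g_{(4)})\Bigr) f'\Bigl(p\bigl(f(h_{(3)}, g_{(3)})\bigr),\, v(h_{(5)}g_{(5)})\Bigr)$;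 (CP7) $r(h_{(1)}) \bigl(v(h_{(2)}) \triangleright' u(a_{(1)})\bigr) f' \bigl(v(h_{(3)}), \, p(a_{(2)})\bigr) = u(h_{(1)} \triangleright a_{(1)}) \, \bigl(p(h_{(2)} \triangleright a_{(2)}) \triangleright' r(h_{(4)})\bigr) f' \bigl(p(h_{(3)} \triangleright a_{(3)}), \, v(h_{(5)})\bigr)$. Under this bijection the morphism of Hopf algebras $\psi: A \#^{\triangleright}_{f} H \to A' \#^{\triangleright'}_{f'} H'$ corresponding to $(u, p, r, v)$ is given, for all $a \in A$ and $h\in H$, by $$\psi(a \# h) = u(a_{(1)}) \, \bigl( p(a_{(2)}) \triangleright' r(h_{(1)}) \bigr) f'\bigl(p(a_{(3)}), \, v(h_{(2)})\bigr) \,\, \#' \, p(a_{(4)}) \, v(h_{(3)}).$$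
   Context: All objects are over an arbitrary field $k$; Sweedler notation $\Delta(c)=c_{(1)}\otimes c_{(2)}$ is used (summation understood). A map is unitary if it sends the unit to the unit. For Hopf algebras $A$, $H$, a weak action of $H$ on $A$ is a $k$-linear map $\triangleright: H\otimes A\to A$ with $h\triangleright 1_A=\varepsilon_H(h)1_A$, $1_H\triangleright a=a$, and $h\triangleright(ab)=(h_{(1)}\triangleright a)(h_{(2)}\triangleright b)$ for all $a,b\in A$, $h\in H$. Given a weak action $\triangleright$ and a $k$-linear map $f:H\otimes H\to A$ (write $f(g,h)=f(g\otimes h)$), $A\#_f^{\triangleright}H$ denotes the vector space $A\otimes H$ (write $a\#h$ for $a\otimes h$) with multiplication $$(a\#h)\cdot(c\#g):=a(h_{(1)}\triangleright c)f(h_{(2)},g_{(1)})\#h_{(3)}g_{(2)}.$$ $(A,H,\triangleright,f)$ is called a crossed system of Hopf algebras, and $A\#_f^{\triangleright}H$ a crossed product of Hopf algebras, if $A\#_f^{\triangleright}H$ is a Hopf algebra with this multiplication, unit $1_A\#1_H$ and the tensor product coalgebra structure. Elements $a'\otimes h'$ of $A'\#^{\triangleright'}_{f'}H'$ are written $a'\#'h'$. *)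

theory Defs
  imports Complex_Main "HOL-Library.FuncSet" "HOL-Library.Function_Algebras"
begin

section \<open>Vector spaces and tensor products\<close>

text \<open>
  The ground field is the type \<open>'k :: field\<close>. A vector space is a linear subspace \<open>vcar V\<close>, possibly
  all, of a type carrying a vector space structure. Carriers are needed because the underlying space
  of a tensor product depends on the scalar multiplications of its factors, so it cannot be a type.
  Maps are only meaningful on carriers.
\<close>

record ('k, 'a) vspace =
  vcar :: "'a set"
  vscale :: "'k \<Rightarrow> 'a \<Rightarrow> 'a"

definition is_vspace :: "('k::field, 'a::ab_group_add, 'm) vspace_scheme \<Rightarrow> bool" where
  "is_vspace V \<longleftrightarrow> vector_space (vscale V) \<and> module.subspace (vscale V) (vcar V)"

definition linear_map ::
    "('k::field, 'a::ab_group_add, 'm) vspace_scheme \<Rightarrow> ('k, 'b::ab_group_add, 'n) vspace_scheme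
      \<Rightarrow> ('a \<Rightarrow> 'b) \<Rightarrow> bool" where
  "linear_map V W \<phi> \<longleftrightarrow>
     \<phi> \<in> vcar V \<rightarrow> vcar W \<and>
     (\<forall>x\<in>vcar V. \<forall>y\<in>vcar V. \<phi> (x + y) = \<phi> x + \<phi> y) \<and>
     (\<forall>c. \<forall>x\<in>vcar V. \<phi> (vscale V c x) = vscale W c (\<phi> x))"

definition bilinear_map ::
    "('k::field, 'a::ab_group_add, 'm) vspace_scheme \<Rightarrow> ('k, 'b::ab_group_add, 'n) vspace_scheme
      \<Rightarrow> ('k, 'c::ab_group_add, 'o) vspace_scheme \<Rightarrow> ('a \<Rightarrow> 'b \<Rightarrow> 'c) \<Rightarrow> bool" where
  "bilinear_map V W U \<beta> \<longleftrightarrow>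
     (\<forall>x\<in>vcar V. linear_map W U (\<beta> x)) \<and> (\<forall>y\<in>vcar W. linear_map V U (\<lambda>x. \<beta> x y))"

definition ground :: "('k::field, 'k) vspace" where
  "ground = \<lparr>vcar = UNIV, vscale = (*)\<rparr>"

text \<open>
  The tensor product of two spaces over a field, realised inside the dual of the space of bilinear
  forms: \<open>x \<otimes> y\<close> is evaluation at \<open>(x, y)\<close>, and \<open>V \<otimes> W\<close> is the span of these evaluations. The
  universal property is \<open>tensor_lift_tens\<close> and \<open>tensor_lift_linear\<close> below, together with the fact that
  the pure tensors span.
\<close>

type_synonym ('k, 'a, 'b) tensor = "('a \<Rightarrow> 'b \<Rightarrow> 'k) \<Rightarrow> 'k"

definition tens ::
    "('k::field, 'a::ab_group_add, 'm) vspace_scheme \<Rightarrow> ('k, 'b::ab_group_add, 'n) vspace_scheme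
      \<Rightarrow> 'a \<Rightarrow> 'b \<Rightarrow> ('k, 'a, 'b) tensor" where
  "tens V W x y = (\<lambda>\<beta>. if bilinear_map V W ground \<beta> then \<beta> x y else 0)"

abbreviation tens_syntax ("(_ \<otimes>\<^bsub>_,_\<^esub> _)" [71, 0, 0, 71] 70) where
  "x \<otimes>\<^bsub>V,W\<^esub> y \<equiv> tens V W x y"

definition tensor_scale :: "'k::field \<Rightarrow> ('k, 'a, 'b) tensor \<Rightarrow> ('k, 'a, 'b) tensor" where
  "tensor_scale c t = (\<lambda>\<beta>. c * t \<beta>)"

definition tensor_space ::
    "('k::field, 'a::ab_group_add, 'm) vspace_scheme \<Rightarrow> ('k, 'b::ab_group_add, 'n) vspace_scheme
      \<Rightarrow> ('k, ('k, 'a, 'b) tensor) vspace" where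
  "tensor_space V W =
     \<lparr>vcar = module.span tensor_scale {x \<otimes>\<^bsub>V,W\<^esub> y | x y. x \<in> vcar V \<and> y \<in> vcar W},
      vscale = tensor_scale\<rparr>"

text \<open>
  \<open>tensor_lift V W \<beta>\<close> is the linear map on \<open>V \<otimes> W\<close> with \<open>x \<otimes> y \<mapsto> \<beta> x y\<close>: choose any presentation
  \<open>t = \<Sum>\<^sub>i x\<^sub>i \<otimes> y\<^sub>i\<close> and return \<open>\<Sum>\<^sub>i \<beta> x\<^sub>i y\<^sub>i\<close>.
\<close>

definition presents ::
    "('k::field, 'a::ab_group_add, 'm) vspace_scheme \<Rightarrow> ('k, 'b::ab_group_add, 'n) vspace_scheme
      \<Rightarrow> ('a \<times> 'b) list \<Rightarrow> ('k, 'a, 'b) tensor \<Rightarrow> bool" where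
  "presents V W xs t \<longleftrightarrow>
     set xs \<subseteq> vcar V \<times> vcar W \<and> t = (\<Sum>(x, y)\<leftarrow>xs. x \<otimes>\<^bsub>V,W\<^esub> y)"

definition tensor_lift ::
    "('k::field, 'a::ab_group_add, 'm) vspace_scheme \<Rightarrow> ('k, 'b::ab_group_add, 'n) vspace_scheme
      \<Rightarrow> ('a \<Rightarrow> 'b \<Rightarrow> 'c::ab_group_add) \<Rightarrow> ('k, 'a, 'b) tensor \<Rightarrow> 'c" where
  "tensor_lift V W \<beta> t = (\<Sum>(x, y)\<leftarrow>(SOME xs. presents V W xs t). \<beta> x y)"

lemma vector_space_tensor_scale: "vector_space (tensor_scale :: 'k::field \<Rightarrow> ('k, 'a, 'b) tensor \<Rightarrow> _)"
  by unfold_locales (auto simp: tensor_scale_def fun_eq_iff algebra_simps)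

lemma vector_space_ground: "vector_space ((*) :: 'k::field \<Rightarrow> 'k \<Rightarrow> 'k)"
  by unfold_locales (auto simp: algebra_simps)

lemma is_vspace_tensor_space:
  fixes V :: "('k::field, 'a::ab_group_add, 'm) vspace_scheme"
    and W :: "('k, 'b::ab_group_add, 'n) vspace_scheme"
  shows "is_vspace (tensor_space V W)"
proof -
  interpret vector_space "tensor_scale :: 'k \<Rightarrow> ('k, 'a, 'b) tensor \<Rightarrow> _"
    by (rule vector_space_tensor_scale)
  show ?thesis
    by (simp add: is_vspace_def tensor_space_def vector_space_axioms)
qed

lemma tens_scale_left:
  assumes "x \<in> vcar V" "y \<in> vcar W"
  shows "vscale V c x \<otimes>\<^bsub>V,W\<^esub> y = tensor_scale c (x \<otimes>\<^bsub>V,W\<^esub> y)"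
  using assms
  by (auto simp: tens_def tensor_scale_def bilinear_map_def linear_map_def ground_def fun_eq_iff)

lemma presentsE:
  fixes V :: "('k::field, 'a::ab_group_add, 'm) vspace_scheme"
    and W :: "('k, 'b::ab_group_add, 'n) vspace_scheme"
  assumes V: "is_vspace V" and t: "t \<in> vcar (tensor_space V W)"
  obtains xs where "presents V W xs t"
proof -
  interpret T: vector_space "tensor_scale :: 'k \<Rightarrow> ('k, 'a, 'b) tensor \<Rightarrow> _"
    by (rule vector_space_tensor_scale)
  have V': "vector_space (vscale V)" "module.subspace (vscale V) (vcar V)"
    using V by (auto simp: is_vspace_def)
  interpret V: vector_space "vscale V" by (rule V')
  have "\<exists>xs. presents V W xs t"
    using t unfolding tensor_space_def vspace.simps
  proof (induction rule: T.span_induct_alt)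
    case base
    have "presents V W [] 0" by (simp add: presents_def)
    thus ?case by blast
  next
    case (step c s t)
    then obtain x y xs where xy: "s = x \<otimes>\<^bsub>V,W\<^esub> y" "x \<in> vcar V" "y \<in> vcar W" "presents V W xs t"
      by auto
    have "vscale V c x \<in> vcar V" using V'(2) xy by (auto simp: V.subspace_def)
    hence "presents V W ((vscale V c x, y) # xs) (tensor_scale c s + t)"
      using xy by (auto simp: presents_def tens_scale_left)
    thus ?case by blast
  qed
  thus ?thesis using that by blast
qed

lemma bilinear_map_compose:
  assumes "bilinear_map V W U \<beta>" "linear_map U X \<phi>"
  shows "bilinear_map V W X (\<lambda>x y. \<phi> (\<beta> x y))"
  using assms by (fastforce simp: bilinear_map_def linear_map_def Pi_iff)

lemma sum_list_tens_apply:
  assumes "bilinear_map V W ground \<gamma>"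
  shows "(\<Sum>(x, y)\<leftarrow>xs. x \<otimes>\<^bsub>V,W\<^esub> y) \<gamma> = (\<Sum>(x, y)\<leftarrow>xs. \<gamma> x y)"
  by (induction xs) (auto simp: tens_def assms)

lemma tensor_lift_presents:
  fixes V :: "('k::field, 'a::ab_group_add, 'm) vspace_scheme"
    and W :: "('k, 'b::ab_group_add, 'n) vspace_scheme"
    and U :: "('k, 'c::ab_group_add, 'o) vspace_scheme"
  assumes U: "is_vspace U" and \<beta>: "bilinear_map V W U \<beta>" and xs: "presents V W xs t"
  shows "tensor_lift V W \<beta> t = (\<Sum>(x, y)\<leftarrow>xs. \<beta> x y)"
proof -
  define ys where "ys = (SOME ys. presents V W ys t)"
  have ys: "presents V W ys t" unfolding ys_def using xs by (rule someI)
  define d where "d = (\<Sum>(x, y)\<leftarrow>ys. \<beta> x y) - (\<Sum>(x, y)\<leftarrow>xs. \<beta> x y)"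
  have "d = 0"
  proof (rule ccontr)
    assume d: "d \<noteq> 0"
    interpret U: vector_space "vscale U" using U by (auto simp: is_vspace_def)
    interpret K: vector_space "(*) :: 'k \<Rightarrow> 'k \<Rightarrow> 'k" by (rule vector_space_ground)
    interpret P: vector_space_pair "vscale U" "(*) :: 'k \<Rightarrow> 'k \<Rightarrow> 'k" ..
    obtain \<phi> where \<phi>: "Vector_Spaces.linear (vscale U) (*) \<phi>" "\<phi> d = (1 :: 'k)"
      using P.linear_independent_extend[of "{d}" "\<lambda>_. 1"] d by auto
    interpret \<phi>: Vector_Spaces.linear "vscale U" "(*)" \<phi> by (rule \<phi>)
    have sum: "\<phi> (\<Sum>(x, y)\<leftarrow>zs. \<beta> x y) = (\<Sum>(x, y)\<leftarrow>zs. \<phi> (\<beta> x y))" for zs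
      by (induction zs) (auto simp: \<phi>.add \<phi>.zero)
    have lin: "linear_map U ground \<phi>"
      by (auto simp: linear_map_def ground_def \<phi>.add \<phi>.scale)
    have bil: "bilinear_map V W ground (\<lambda>x y. \<phi> (\<beta> x y))"
      by (rule bilinear_map_compose[OF \<beta> lin])
    have "(\<Sum>(x, y)\<leftarrow>zs. \<phi> (\<beta> x y)) = t (\<lambda>x y. \<phi> (\<beta> x y))" if "presents V W zs t" for zs
      using that sum_list_tens_apply[OF bil, of zs] by (simp add: presents_def)
    hence "\<phi> d = 0" using xs ys by (simp add: d_def \<phi>.diff sum)
    thus False using \<phi>(2) by simp
  qed
  thus ?thesis by (simp add: tensor_lift_def d_def ys_def)
qed

lemma tensor_lift_tens:
  assumes "is_vspace U" "bilinear_map V W U \<beta>" "x \<in> vcar V" "y \<in> vcar W"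
  shows "tensor_lift V W \<beta> (x \<otimes>\<^bsub>V,W\<^esub> y) = \<beta> x y"
  using tensor_lift_presents[OF assms(1,2), of "[(x, y)]"] assms(3,4) by (simp add: presents_def)

lemma tensor_lift_linear:
  fixes V :: "('k::field, 'a::ab_group_add, 'm) vspace_scheme"
    and W :: "('k, 'b::ab_group_add, 'n) vspace_scheme"
    and U :: "('k, 'c::ab_group_add, 'o) vspace_scheme"
  assumes V: "is_vspace V" and U: "is_vspace U" and \<beta>: "bilinear_map V W U \<beta>"
  shows "linear_map (tensor_space V W) U (tensor_lift V W \<beta>)"
proof -
  interpret U: vector_space "vscale U" using U by (auto simp: is_vspace_def)
  interpret V: vector_space "vscale V" using V by (auto simp: is_vspace_def)
  have subU: "U.subspace (vcar U)" and subV: "V.subspace (vcar V)"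
    using U V by (auto simp: is_vspace_def)
  have in_U: "\<beta> x y \<in> vcar U" if "x \<in> vcar V" "y \<in> vcar W" for x y
    using \<beta> that by (auto simp: bilinear_map_def linear_map_def)
  have mem: "(\<Sum>(x, y)\<leftarrow>xs. \<beta> x y) \<in> vcar U" if "set xs \<subseteq> vcar V \<times> vcar W" for xs
    using that by (induction xs) (auto simp: in_U U.subspace_0[OF subU] U.subspace_add[OF subU])
  have scale: "tensor_scale c (\<Sum>(x, y)\<leftarrow>xs. x \<otimes>\<^bsub>V,W\<^esub> y) = (\<Sum>(x, y)\<leftarrow>map (\<lambda>(x, y). (vscale V c x, y)) xs. x \<otimes>\<^bsub>V,W\<^esub> y)
      \<and> vscale U c (\<Sum>(x, y)\<leftarrow>xs. \<beta> x y) = (\<Sum>(x, y)\<leftarrow>map (\<lambda>(x, y). (vscale V c x, y)) xs. \<beta> x y)"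
    if "set xs \<subseteq> vcar V \<times> vcar W" for c xs
    using that
  proof (induction xs)
    case Nil
    show ?case by (simp add: tensor_scale_def fun_eq_iff)
  next
    case (Cons z xs)
    obtain x y where z: "z = (x, y)" by (cases z)
    interpret T: vector_space "tensor_scale :: 'k \<Rightarrow> ('k, 'a, 'b) tensor \<Rightarrow> _"
      by (rule vector_space_tensor_scale)
    have "\<beta> (vscale V c x) y = vscale U c (\<beta> x y)"
      using \<beta> Cons.prems z by (auto simp: bilinear_map_def linear_map_def)
    moreover have "vscale V c x \<otimes>\<^bsub>V,W\<^esub> y = tensor_scale c (x \<otimes>\<^bsub>V,W\<^esub> y)"
      using Cons.prems z by (auto simp: tens_scale_left)
    ultimately show ?case
      using Cons unfolding z list.map sum_list.Cons case_prod_conv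
      by (simp only: T.scale_right_distrib U.scale_right_distrib set_simps insert_subset)
  qed
  show ?thesis unfolding linear_map_def
  proof (intro conjI ballI allI funcsetI)
    fix t assume "t \<in> vcar (tensor_space V W)"
    then obtain xs where xs: "presents V W xs t" by (rule presentsE[OF V])
    show "tensor_lift V W \<beta> t \<in> vcar U"
      unfolding tensor_lift_presents[OF U \<beta> xs] using mem xs by (simp add: presents_def)
    fix c
    have "presents V W (map (\<lambda>(x, y). (vscale V c x, y)) xs) (tensor_scale c t)"
      using xs scale[of xs c] V.subspace_scale[OF subV] by (auto simp: presents_def)
    from tensor_lift_presents[OF U \<beta> this]
    show "tensor_lift V W \<beta> (vscale (tensor_space V W) c t) = vscale U c (tensor_lift V W \<beta> t)"
      unfolding tensor_lift_presents[OF U \<beta> xs] using scale[of xs c] xs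
      by (simp add: tensor_space_def presents_def)
  next
    fix s t assume "s \<in> vcar (tensor_space V W)" "t \<in> vcar (tensor_space V W)"
    then obtain xs ys where xy: "presents V W xs s" "presents V W ys t"
      by (meson presentsE[OF V])
    hence "presents V W (xs @ ys) (s + t)" by (auto simp: presents_def)
    from tensor_lift_presents[OF U \<beta> this]
    show "tensor_lift V W \<beta> (s + t) = tensor_lift V W \<beta> s + tensor_lift V W \<beta> t"
      by (simp add: tensor_lift_presents[OF U \<beta> xy(1)] tensor_lift_presents[OF U \<beta> xy(2)])
  qed
qed

section \<open>Coalgebras and Hopf algebras\<close>

record ('k, 'a) coalg = "('k, 'a) vspace" +
  comul :: "'a \<Rightarrow> ('k, 'a, 'a) tensor"
  counit :: "'a \<Rightarrow> 'k"

record ('k, 'a) bialg = "('k, 'a) coalg" +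
  mul :: "'a \<Rightarrow> 'a \<Rightarrow> 'a" (infixl "\<cdot>\<index>" 75)
  unit :: "'a" ("\<one>\<index>")

text \<open>
  Sweedler notation: \<open>sw\<^sub>n C c (\<lambda>c\<^sub>1 \<dots> c\<^sub>n. F c\<^sub>1 \<dots> c\<^sub>n)\<close> is the element written
  \<open>F(c\<^sub>(\<^sub>1\<^sub>), \<dots>, c\<^sub>(\<^sub>n\<^sub>))\<close> with summation understood, for multilinear \<open>F\<close>; it is applied to the iterated
  comultiplication \<open>c\<^sub>(\<^sub>1\<^sub>) \<otimes> (c\<^sub>(\<^sub>2\<^sub>) \<otimes> (\<dots> \<otimes> c\<^sub>(\<^sub>n\<^sub>)))\<close>.
\<close>

definition sw2 :: "('k::field, 'a::ab_group_add, 'm) coalg_scheme \<Rightarrow> 'a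
    \<Rightarrow> ('a \<Rightarrow> 'a \<Rightarrow> 'c::ab_group_add) \<Rightarrow> 'c" where
  "sw2 C c F = tensor_lift C C F (comul C c)"

definition sw3 :: "('k::field, 'a::ab_group_add, 'm) coalg_scheme \<Rightarrow> 'a
    \<Rightarrow> ('a \<Rightarrow> 'a \<Rightarrow> 'a \<Rightarrow> 'c::ab_group_add) \<Rightarrow> 'c" where
  "sw3 C c F = sw2 C c (\<lambda>c1 d. sw2 C d (F c1))"

definition sw4 :: "('k::field, 'a::ab_group_add, 'm) coalg_scheme \<Rightarrow> 'a
    \<Rightarrow> ('a \<Rightarrow> 'a \<Rightarrow> 'a \<Rightarrow> 'a \<Rightarrow> 'c::ab_group_add) \<Rightarrow> 'c" where
  "sw4 C c F = sw2 C c (\<lambda>c1 d. sw3 C d (F c1))"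

definition sw5 :: "('k::field, 'a::ab_group_add, 'm) coalg_scheme \<Rightarrow> 'a
    \<Rightarrow> ('a \<Rightarrow> 'a \<Rightarrow> 'a \<Rightarrow> 'a \<Rightarrow> 'a \<Rightarrow> 'c::ab_group_add) \<Rightarrow> 'c" where
  "sw5 C c F = sw2 C c (\<lambda>c1 d. sw4 C d (F c1))"

text \<open>Coassociativity is stated in \<open>C \<otimes> (C \<otimes> C)\<close>.\<close>

definition coalgebra :: "('k::field, 'a::ab_group_add, 'm) coalg_scheme \<Rightarrow> bool" where
  "coalgebra C \<longleftrightarrow>
     is_vspace C \<and>
     linear_map C (tensor_space C C) (comul C) \<and>
     linear_map C ground (counit C) \<and>
     (\<forall>c\<in>vcar C.
        sw2 C c (\<lambda>x y. sw2 C x (\<lambda>x1 x2. x1 \<otimes>\<^bsub>C,tensor_space C C\<^esub> (x2 \<otimes>\<^bsub>C,C\<^esub> y))) =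
        sw2 C c (\<lambda>x y. sw2 C y (\<lambda>y1 y2. x \<otimes>\<^bsub>C,tensor_space C C\<^esub> (y1 \<otimes>\<^bsub>C,C\<^esub> y2)))) \<and>
     (\<forall>c\<in>vcar C. sw2 C c (\<lambda>x y. vscale C (counit C x) y) = c) \<and>
     (\<forall>c\<in>vcar C. sw2 C c (\<lambda>x y. vscale C (counit C y) x) = c)"

definition algebra :: "('k::field, 'a::ab_group_add, 'm) bialg_scheme \<Rightarrow> bool" where
  "algebra A \<longleftrightarrow>
     is_vspace A \<and>
     bilinear_map A A A (mul A) \<and>
     (\<forall>x\<in>vcar A. \<forall>y\<in>vcar A. \<forall>z\<in>vcar A. (x \<cdot>\<^bsub>A\<^esub> y) \<cdot>\<^bsub>A\<^esub> z = x \<cdot>\<^bsub>A\<^esub> (y \<cdot>\<^bsub>A\<^esub> z)) \<and>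
     \<one>\<^bsub>A\<^esub> \<in> vcar A \<and>
     (\<forall>x\<in>vcar A. \<one>\<^bsub>A\<^esub> \<cdot>\<^bsub>A\<^esub> x = x \<and> x \<cdot>\<^bsub>A\<^esub> \<one>\<^bsub>A\<^esub> = x)"

definition bialgebra :: "('k::field, 'a::ab_group_add, 'm) bialg_scheme \<Rightarrow> bool" where
  "bialgebra B \<longleftrightarrow>
     coalgebra B \<and> algebra B \<and>
     (\<forall>x\<in>vcar B. \<forall>y\<in>vcar B.
        comul B (x \<cdot>\<^bsub>B\<^esub> y) =
          sw2 B x (\<lambda>x1 x2. sw2 B y (\<lambda>y1 y2. (x1 \<cdot>\<^bsub>B\<^esub> y1) \<otimes>\<^bsub>B,B\<^esub> (x2 \<cdot>\<^bsub>B\<^esub> y2))) \<and>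
        counit B (x \<cdot>\<^bsub>B\<^esub> y) = counit B x * counit B y) \<and>
     comul B \<one>\<^bsub>B\<^esub> = \<one>\<^bsub>B\<^esub> \<otimes>\<^bsub>B,B\<^esub> \<one>\<^bsub>B\<^esub> \<and>
     counit B \<one>\<^bsub>B\<^esub> = 1"

definition antipode :: "('k::field, 'a::ab_group_add, 'm) bialg_scheme \<Rightarrow> ('a \<Rightarrow> 'a) \<Rightarrow> bool" where
  "antipode B S \<longleftrightarrow>
     linear_map B B S \<and>
     (\<forall>x\<in>vcar B. sw2 B x (\<lambda>x1 x2. S x1 \<cdot>\<^bsub>B\<^esub> x2) = vscale B (counit B x) \<one>\<^bsub>B\<^esub> \<and>
                 sw2 B x (\<lambda>x1 x2. x1 \<cdot>\<^bsub>B\<^esub> S x2) = vscale B (counit B x) \<one>\<^bsub>B\<^esub>)"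

text \<open>
  The antipode, being unique, is not part of the data. Accordingly, a morphism of Hopf algebras is
  a morphism of bialgebras; it automatically commutes with the antipodes.
\<close>

definition hopf_algebra :: "('k::field, 'a::ab_group_add, 'm) bialg_scheme \<Rightarrow> bool" where
  "hopf_algebra B \<longleftrightarrow> bialgebra B \<and> (\<exists>S. antipode B S)"

definition coalgebra_hom ::
    "('k::field, 'a::ab_group_add, 'm) coalg_scheme \<Rightarrow> ('k, 'b::ab_group_add, 'n) coalg_scheme
      \<Rightarrow> ('a \<Rightarrow> 'b) \<Rightarrow> bool" where
  "coalgebra_hom C D \<phi> \<longleftrightarrow>
     linear_map C D \<phi> \<and>
     (\<forall>c\<in>vcar C. comul D (\<phi> c) = sw2 C c (\<lambda>c1 c2. \<phi> c1 \<otimes>\<^bsub>D,D\<^esub> \<phi> c2) \<and>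
                 counit D (\<phi> c) = counit C c)"

definition unitary ::
    "('k::field, 'a::ab_group_add, 'm) bialg_scheme \<Rightarrow> ('k, 'b::ab_group_add, 'n) bialg_scheme
      \<Rightarrow> ('a \<Rightarrow> 'b) \<Rightarrow> bool" where
  "unitary A B \<phi> \<longleftrightarrow> \<phi> \<one>\<^bsub>A\<^esub> = \<one>\<^bsub>B\<^esub>"

definition hopf_hom ::
    "('k::field, 'a::ab_group_add, 'm) bialg_scheme \<Rightarrow> ('k, 'b::ab_group_add, 'n) bialg_scheme
      \<Rightarrow> ('a \<Rightarrow> 'b) \<Rightarrow> bool" where
  "hopf_hom A B \<phi> \<longleftrightarrow>
     coalgebra_hom A B \<phi> \<and> unitary A B \<phi> \<and>
     (\<forall>x\<in>vcar A. \<forall>y\<in>vcar A. \<phi> (x \<cdot>\<^bsub>A\<^esub> y) = \<phi> x \<cdot>\<^bsub>B\<^esub> \<phi> y)"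

section \<open>Crossed products\<close>

definition weak_action ::
    "('k::field, 'a::ab_group_add) bialg \<Rightarrow> ('k, 'h::ab_group_add) bialg
      \<Rightarrow> (('k, 'h, 'a) tensor \<Rightarrow> 'a) \<Rightarrow> bool" where
  "weak_action A H act \<longleftrightarrow>
     linear_map (tensor_space H A) A act \<and>
     (\<forall>h\<in>vcar H. act (h \<otimes>\<^bsub>H,A\<^esub> \<one>\<^bsub>A\<^esub>) = vscale A (counit H h) \<one>\<^bsub>A\<^esub>) \<and>
     (\<forall>a\<in>vcar A. act (\<one>\<^bsub>H\<^esub> \<otimes>\<^bsub>H,A\<^esub> a) = a) \<and>
     (\<forall>h\<in>vcar H. \<forall>a\<in>vcar A. \<forall>b\<in>vcar A.
        act (h \<otimes>\<^bsub>H,A\<^esub> (a \<cdot>\<^bsub>A\<^esub> b)) =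
          sw2 H h (\<lambda>h1 h2. act (h1 \<otimes>\<^bsub>H,A\<^esub> a) \<cdot>\<^bsub>A\<^esub> act (h2 \<otimes>\<^bsub>H,A\<^esub> b)))"

text \<open>The multiplication and the tensor product coalgebra structure are extended linearly from
  pure tensors.\<close>

definition crossed_product ::
    "('k::field, 'a::ab_group_add) bialg \<Rightarrow> ('k, 'h::ab_group_add) bialg
      \<Rightarrow> (('k, 'h, 'a) tensor \<Rightarrow> 'a) \<Rightarrow> (('k, 'h, 'h) tensor \<Rightarrow> 'a)
      \<Rightarrow> ('k, ('k, 'a, 'h) tensor) bialg" where
  "crossed_product A H act f =
     \<lparr>vcar = vcar (tensor_space A H),
      vscale = vscale (tensor_space A H),
      comul = tensor_lift A H (\<lambda>a h.
        sw2 A a (\<lambda>a1 a2. sw2 H h (\<lambda>h1 h2.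
          (a1 \<otimes>\<^bsub>A,H\<^esub> h1) \<otimes>\<^bsub>tensor_space A H,tensor_space A H\<^esub> (a2 \<otimes>\<^bsub>A,H\<^esub> h2)))),
      counit = tensor_lift A H (\<lambda>a h. counit A a * counit H h),
      mul = (\<lambda>s t.
        tensor_lift A H (\<lambda>a h. tensor_lift A H (\<lambda>c g.
          sw3 H h (\<lambda>h1 h2 h3. sw2 H g (\<lambda>g1 g2.
            (a \<cdot>\<^bsub>A\<^esub> act (h1 \<otimes>\<^bsub>H,A\<^esub> c) \<cdot>\<^bsub>A\<^esub> f (h2 \<otimes>\<^bsub>H,H\<^esub> g1)) \<otimes>\<^bsub>A,H\<^esub> (h3 \<cdot>\<^bsub>H\<^esub> g2)))) t) s),
      unit = \<one>\<^bsub>A\<^esub> \<otimes>\<^bsub>A,H\<^esub> \<one>\<^bsub>H\<^esub>\<rparr>"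

definition crossed_system ::
    "('k::field, 'a::ab_group_add) bialg \<Rightarrow> ('k, 'h::ab_group_add) bialg
      \<Rightarrow> (('k, 'h, 'a) tensor \<Rightarrow> 'a) \<Rightarrow> (('k, 'h, 'h) tensor \<Rightarrow> 'a) \<Rightarrow> bool" where
  "crossed_system A H act f \<longleftrightarrow>
     hopf_algebra A \<and> hopf_algebra H \<and>
     weak_action A H act \<and>
     linear_map (tensor_space H H) A f \<and>
     hopf_algebra (crossed_product A H act f)"

text \<open>Functions are required to be \<open>undefined\<close> off the carrier, so that equality of functions is
  equality of maps.\<close>

definition hopf_homs ::
    "('k::field, 'a::ab_group_add) bialg \<Rightarrow> ('k, 'b::ab_group_add) bialg \<Rightarrow> ('a \<Rightarrow> 'b) set" where
  "hopf_homs A B = {\<phi> \<in> extensional (vcar A). hopf_hom A B \<phi>}"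

definition unitary_coalgebra_homs ::
    "('k::field, 'a::ab_group_add) bialg \<Rightarrow> ('k, 'b::ab_group_add) bialg \<Rightarrow> ('a \<Rightarrow> 'b) set" where
  "unitary_coalgebra_homs A B =
     {\<phi> \<in> extensional (vcar A). coalgebra_hom A B \<phi> \<and> unitary A B \<phi>}"

text \<open>
  In the next two definitions \<open>tri\<close>, \<open>coc\<close>, \<open>tri'\<close>, \<open>coc'\<close> are the bilinear maps
  \<open>h \<triangleright> a\<close>, \<open>f(h, g)\<close>, \<open>h' \<triangleright>' a'\<close>, \<open>f'(h', g')\<close> of the four structure maps.
\<close>

definition compatible_quadruples ::
    "('k::field, 'a::ab_group_add) bialg \<Rightarrow> ('k, 'h::ab_group_add) bialg
      \<Rightarrow> (('k, 'h, 'a) tensor \<Rightarrow> 'a) \<Rightarrow> (('k, 'h, 'h) tensor \<Rightarrow> 'a)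
      \<Rightarrow> ('k, 'c::ab_group_add) bialg \<Rightarrow> ('k, 'd::ab_group_add) bialg
      \<Rightarrow> (('k, 'd, 'c) tensor \<Rightarrow> 'c) \<Rightarrow> (('k, 'd, 'd) tensor \<Rightarrow> 'c)
      \<Rightarrow> (('a \<Rightarrow> 'c) \<times> ('a \<Rightarrow> 'd) \<times> ('h \<Rightarrow> 'c) \<times> ('h \<Rightarrow> 'd)) set" where
  "compatible_quadruples A H act f A' H' act' f' =
     (let tri = \<lambda>h a. act (h \<otimes>\<^bsub>H,A\<^esub> a);
          coc = \<lambda>h g. f (h \<otimes>\<^bsub>H,H\<^esub> g);
          tri' = \<lambda>h a. act' (h \<otimes>\<^bsub>H',A'\<^esub> a);
          coc' = \<lambda>h g. f' (h \<otimes>\<^bsub>H',H'\<^esub> g)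
      in {(u, p, r, v).
        p \<in> hopf_homs A H' \<and>
        u \<in> unitary_coalgebra_homs A A' \<and>
        r \<in> unitary_coalgebra_homs H A' \<and>
        v \<in> unitary_coalgebra_homs H H' \<and>
        (\<forall>a\<in>vcar A.
           sw2 A a (\<lambda>a1 a2. u a1 \<otimes>\<^bsub>A',H'\<^esub> p a2) = sw2 A a (\<lambda>a1 a2. u a2 \<otimes>\<^bsub>A',H'\<^esub> p a1)) \<and>
        (\<forall>h\<in>vcar H.
           sw2 H h (\<lambda>h1 h2. r h1 \<otimes>\<^bsub>A',H'\<^esub> v h2) = sw2 H h (\<lambda>h1 h2. r h2 \<otimes>\<^bsub>A',H'\<^esub> v h1)) \<and>
        (\<forall>a\<in>vcar A. \<forall>b\<in>vcar A.
           u (a \<cdot>\<^bsub>A\<^esub> b) =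
           sw3 A a (\<lambda>a1 a2 a3. sw2 A b (\<lambda>b1 b2.
             u a1 \<cdot>\<^bsub>A'\<^esub> tri' (p a2) (u b1) \<cdot>\<^bsub>A'\<^esub> coc' (p a3) (p b2)))) \<and>
        (\<forall>h\<in>vcar H. \<forall>g\<in>vcar H.
           v h \<cdot>\<^bsub>H'\<^esub> v g =
           sw2 H h (\<lambda>h1 h2. sw2 H g (\<lambda>g1 g2. p (coc h1 g1) \<cdot>\<^bsub>H'\<^esub> v (h2 \<cdot>\<^bsub>H\<^esub> g2)))) \<and>
        (\<forall>h\<in>vcar H. \<forall>a\<in>vcar A.
           v h \<cdot>\<^bsub>H'\<^esub> p a = sw2 H h (\<lambda>h1 h2. p (tri h1 a) \<cdot>\<^bsub>H'\<^esub> v h2)) \<and>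
        (\<forall>h\<in>vcar H. \<forall>g\<in>vcar H.
           sw3 H h (\<lambda>h1 h2 h3. sw2 H g (\<lambda>g1 g2.
             r h1 \<cdot>\<^bsub>A'\<^esub> tri' (v h2) (r g1) \<cdot>\<^bsub>A'\<^esub> coc' (v h3) (v g2))) =
           sw5 H h (\<lambda>h1 h2 h3 h4 h5. sw5 H g (\<lambda>g1 g2 g3 g4 g5.
             u (coc h1 g1) \<cdot>\<^bsub>A'\<^esub> tri' (p (coc h2 g2)) (r (h4 \<cdot>\<^bsub>H\<^esub> g4))
               \<cdot>\<^bsub>A'\<^esub> coc' (p (coc h3 g3)) (v (h5 \<cdot>\<^bsub>H\<^esub> g5))))) \<and>
        (\<forall>h\<in>vcar H. \<forall>a\<in>vcar A.
           sw3 H h (\<lambda>h1 h2 h3. sw2 A a (\<lambda>a1 a2.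
             r h1 \<cdot>\<^bsub>A'\<^esub> tri' (v h2) (u a1) \<cdot>\<^bsub>A'\<^esub> coc' (v h3) (p a2))) =
           sw5 H h (\<lambda>h1 h2 h3 h4 h5. sw3 A a (\<lambda>a1 a2 a3.
             u (tri h1 a1) \<cdot>\<^bsub>A'\<^esub> tri' (p (tri h2 a2)) (r h4)
               \<cdot>\<^bsub>A'\<^esub> coc' (p (tri h3 a3)) (v h5))))})"

text \<open>The value on \<open>a # h\<close> of the morphism associated with \<open>(u, p, r, v)\<close>.\<close>

definition quadruple_value ::
    "('k::field, 'a::ab_group_add) bialg \<Rightarrow> ('k, 'h::ab_group_add) bialg
      \<Rightarrow> ('k, 'c::ab_group_add) bialg \<Rightarrow> ('k, 'd::ab_group_add) bialg
      \<Rightarrow> (('k, 'd, 'c) tensor \<Rightarrow> 'c) \<Rightarrow> (('k, 'd, 'd) tensor \<Rightarrow> 'c)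
      \<Rightarrow> ('a \<Rightarrow> 'c) \<times> ('a \<Rightarrow> 'd) \<times> ('h \<Rightarrow> 'c) \<times> ('h \<Rightarrow> 'd)
      \<Rightarrow> 'a \<Rightarrow> 'h \<Rightarrow> ('k, 'c, 'd) tensor" where
  "quadruple_value A H A' H' act' f' = (\<lambda>(u, p, r, v) a h.
     (let tri' = \<lambda>h a. act' (h \<otimes>\<^bsub>H',A'\<^esub> a);
          coc' = \<lambda>h g. f' (h \<otimes>\<^bsub>H',H'\<^esub> g)
      in sw4 A a (\<lambda>a1 a2 a3 a4. sw3 H h (\<lambda>h1 h2 h3.
           (u a1 \<cdot>\<^bsub>A'\<^esub> tri' (p a2) (r h1) \<cdot>\<^bsub>A'\<^esub> coc' (p a3) (v h2)) \<otimes>\<^bsub>A',H'\<^esub> (p a4 \<cdot>\<^bsub>H'\<^esub> v h3)))))"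

end

theory Submission
  imports Defs
begin

text \<open>
  Why the theorem holds. Write \<open>B = A # H\<close> and \<open>B' = A' # H'\<close>. The maps \<open>i\<^sub>A a = a # 1\<close> and
  \<open>i\<^sub>H h = 1 # h\<close> are coalgebra maps into \<open>B\<close>, \<open>i\<^sub>A\<close> is multiplicative, and \<open>a # h = i\<^sub>A a \<cdot> i\<^sub>H h\<close>. So \<open>B\<close> is
  generated by the images of \<open>i\<^sub>A\<close> and \<open>i\<^sub>H\<close>, subject only to the relations
  \<open>i\<^sub>H h \<cdot> i\<^sub>H g = i\<^sub>A (f(h\<^sub>1, g\<^sub>1)) \<cdot> i\<^sub>H (h\<^sub>2 g\<^sub>2)\<close> and \<open>i\<^sub>H h \<cdot> i\<^sub>A a = i\<^sub>A (h\<^sub>1 \<triangleright> a) \<cdot> i\<^sub>H h\<^sub>2\<close>.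
  Hence a Hopf algebra map \<open>\<psi>\<close> on \<open>B\<close> is the same as a pair of unitary coalgebra maps \<open>\<alpha> = \<psi> i\<^sub>A\<close> and
  \<open>\<beta> = \<psi> i\<^sub>H\<close>, with \<open>\<alpha>\<close> multiplicative, that respects these two relations
  (\<open>compatible_iff_relations\<close> and \<open>psi_mul\<close>).
  
  On the other side, the coalgebra \<open>B'\<close> is \<open>A' \<otimes> H'\<close>, with coalgebra projections \<open>\<pi>\<^sub>A\<close> and \<open>\<pi>\<^sub>H\<close> that
  satisfy \<open>b = \<pi>\<^sub>A b\<^sub>1 # \<pi>\<^sub>H b\<^sub>2 = \<pi>\<^sub>A b\<^sub>2 # \<pi>\<^sub>H b\<^sub>1\<close> (\<open>components\<close>). So a coalgebra map into \<open>B'\<close> is the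
  same as a pair of coalgebra maps into \<open>A'\<close> and \<open>H'\<close> whose values commute under comultiplication
  (\<open>coalgebra_hom_pair\<close>, \<open>pair_components\<close>). Applied to \<open>\<alpha>\<close> this gives \<open>(u, p)\<close> with the first
  compatibility condition, and applied to \<open>\<beta>\<close> it gives \<open>(r, v)\<close> with the second.
  
  The three requirements on \<open>\<alpha>\<close> and \<open>\<beta>\<close> are equations between maps in two variables that are compatible
  with comultiplication, because every map that occurs is built from coalgebra maps and the
  multiplications of bialgebras. Such an equation holds if and only if it holds after \<open>\<pi>\<^sub>A\<close> and after
  \<open>\<pi>\<^sub>H\<close> (\<open>comultiplicative2_eqI\<close>). The map \<open>\<pi>\<^sub>H\<close> is multiplicative, and
  \<open>\<pi>\<^sub>A ((x # y) \<cdot> (z # w)) = x (y\<^sub>1 \<triangleright> z) f(y\<^sub>2, w)\<close>; with these formulas the six component equations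
  become the multiplicativity of \<open>p\<close> and the remaining five compatibility conditions
  (\<open>compatible_iff_components\<close>).
  
  On Sweedler sums: for fixed \<open>c\<close>, the sum \<open>sw2 C c F\<close> is a finite sum of values of \<open>F\<close> over a list of
  pairs that does not depend on \<open>F\<close>. Sums over different elements can therefore be exchanged, and
  additive maps can be moved in and out, for arbitrary \<open>F\<close>. Multilinearity of \<open>F\<close> matters only where
  the element itself changes: for coassociativity, the counit laws and coalgebra maps.
\<close>
section \<open>Linear maps on carriers\<close>

text \<open>
  Introduction rules that reduce linearity of a composite expression in one of its arguments, and
  membership of its value in a carrier, to the same questions about its parts.
\<close>

named_theorems lin

lemma linear_mapD:
  assumes "linear_map V W \<phi>"
  shows "x \<in> vcar V \<Longrightarrow> \<phi> x \<in> vcar W"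
    and "x \<in> vcar V \<Longrightarrow> y \<in> vcar V \<Longrightarrow> \<phi> (x + y) = \<phi> x + \<phi> y"
    and "x \<in> vcar V \<Longrightarrow> \<phi> (vscale V c x) = vscale W c (\<phi> x)"
  using assms by (auto simp: linear_map_def)

lemma is_vspaceD:
  assumes "is_vspace V"
  shows "vector_space (vscale V)"
    and "0 \<in> vcar V"
    and "x \<in> vcar V \<Longrightarrow> y \<in> vcar V \<Longrightarrow> x + y \<in> vcar V"
    and "x \<in> vcar V \<Longrightarrow> vscale V c x \<in> vcar V"
proof -
  interpret vector_space "vscale V" using assms by (auto simp: is_vspace_def)
  have "subspace (vcar V)" using assms by (auto simp: is_vspace_def)
  thus "0 \<in> vcar V" "x \<in> vcar V \<Longrightarrow> y \<in> vcar V \<Longrightarrow> x + y \<in> vcar V"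
    "x \<in> vcar V \<Longrightarrow> vscale V c x \<in> vcar V"
    by (auto simp: subspace_def)
  show "vector_space (vscale V)" ..
qed

lemma vscale_laws:
  assumes "is_vspace V"
  shows "vscale V c (x + y) = vscale V c x + vscale V c y"
    and "vscale V (c + d) x = vscale V c x + vscale V d x"
    and "vscale V c (vscale V d x) = vscale V (c * d) x"
    and "vscale V 1 x = x"
proof -
  interpret vector_space "vscale V" using assms by (rule is_vspaceD)
  show "vscale V c (x + y) = vscale V c x + vscale V c y"
    "vscale V (c + d) x = vscale V c x + vscale V d x"
    "vscale V c (vscale V d x) = vscale V (c * d) x" "vscale V 1 x = x"
    by (simp_all add: scale_right_distrib scale_left_distrib)
qed

lemma is_vspace_ground [lin]: "is_vspace ground"
proof -
  interpret vector_space "(*) :: 'a \<Rightarrow> 'a \<Rightarrow> 'a" by (rule vector_space_ground)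
  show ?thesis by (auto simp: is_vspace_def ground_def vector_space_axioms)
qed

declare is_vspace_tensor_space [lin]

lemma linear_map_zero:
  assumes "linear_map V W \<phi>" "is_vspace V"
  shows "\<phi> 0 = 0"
  using linear_mapD(2)[OF assms(1), of 0 0] is_vspaceD(2)[OF assms(2)] by simp

lemma linear_map_id [lin]: "linear_map V V (\<lambda>x. x)"
  by (auto simp: linear_map_def)

lemma linear_map_comp:
  assumes "linear_map V W g" "linear_map W U \<phi>"
  shows "linear_map V U (\<lambda>x. \<phi> (g x))"
  using assms by (auto simp: linear_map_def Pi_iff)

lemma linear_map_vscale [lin]:
  assumes "is_vspace W" "linear_map V W g"
  shows "linear_map V W (\<lambda>x. vscale W c (g x))"
  using assms by (auto simp: linear_map_def Pi_iff is_vspaceD vscale_laws mult.commute)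

lemma linear_map_vscale_left [lin]:
  assumes "is_vspace W" "linear_map V ground g" "y \<in> vcar W"
  shows "linear_map V W (\<lambda>x. vscale W (g x) y)"
  using assms by (auto simp: linear_map_def Pi_iff is_vspaceD vscale_laws ground_def)

lemma bilinear_mapI [lin]:
  assumes "\<And>x. x \<in> vcar V \<Longrightarrow> linear_map W U (\<lambda>y. \<beta> x y)"
    and "\<And>y. y \<in> vcar W \<Longrightarrow> linear_map V U (\<lambda>x. \<beta> x y)"
  shows "bilinear_map V W U \<beta>"
  using assms by (auto simp: bilinear_map_def)

lemma bilinear_mapD:
  assumes "bilinear_map V W U \<beta>"
  shows "x \<in> vcar V \<Longrightarrow> linear_map W U (\<beta> x)"
    and "y \<in> vcar W \<Longrightarrow> linear_map V U (\<lambda>x. \<beta> x y)"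
    and "x \<in> vcar V \<Longrightarrow> y \<in> vcar W \<Longrightarrow> \<beta> x y \<in> vcar U"
  using assms by (auto simp: bilinear_map_def linear_map_def)

lemma bilinear_map_left:
  assumes "bilinear_map V W U \<beta>" "linear_map X V g" "y \<in> vcar W"
  shows "linear_map X U (\<lambda>x. \<beta> (g x) y)"
  by (rule linear_map_comp[OF assms(2) bilinear_mapD(2)[OF assms(1,3)]])

lemma bilinear_map_right:
  assumes "bilinear_map V W U \<beta>" "linear_map X W g" "x \<in> vcar V"
  shows "linear_map X U (\<lambda>y. \<beta> x (g y))"
  by (rule linear_map_comp[OF assms(2) bilinear_mapD(1)[OF assms(1,3)]])

lemma linear_map_mult_left [lin]:
  "linear_map V ground g \<Longrightarrow> linear_map V ground (\<lambda>x. g x * c)"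
  by (auto simp: linear_map_def ground_def algebra_simps)

lemma linear_map_mult_right [lin]:
  "linear_map V ground g \<Longrightarrow> linear_map V ground (\<lambda>x. c * g x)"
  by (auto simp: linear_map_def ground_def algebra_simps)

section \<open>Tensor products\<close>

lemma tens_closed [lin]:
  fixes V :: "('k::field, 'a::ab_group_add, 'm) vspace_scheme"
    and W :: "('k, 'b::ab_group_add, 'n) vspace_scheme"
  assumes "x \<in> vcar V" "y \<in> vcar W"
  shows "x \<otimes>\<^bsub>V,W\<^esub> y \<in> vcar (tensor_space V W)"
proof -
  interpret vector_space "tensor_scale :: 'k \<Rightarrow> ('k, 'a, 'b) tensor \<Rightarrow> _"
    by (rule vector_space_tensor_scale)
  show ?thesis unfolding tensor_space_def using assms by (auto intro!: span_base)
qed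

lemma tens_linear:
  assumes "x \<in> vcar V" "x' \<in> vcar V" "y \<in> vcar W" "y' \<in> vcar W"
  shows "(x + x') \<otimes>\<^bsub>V,W\<^esub> y = x \<otimes>\<^bsub>V,W\<^esub> y + x' \<otimes>\<^bsub>V,W\<^esub> y"
    and "x \<otimes>\<^bsub>V,W\<^esub> (y + y') = x \<otimes>\<^bsub>V,W\<^esub> y + x \<otimes>\<^bsub>V,W\<^esub> y'"
    and "x \<otimes>\<^bsub>V,W\<^esub> vscale W c y = tensor_scale c (x \<otimes>\<^bsub>V,W\<^esub> y)"
  using assms
  by (auto simp: tens_def tensor_scale_def bilinear_map_def linear_map_def ground_def fun_eq_iff)

lemma bilinear_map_tens: "bilinear_map V W (tensor_space V W) (tens V W)"
  unfolding bilinear_map_def linear_map_def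
  by (auto simp: tens_closed tens_linear tens_scale_left tensor_space_def[THEN arg_cong[where f = vscale]])

lemmas linear_map_tens_left [lin] = bilinear_map_left[OF bilinear_map_tens]
lemmas linear_map_tens_right [lin] = bilinear_map_right[OF bilinear_map_tens]

lemma scaled_tens:
  assumes "x \<in> vcar V" "y \<in> vcar V" "is_vspace V"
  shows "vscale V c x \<otimes>\<^bsub>V,V\<^esub> vscale V d y = vscale (tensor_space V V) d (vscale (tensor_space V V) c (x \<otimes>\<^bsub>V,V\<^esub> y))"
  using assms by (simp add: tens_scale_left tens_linear[OF _ assms(1) _ assms(1)] is_vspaceD tensor_space_def tensor_scale_def fun_eq_iff mult.left_commute)

text \<open>
  The space underlying \<open>A # H\<close> is \<open>A \<otimes> H\<close>, but as a record it is a different object. This lemma makes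
  tensors over the two records interchangeable.
\<close>
lemma tens_carrier_cong:
  assumes "vcar V = vcar V'" "vscale V = vscale V'" "vcar W = vcar W'" "vscale W = vscale W'"
  shows "tens V W = tens V' W'" "tensor_lift V W = tensor_lift V' W'"
proof -
  have *: "bilinear_map V W ground = bilinear_map V' W' ground"
    unfolding bilinear_map_def linear_map_def fun_eq_iff by (simp add: assms)
  show t: "tens V W = tens V' W'" unfolding tens_def fun_eq_iff by (simp add: *)
  show "tensor_lift V W = tensor_lift V' W'"
    unfolding tensor_lift_def presents_def fun_eq_iff by (simp add: t assms)
qed

text \<open>
  One list of pairs presents \<open>t\<close> and computes \<open>tensor_lift V W \<beta> t\<close> for every \<open>\<beta>\<close>, bilinear or not,
  since the list is chosen before \<open>\<beta>\<close> enters.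
\<close>
lemma tensor_presentation:
  assumes "is_vspace V" "t \<in> vcar (tensor_space V W)"
  obtains xs where "set xs \<subseteq> vcar V \<times> vcar W" "t = (\<Sum>(x, y)\<leftarrow>xs. x \<otimes>\<^bsub>V,W\<^esub> y)"
    "\<And>\<beta> :: _ \<Rightarrow> _ \<Rightarrow> 'c::ab_group_add. tensor_lift V W \<beta> t = (\<Sum>(x, y)\<leftarrow>xs. \<beta> x y)"
proof -
  have "presents V W (SOME xs. presents V W xs t) t"
    using presentsE[OF assms] by (metis someI)
  thus ?thesis using that unfolding presents_def tensor_lift_def by blast
qed

lemma sum_list_linear_map:
  assumes "linear_map V W \<phi>" "is_vspace V" "\<And>z. z \<in> set zs \<Longrightarrow> F z \<in> vcar V"
  shows "(\<Sum>z\<leftarrow>zs. F z) \<in> vcar V \<and> \<phi> (\<Sum>z\<leftarrow>zs. F z) = (\<Sum>z\<leftarrow>zs. \<phi> (F z))"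
  using assms(3)
  by (induction zs) (auto simp: linear_map_zero[OF assms(1,2)] is_vspaceD[OF assms(2)]
        linear_mapD[OF assms(1)])

lemma tensor_lift_closed:
  fixes U :: "('a::field, 'c::ab_group_add, 'u) vspace_scheme"
    and V :: "('a, 'b::ab_group_add, 'v) vspace_scheme"
    and W :: "('a, 'd::ab_group_add, 'w) vspace_scheme"
  assumes "is_vspace V" "is_vspace U" "t \<in> vcar (tensor_space V W)"
    and "\<And>x y. x \<in> vcar V \<Longrightarrow> y \<in> vcar W \<Longrightarrow> F x y \<in> vcar U"
  shows "tensor_lift V W F t \<in> vcar U"
proof (rule tensor_presentation[OF assms(1,3)])
  fix xs assume xs: "set xs \<subseteq> vcar V \<times> vcar W"
    "\<And>\<beta> :: 'b \<Rightarrow> 'd \<Rightarrow> 'c. tensor_lift V W \<beta> t = (\<Sum>(x, y)\<leftarrow>xs. \<beta> x y)"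
  show ?thesis
    using sum_list_linear_map[OF linear_map_id assms(2), of xs "\<lambda>(x, y). F x y"] xs(1) assms(4)
    by (auto simp: xs(2))
qed

lemma tensor_lift_cong:
  fixes F :: "'b::ab_group_add \<Rightarrow> 'd::ab_group_add \<Rightarrow> 'c::ab_group_add"
    and V :: "('a::field, 'b, 'v) vspace_scheme"
    and W :: "('a, 'd, 'w) vspace_scheme"
  assumes "is_vspace V" "t \<in> vcar (tensor_space V W)"
    and "\<And>x y. x \<in> vcar V \<Longrightarrow> y \<in> vcar W \<Longrightarrow> F x y = G x y"
  shows "tensor_lift V W F t = tensor_lift V W G t"
proof (rule tensor_presentation[OF assms(1,2)])
  fix xs assume xs: "set xs \<subseteq> vcar V \<times> vcar W"
    "\<And>\<beta> :: 'b \<Rightarrow> 'd \<Rightarrow> 'c. tensor_lift V W \<beta> t = (\<Sum>(x, y)\<leftarrow>xs. \<beta> x y)"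
  show ?thesis unfolding xs(2) using xs(1) assms(3) by (intro arg_cong[where f = sum_list] map_cong) auto
qed

lemma linear_map_tensor_lift:
  assumes "linear_map U X \<phi>" "is_vspace V" "is_vspace U" "t \<in> vcar (tensor_space V W)"
    and "\<And>x y. x \<in> vcar V \<Longrightarrow> y \<in> vcar W \<Longrightarrow> F x y \<in> vcar U"
  shows "\<phi> (tensor_lift V W F t) = tensor_lift V W (\<lambda>x y. \<phi> (F x y)) t"
proof -
  define xs where "xs = (SOME xs. presents V W xs t)"
  note l = xs_def
  obtain ys where "presents V W ys t" using assms(2,4) by (rule presentsE)
  hence "presents V W xs t" unfolding xs_def by (rule someI)
  hence xs: "set xs \<subseteq> vcar V \<times> vcar W" by (simp add: presents_def)
  have "F x y \<in> vcar U" if "(x, y) \<in> set xs" for x y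
    using that xs assms(5) by auto
  thus ?thesis
    using sum_list_linear_map[OF assms(1,3), of xs "\<lambda>(x, y). F x y"]
    unfolding tensor_lift_def l[symmetric] by (auto simp: case_prod_unfold)
qed

text \<open>
  The pure tensors span.
\<close>
lemma tensor_space_eqI:
  assumes "linear_map (tensor_space V W) U \<phi>" "linear_map (tensor_space V W) U \<psi>" "is_vspace V"
    and "\<And>x y. x \<in> vcar V \<Longrightarrow> y \<in> vcar W \<Longrightarrow> \<phi> (x \<otimes>\<^bsub>V,W\<^esub> y) = \<psi> (x \<otimes>\<^bsub>V,W\<^esub> y)"
    and t: "t \<in> vcar (tensor_space V W)"
  shows "\<phi> t = \<psi> t"
proof (rule tensor_presentation[OF assms(3) t])
  fix xs assume xs: "set xs \<subseteq> vcar V \<times> vcar W" "t = (\<Sum>(x, y)\<leftarrow>xs. x \<otimes>\<^bsub>V,W\<^esub> y)"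
  have "(x, y) \<in> set xs \<Longrightarrow> x \<otimes>\<^bsub>V,W\<^esub> y \<in> vcar (tensor_space V W)" for x y
    using xs(1) by (auto intro: tens_closed)
  hence "\<phi> t = (\<Sum>(x, y)\<leftarrow>xs. \<phi> (x \<otimes>\<^bsub>V,W\<^esub> y))" "\<psi> t = (\<Sum>(x, y)\<leftarrow>xs. \<psi> (x \<otimes>\<^bsub>V,W\<^esub> y))"
    unfolding xs(2)
    using sum_list_linear_map[OF assms(1) is_vspace_tensor_space, of xs "\<lambda>(x, y). x \<otimes>\<^bsub>V,W\<^esub> y"]
      sum_list_linear_map[OF assms(2) is_vspace_tensor_space, of xs "\<lambda>(x, y). x \<otimes>\<^bsub>V,W\<^esub> y"]
    by (auto simp: case_prod_unfold)
  thus ?thesis using xs(1) assms(4)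
    by (auto intro!: arg_cong[where f = sum_list] map_cong)
qed

lemma tensor_lift_swap:
  "tensor_lift V W (\<lambda>x y. tensor_lift V' W' (\<lambda>z w. F x y z w) s) t =
   tensor_lift V' W' (\<lambda>z w. tensor_lift V W (\<lambda>x y. F x y z w) t) s"
proof -
  have "(\<Sum>(x, y)\<leftarrow>xs. \<Sum>(z, w)\<leftarrow>ys. F x y z w) = (\<Sum>(z, w)\<leftarrow>ys. \<Sum>(x, y)\<leftarrow>xs. F x y z w)" for xs ys
    by (induction xs) (auto simp: sum_list_addf case_prod_unfold)
  thus ?thesis by (simp add: tensor_lift_def)
qed

lemma linear_map_tensor_lift_arg [lin]:
  fixes U :: "('a::field, 'c::ab_group_add, 'u) vspace_scheme"
    and V :: "('a, 'b::ab_group_add, 'v) vspace_scheme"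
    and W :: "('a, 'd::ab_group_add, 'w) vspace_scheme"
  assumes "is_vspace V" "is_vspace U" "\<And>x y. x \<in> vcar V \<Longrightarrow> y \<in> vcar W \<Longrightarrow> linear_map X U (\<lambda>z. F x y z)"
    and t: "t \<in> vcar (tensor_space V W)"
  shows "linear_map X U (\<lambda>z. tensor_lift V W (\<lambda>x y. F x y z) t)"
proof (rule tensor_presentation[OF assms(1) t])
  fix xs assume xs: "set xs \<subseteq> vcar V \<times> vcar W"
    "\<And>\<beta> :: 'b \<Rightarrow> 'd \<Rightarrow> 'c. tensor_lift V W \<beta> t = (\<Sum>(x, y)\<leftarrow>xs. \<beta> x y)"
  interpret U: vector_space "vscale U" using assms(2) by (rule is_vspaceD)
  have "linear_map X U (\<lambda>z. \<Sum>(x, y)\<leftarrow>xs. F x y z)"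
    using xs(1)
  proof (induction xs)
    case Nil
    show ?case by (auto simp: linear_map_def is_vspaceD[OF assms(2)])
  next
    case (Cons p xs)
    obtain x y where p: "p = (x, y)" by (cases p)
    have "linear_map X U (F x y)" "linear_map X U (\<lambda>z. \<Sum>(x, y)\<leftarrow>xs. F x y z)"
      using Cons p assms(3) by auto
    thus ?case 
      by (auto simp: linear_map_def p is_vspaceD[OF assms(2)] U.scale_right_distrib Pi_iff)
  qed
  thus ?thesis by (simp add: xs(2))
qed

lemma linear_map_tensor_lift_comp [lin]:
  assumes "is_vspace V" "is_vspace U" "bilinear_map V W U \<beta>" "linear_map X (tensor_space V W) g"
  shows "linear_map X U (\<lambda>z. tensor_lift V W \<beta> (g z))"
  using assms by (intro linear_map_comp[OF assms(4)] tensor_lift_linear)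

section \<open>Sweedler sums\<close>

lemma coalgebraD:
  assumes "coalgebra C"
  shows "is_vspace C" "linear_map C (tensor_space C C) (comul C)" "linear_map C ground (counit C)"
  using assms by (auto simp: coalgebra_def)

lemma comul_closed:
  assumes "coalgebra C" "c \<in> vcar C"
  shows "comul C c \<in> vcar (tensor_space C C)"
  using linear_mapD(1)[OF coalgebraD(2)] assms .

lemma linear_map_counit [lin]:
  "coalgebra C \<Longrightarrow> linear_map V C g \<Longrightarrow> linear_map V ground (\<lambda>x. counit C (g x))"
  by (rule linear_map_comp[OF _ coalgebraD(3)])

lemma counit_scale: "coalgebra C \<Longrightarrow> c \<in> vcar C \<Longrightarrow> counit C (vscale C k c) = k * counit C c"
  using linear_mapD(3)[OF coalgebraD(3)] by (fastforce simp: ground_def)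

lemma sw2_closed [lin]:
  fixes C :: "('k::field, 'a::ab_group_add, 'm) coalg_scheme"
    and U :: "('k, 'u::ab_group_add, 'p) vspace_scheme"
  assumes "coalgebra C" "is_vspace U" "\<And>x y. x \<in> vcar C \<Longrightarrow> y \<in> vcar C \<Longrightarrow> F x y \<in> vcar U"
    "c \<in> vcar C"
  shows "sw2 C c F \<in> vcar U"
  unfolding sw2_def
  by (rule tensor_lift_closed[OF coalgebraD(1)[OF assms(1)] assms(2) comul_closed[OF assms(1,4)]])
    (rule assms(3))

lemma sw2_cong:
  assumes "coalgebra C" "c \<in> vcar C" "\<And>x y. x \<in> vcar C \<Longrightarrow> y \<in> vcar C \<Longrightarrow> F x y = G x y"
  shows "sw2 C c F = sw2 C c G"
  unfolding sw2_def
  by (rule tensor_lift_cong[OF coalgebraD(1)[OF assms(1)] comul_closed[OF assms(1,2)]])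
    (rule assms(3))

lemma linear_map_sw2:
  fixes C :: "('k::field, 'a::ab_group_add, 'm) coalg_scheme"
    and U :: "('k, 'u::ab_group_add, 'p) vspace_scheme"
    and X :: "('k, 'x::ab_group_add, 'q) vspace_scheme"
  assumes "linear_map U X \<phi>" "is_vspace U" "coalgebra C" "c \<in> vcar C"
    and "\<And>x y. x \<in> vcar C \<Longrightarrow> y \<in> vcar C \<Longrightarrow> F x y \<in> vcar U"
  shows "\<phi> (sw2 C c F) = sw2 C c (\<lambda>x y. \<phi> (F x y))"
  unfolding sw2_def
  by (rule linear_map_tensor_lift[OF assms(1) coalgebraD(1)[OF assms(3)] assms(2)
        comul_closed[OF assms(3,4)]])
    (rule assms(5))

lemma sw2_vscale:
  fixes C :: "('k::field, 'a::ab_group_add, 'm) coalg_scheme"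
    and U :: "('k, 'u::ab_group_add, 'p) vspace_scheme"
  assumes "coalgebra C" "c \<in> vcar C" "is_vspace U" 
    "\<And>x y. x \<in> vcar C \<Longrightarrow> y \<in> vcar C \<Longrightarrow> F x y \<in> vcar U"
  shows "sw2 C c (\<lambda>x y. vscale U k (F x y)) = vscale U k (sw2 C c F)"
  by (rule linear_map_sw2[symmetric, OF linear_map_vscale[OF assms(3) linear_map_id] assms(3,1,2)])
    (rule assms(4))

lemma sw2_swap:
  "sw2 C c (\<lambda>x y. sw2 D d (\<lambda>z w. F x y z w)) = sw2 D d (\<lambda>z w. sw2 C c (\<lambda>x y. F x y z w))"
  unfolding sw2_def by (rule tensor_lift_swap)

lemma linear_map_sw2_arg [lin]:
  fixes C :: "('k::field, 'a::ab_group_add, 'm) coalg_scheme"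
    and U :: "('k, 'u::ab_group_add, 'p) vspace_scheme"
    and X :: "('k, 'x::ab_group_add, 'q) vspace_scheme"
  assumes "coalgebra C" "is_vspace U"
    "\<And>x y. x \<in> vcar C \<Longrightarrow> y \<in> vcar C \<Longrightarrow> linear_map X U (\<lambda>z. F x y z)" "c \<in> vcar C"
  shows "linear_map X U (\<lambda>z. sw2 C c (\<lambda>x y. F x y z))"
  unfolding sw2_def
  by (rule linear_map_tensor_lift_arg[OF coalgebraD(1)[OF assms(1)] assms(2) _
        comul_closed[OF assms(1,4)]]) (rule assms(3))

lemma linear_map_sw2_comp [lin]:
  fixes C :: "('k::field, 'a::ab_group_add, 'm) coalg_scheme"
    and U :: "('k, 'u::ab_group_add, 'p) vspace_scheme"
    and X :: "('k, 'x::ab_group_add, 'q) vspace_scheme"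
  assumes "coalgebra C" "is_vspace U" "bilinear_map C C U F" "linear_map X C g"
  shows "linear_map X U (\<lambda>z. sw2 C (g z) F)"
  unfolding sw2_def
  by (rule linear_map_tensor_lift_comp[OF coalgebraD(1)[OF assms(1)] assms(2,3)
        linear_map_comp[OF assms(4) coalgebraD(2)[OF assms(1)]]])

text \<open>
  The rule behind all substitutions in Sweedler sums: any presentation of \<open>\<Delta>(y)\<close>, here one that is
  indexed by the Sweedler components of another element \<open>c\<close>, computes the Sweedler sums of \<open>y\<close>.
\<close>
lemma sw2_expand:
  fixes C :: "('k::field, 'a::ab_group_add, 'm) coalg_scheme"
    and D :: "('k, 'd::ab_group_add, 'n) coalg_scheme"
    and U :: "('k, 'u::ab_group_add, 'p) vspace_scheme"
  assumes "coalgebra C" "coalgebra D" "c \<in> vcar C" "is_vspace U" "bilinear_map D D U F"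
    and "comul D y = sw2 C c (\<lambda>x1 x2. s x1 x2 \<otimes>\<^bsub>D,D\<^esub> t x1 x2)"
    and "\<And>x1 x2. x1 \<in> vcar C \<Longrightarrow> x2 \<in> vcar C \<Longrightarrow> s x1 x2 \<in> vcar D"
    and "\<And>x1 x2. x1 \<in> vcar C \<Longrightarrow> x2 \<in> vcar C \<Longrightarrow> t x1 x2 \<in> vcar D"
  shows "sw2 D y F = sw2 C c (\<lambda>x1 x2. F (s x1 x2) (t x1 x2))"
proof -
  note D = coalgebraD[OF assms(2)]
  have "sw2 D y F = tensor_lift D D F (sw2 C c (\<lambda>x1 x2. s x1 x2 \<otimes>\<^bsub>D,D\<^esub> t x1 x2))"
    by (simp add: sw2_def[of D] assms(6))
  also have "\<dots> = sw2 C c (\<lambda>x1 x2. tensor_lift D D F (s x1 x2 \<otimes>\<^bsub>D,D\<^esub> t x1 x2))"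
    by (intro linear_map_sw2[OF tensor_lift_linear[OF D(1) assms(4,5)] is_vspace_tensor_space] lin assms)
  also have "\<dots> = sw2 C c (\<lambda>x1 x2. F (s x1 x2) (t x1 x2))"
    using assms by (intro sw2_cong tensor_lift_tens) auto
  finally show ?thesis .
qed

lemma sw2_expand2:
  fixes C :: "('k::field, 'a::ab_group_add, 'm) coalg_scheme"
    and C' :: "('k, 'b::ab_group_add, 'o) coalg_scheme"
    and D :: "('k, 'd::ab_group_add, 'n) coalg_scheme"
    and U :: "('k, 'u::ab_group_add, 'p) vspace_scheme"
  assumes "coalgebra C" "coalgebra C'" "coalgebra D" "c \<in> vcar C" "c' \<in> vcar C'" "is_vspace U"
    "bilinear_map D D U F"
    and "comul D y = sw2 C c (\<lambda>x1 x2. sw2 C' c' (\<lambda>y1 y2. s x1 y1 \<otimes>\<^bsub>D,D\<^esub> s x2 y2))"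
    and "\<And>x y. x \<in> vcar C \<Longrightarrow> y \<in> vcar C' \<Longrightarrow> s x y \<in> vcar D"
  shows "sw2 D y F = sw2 C c (\<lambda>x1 x2. sw2 C' c' (\<lambda>y1 y2. F (s x1 y1) (s x2 y2)))"
proof -
  note D = coalgebraD[OF assms(3)]
  note lift = linear_map_sw2[OF tensor_lift_linear[OF D(1) assms(6,7)] is_vspace_tensor_space]
  have "sw2 D y F = tensor_lift D D F (sw2 C c (\<lambda>x1 x2. sw2 C' c' (\<lambda>y1 y2. s x1 y1 \<otimes>\<^bsub>D,D\<^esub> s x2 y2)))"
    by (simp add: sw2_def[of D] assms(8))
  also have "\<dots> = sw2 C c (\<lambda>x1 x2. tensor_lift D D F (sw2 C' c' (\<lambda>y1 y2. s x1 y1 \<otimes>\<^bsub>D,D\<^esub> s x2 y2)))"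
    by (intro lift lin assms)
  also have "\<dots> = sw2 C c (\<lambda>x1 x2. sw2 C' c' (\<lambda>y1 y2. tensor_lift D D F (s x1 y1 \<otimes>\<^bsub>D,D\<^esub> s x2 y2)))"
    by (intro sw2_cong lift lin assms)
  also have "\<dots> = sw2 C c (\<lambda>x1 x2. sw2 C' c' (\<lambda>y1 y2. F (s x1 y1) (s x2 y2)))"
    using assms by (intro sw2_cong tensor_lift_tens) auto
  finally show ?thesis .
qed

text \<open>
  Coassociativity is given for \<open>F x y z = x \<otimes> (y \<otimes> z)\<close>; any trilinear \<open>F\<close> factors through this
  one by the universal property of the tensor product.
\<close>
lemma sw2_coassoc:
  fixes C :: "('k::field, 'a::ab_group_add, 'm) coalg_scheme"
    and U :: "('k, 'u::ab_group_add, 'p) vspace_scheme"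
  assumes C: "coalgebra C" and c: "c \<in> vcar C" and U: "is_vspace U"
    and F: "\<And>y z. y \<in> vcar C \<Longrightarrow> z \<in> vcar C \<Longrightarrow> linear_map C U (\<lambda>x. F x y z)"
      "\<And>x z. x \<in> vcar C \<Longrightarrow> z \<in> vcar C \<Longrightarrow> linear_map C U (\<lambda>y. F x y z)"
      "\<And>x y. x \<in> vcar C \<Longrightarrow> y \<in> vcar C \<Longrightarrow> linear_map C U (\<lambda>z. F x y z)"
  shows "sw2 C c (\<lambda>d z. sw2 C d (\<lambda>x y. F x y z)) = sw2 C c (\<lambda>x d. sw2 C d (\<lambda>y z. F x y z))"
proof -
  let ?T = "tensor_space C C"
  note V = coalgebraD[OF C]
  define L where "L = tensor_lift C ?T (\<lambda>x t. tensor_lift C C (\<lambda>y z. F x y z) t)"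
  have bil: "bilinear_map C ?T U (\<lambda>x t. tensor_lift C C (\<lambda>y z. F x y z) t)"
    by (intro lin V U F)
  have bil': "bilinear_map C C U (\<lambda>y z. F x y z)" if "x \<in> vcar C" for x
    by (intro lin V U F that)
  have L: "linear_map (tensor_space C ?T) U L"
    unfolding L_def by (intro tensor_lift_linear V U bil)
  have Lt: "L (x \<otimes>\<^bsub>C,?T\<^esub> (y \<otimes>\<^bsub>C,C\<^esub> z)) = F x y z" if "x \<in> vcar C" "y \<in> vcar C" "z \<in> vcar C" for x y z
    unfolding L_def
    by (subst tensor_lift_tens[OF U bil]) (auto intro: tens_closed tensor_lift_tens[OF U bil'] that)
  have "sw2 C c (\<lambda>d z. sw2 C d (\<lambda>x y. F x y z)) =
      sw2 C c (\<lambda>d z. sw2 C d (\<lambda>x y. L (x \<otimes>\<^bsub>C,?T\<^esub> (y \<otimes>\<^bsub>C,C\<^esub> z))))"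
    by (intro sw2_cong C c) (auto simp: Lt)
  also have "\<dots> = sw2 C c (\<lambda>d z. L (sw2 C d (\<lambda>x y. x \<otimes>\<^bsub>C,?T\<^esub> (y \<otimes>\<^bsub>C,C\<^esub> z))))"
    by (intro sw2_cong C c linear_map_sw2[OF L, symmetric] lin)
  also have "\<dots> = L (sw2 C c (\<lambda>d z. sw2 C d (\<lambda>x y. x \<otimes>\<^bsub>C,?T\<^esub> (y \<otimes>\<^bsub>C,C\<^esub> z))))"
    by (intro C c linear_map_sw2[OF L, symmetric] lin)
  also have "\<dots> = L (sw2 C c (\<lambda>x d. sw2 C d (\<lambda>y z. x \<otimes>\<^bsub>C,?T\<^esub> (y \<otimes>\<^bsub>C,C\<^esub> z))))"
    using C c by (simp add: coalgebra_def)
  also have "\<dots> = sw2 C c (\<lambda>x d. L (sw2 C d (\<lambda>y z. x \<otimes>\<^bsub>C,?T\<^esub> (y \<otimes>\<^bsub>C,C\<^esub> z))))"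
    by (intro C c linear_map_sw2[OF L] lin)
  also have "\<dots> = sw2 C c (\<lambda>x d. sw2 C d (\<lambda>y z. L (x \<otimes>\<^bsub>C,?T\<^esub> (y \<otimes>\<^bsub>C,C\<^esub> z))))"
    by (intro sw2_cong C c linear_map_sw2[OF L] lin)
  also have "\<dots> = sw2 C c (\<lambda>x d. sw2 C d (\<lambda>y z. F x y z))"
    by (intro sw2_cong C c) (auto simp: Lt)
  finally show ?thesis .
qed

lemma sw2_counit:
  fixes C :: "('k::field, 'a::ab_group_add, 'm) coalg_scheme"
    and U :: "('k, 'u::ab_group_add, 'p) vspace_scheme"
  assumes C: "coalgebra C" and c: "c \<in> vcar C" and G: "linear_map C U G"
  shows "sw2 C c (\<lambda>x y. vscale U (counit C x) (G y)) = G c"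
    and "sw2 C c (\<lambda>x y. vscale U (counit C y) (G x)) = G c"
proof -
  note V = coalgebraD(1)[OF C]
  have "sw2 C c (\<lambda>x y. vscale U (counit C x) (G y)) = sw2 C c (\<lambda>x y. G (vscale C (counit C x) y))"
    by (intro sw2_cong C c) (simp add: linear_mapD[OF G])
  also have "\<dots> = G (sw2 C c (\<lambda>x y. vscale C (counit C x) y))"
    by (intro linear_map_sw2[OF G, symmetric] C c V is_vspaceD)
  also have "\<dots> = G c" using C c by (simp add: coalgebra_def)
  finally show "sw2 C c (\<lambda>x y. vscale U (counit C x) (G y)) = G c" .
  have "sw2 C c (\<lambda>x y. vscale U (counit C y) (G x)) = sw2 C c (\<lambda>x y. G (vscale C (counit C y) x))"
    by (intro sw2_cong C c) (simp add: linear_mapD[OF G])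
  also have "\<dots> = G (sw2 C c (\<lambda>x y. vscale C (counit C y) x))"
    by (intro linear_map_sw2[OF G, symmetric] C c V is_vspaceD)
  also have "\<dots> = G c" using C c by (simp add: coalgebra_def)
  finally show "sw2 C c (\<lambda>x y. vscale U (counit C y) (G x)) = G c" .
qed

lemma sw3_swap: "sw3 C c (\<lambda>x y z. sw2 D d (\<lambda>s t. F x y z s t)) = sw2 D d (\<lambda>s t. sw3 C c (\<lambda>x y z. F x y z s t))"
  unfolding sw3_def by (subst sw2_swap) (simp only: sw2_swap[of C _ D d])

lemma linear_map_sw3_arg [lin]:
  fixes C :: "('k::field, 'a::ab_group_add, 'm) coalg_scheme"
    and U :: "('k, 'u::ab_group_add, 'p) vspace_scheme"
    and X :: "('k, 'x::ab_group_add, 'q) vspace_scheme"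
  assumes "coalgebra C" "is_vspace U"
    "\<And>x y z. x \<in> vcar C \<Longrightarrow> y \<in> vcar C \<Longrightarrow> z \<in> vcar C \<Longrightarrow> linear_map X U (\<lambda>s. F x y z s)" "c \<in> vcar C"
  shows "linear_map X U (\<lambda>s. sw3 C c (\<lambda>x y z. F x y z s))"
  unfolding sw3_def by (intro lin assms)

lemma linear_map_sw3:
  fixes C :: "('k::field, 'a::ab_group_add, 'm) coalg_scheme"
    and U :: "('k, 'u::ab_group_add, 'p) vspace_scheme"
    and X :: "('k, 'x::ab_group_add, 'q) vspace_scheme"
  assumes "linear_map U X \<phi>" "is_vspace U" "coalgebra C" "c \<in> vcar C"
    and "\<And>x y z. x \<in> vcar C \<Longrightarrow> y \<in> vcar C \<Longrightarrow> z \<in> vcar C \<Longrightarrow> F x y z \<in> vcar U"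
  shows "\<phi> (sw3 C c F) = sw3 C c (\<lambda>x y z. \<phi> (F x y z))"
  unfolding sw3_def
  by (subst linear_map_sw2[OF assms(1-4)])
    (intro lin assms sw2_cong linear_map_sw2[OF assms(1-3)]; assumption)+

definition trilinear_map where
  "trilinear_map V U F \<longleftrightarrow>
    (\<forall>x\<in>vcar V. bilinear_map V V U (F x)) \<and>
    (\<forall>y\<in>vcar V. \<forall>z\<in>vcar V. linear_map V U (\<lambda>x. F x y z))"

lemma trilinear_mapI [lin]:
  assumes "\<And>y z. y \<in> vcar V \<Longrightarrow> z \<in> vcar V \<Longrightarrow> linear_map V U (\<lambda>x. F x y z)"
    and "\<And>x z. x \<in> vcar V \<Longrightarrow> z \<in> vcar V \<Longrightarrow> linear_map V U (\<lambda>y. F x y z)"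
    and "\<And>x y. x \<in> vcar V \<Longrightarrow> y \<in> vcar V \<Longrightarrow> linear_map V U (\<lambda>z. F x y z)"
  shows "trilinear_map V U F"
  using assms by (simp add: trilinear_map_def bilinear_map_def)

lemma trilinear_mapD:
  assumes "trilinear_map V U F"
  shows "y \<in> vcar V \<Longrightarrow> z \<in> vcar V \<Longrightarrow> linear_map V U (\<lambda>x. F x y z)"
    and "x \<in> vcar V \<Longrightarrow> bilinear_map V V U (F x)"
  using assms by (auto simp add: trilinear_map_def)

lemma bilinear_map_sw2_inner:
  assumes "coalgebra C" "is_vspace U" "trilinear_map C U F"
  shows "bilinear_map C C U (\<lambda>x d. sw2 C d (F x))"
  by (intro lin assms trilinear_mapD(2)[OF assms(3)] trilinear_mapD(1)[OF assms(3)])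

lemma linear_map_sw3_comp [lin]:
  fixes C :: "('k::field, 'a::ab_group_add, 'm) coalg_scheme"
    and U :: "('k, 'u::ab_group_add, 'p) vspace_scheme"
    and X :: "('k, 'x::ab_group_add, 'q) vspace_scheme"
  assumes "coalgebra C" "is_vspace U" "trilinear_map C U F" "linear_map X C g"
  shows "linear_map X U (\<lambda>s. sw3 C (g s) F)"
  unfolding sw3_def by (intro linear_map_sw2_comp bilinear_map_sw2_inner assms)

lemma sw3_cong:
  assumes "coalgebra C" "c \<in> vcar C"
    "\<And>x y z. x \<in> vcar C \<Longrightarrow> y \<in> vcar C \<Longrightarrow> z \<in> vcar C \<Longrightarrow> F x y z = G x y z"
  shows "sw3 C c F = sw3 C c G"
  unfolding sw3_def by (intro sw2_cong assms)

lemma linear_map_sw5_arg [lin]: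
  fixes C :: "('k::field, 'a::ab_group_add, 'm) coalg_scheme"
    and U :: "('k, 'u::ab_group_add, 'p) vspace_scheme"
    and X :: "('k, 'x::ab_group_add, 'q) vspace_scheme"
  assumes "coalgebra C" "is_vspace U"
    "\<And>x y z w v. x \<in> vcar C \<Longrightarrow> y \<in> vcar C \<Longrightarrow> z \<in> vcar C \<Longrightarrow> w \<in> vcar C \<Longrightarrow> v \<in> vcar C \<Longrightarrow>
      linear_map X U (\<lambda>s. F x y z w v s)" "c \<in> vcar C"
  shows "linear_map X U (\<lambda>s. sw5 C c (\<lambda>x y z w v. F x y z w v s))"
  unfolding sw5_def sw4_def by (intro lin assms)

text \<open>
  Generalized coassociativity: splitting \<open>c\<close> in two and then its parts into three and two
  gives the same five components as repeatedly splitting off the first one.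
\<close>
lemma sw5_regroup:
  fixes C :: "('k::field, 'a::ab_group_add, 'm) coalg_scheme"
    and U :: "('k, 'u::ab_group_add, 'p) vspace_scheme"
  assumes C: "coalgebra C" and c: "c \<in> vcar C" and U: "is_vspace U"
    and F: "\<And>y z w v. y \<in> vcar C \<Longrightarrow> z \<in> vcar C \<Longrightarrow> w \<in> vcar C \<Longrightarrow> v \<in> vcar C \<Longrightarrow> linear_map C U (\<lambda>x. F x y z w v)"
      "\<And>x z w v. x \<in> vcar C \<Longrightarrow> z \<in> vcar C \<Longrightarrow> w \<in> vcar C \<Longrightarrow> v \<in> vcar C \<Longrightarrow> linear_map C U (\<lambda>y. F x y z w v)"
      "\<And>x y w v. x \<in> vcar C \<Longrightarrow> y \<in> vcar C \<Longrightarrow> w \<in> vcar C \<Longrightarrow> v \<in> vcar C \<Longrightarrow> linear_map C U (\<lambda>z. F x y z w v)"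
      "\<And>x y z v. x \<in> vcar C \<Longrightarrow> y \<in> vcar C \<Longrightarrow> z \<in> vcar C \<Longrightarrow> v \<in> vcar C \<Longrightarrow> linear_map C U (\<lambda>w. F x y z w v)"
      "\<And>x y z w. x \<in> vcar C \<Longrightarrow> y \<in> vcar C \<Longrightarrow> z \<in> vcar C \<Longrightarrow> w \<in> vcar C \<Longrightarrow> linear_map C U (\<lambda>v. F x y z w v)"
  shows "sw2 C c (\<lambda>d e. sw3 C d (\<lambda>x y z. sw2 C e (\<lambda>w v. F x y z w v))) = sw5 C c F"
proof -
  \<comment> \<open>The first component of \<open>d\<close> is split off, then the second.\<close>
  have "sw2 C c (\<lambda>d e. sw3 C d (\<lambda>x y z. sw2 C e (\<lambda>w v. F x y z w v))) =
    sw2 C c (\<lambda>x d. sw2 C d (\<lambda>d' e. sw2 C d' (\<lambda>y z. sw2 C e (\<lambda>w v. F x y z w v))))"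
    unfolding sw3_def by (rule sw2_coassoc[OF C c U]) (intro lin C U F; assumption)+
  also have "\<dots> = sw2 C c (\<lambda>x d. sw2 C d (\<lambda>y d'. sw2 C d' (\<lambda>z e. sw2 C e (\<lambda>w v. F x y z w v))))"
    by (rule sw2_cong[OF C c], rule sw2_coassoc[OF C _ U]) (assumption | (intro lin C U F; assumption))+
  finally show ?thesis by (simp add: sw5_def sw4_def sw3_def)
qed

text \<open>
  Splitting both halves of \<open>c\<close> amounts to splitting its middle component, which brings the components
  \<open>c\<^sub>(\<^sub>2\<^sub>)\<close> and \<open>c\<^sub>(\<^sub>3\<^sub>)\<close> together as the two halves of one element.
\<close>
lemma sw4_regroup_middle:
  fixes C :: "('k::field, 'a::ab_group_add, 'm) coalg_scheme"
    and U :: "('k, 'u::ab_group_add, 'p) vspace_scheme"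
  assumes C: "coalgebra C" and c: "c \<in> vcar C" and U: "is_vspace U"
    and F: "\<And>y z w. y \<in> vcar C \<Longrightarrow> z \<in> vcar C \<Longrightarrow> w \<in> vcar C \<Longrightarrow> linear_map C U (\<lambda>x. F x y z w)"
      "\<And>x z w. x \<in> vcar C \<Longrightarrow> z \<in> vcar C \<Longrightarrow> w \<in> vcar C \<Longrightarrow> linear_map C U (\<lambda>y. F x y z w)"
      "\<And>x y w. x \<in> vcar C \<Longrightarrow> y \<in> vcar C \<Longrightarrow> w \<in> vcar C \<Longrightarrow> linear_map C U (\<lambda>z. F x y z w)"
      "\<And>x y z. x \<in> vcar C \<Longrightarrow> y \<in> vcar C \<Longrightarrow> z \<in> vcar C \<Longrightarrow> linear_map C U (\<lambda>w. F x y z w)"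
  shows "sw2 C c (\<lambda>d e. sw2 C d (\<lambda>x y. sw2 C e (\<lambda>z w. F x y z w))) =
    sw2 C c (\<lambda>x d. sw2 C d (\<lambda>e w. sw2 C e (\<lambda>y z. F x y z w)))"
proof -
  have "sw2 C c (\<lambda>d e. sw2 C d (\<lambda>x y. sw2 C e (\<lambda>z w. F x y z w))) =
    sw2 C c (\<lambda>x d. sw2 C d (\<lambda>y e. sw2 C e (\<lambda>z w. F x y z w)))"
    by (rule sw2_coassoc[OF C c U]) (intro lin C U F; assumption)+
  also have "\<dots> = sw2 C c (\<lambda>x d. sw2 C d (\<lambda>e w. sw2 C e (\<lambda>y z. F x y z w)))"
    by (rule sw2_cong[OF C c], rule sw2_coassoc[OF C _ U, symmetric]) (assumption | (intro lin C U F; assumption))+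
  finally show ?thesis .
qed

lemma sw2_tens:
  assumes C: "coalgebra C" and c: "c \<in> vcar C"
  shows "sw2 C c (\<lambda>x y. x \<otimes>\<^bsub>C,C\<^esub> y) = comul C c"
proof -
  note V = coalgebraD[OF C]
  have bil: "bilinear_map C C (tensor_space C C) (\<lambda>x y. x \<otimes>\<^bsub>C,C\<^esub> y)" by (intro lin)
  show ?thesis unfolding sw2_def
    by (rule tensor_space_eqI[OF tensor_lift_linear[OF V(1) is_vspace_tensor_space bil] linear_map_id V(1)])
      (auto intro: tensor_lift_tens[OF is_vspace_tensor_space bil] comul_closed C c)
qed

section \<open>Maps compatible with comultiplication\<close>

lemma coalgebra_homD:
  assumes "coalgebra_hom C D \<phi>"
  shows "linear_map C D \<phi>"
    and "c \<in> vcar C \<Longrightarrow> comul D (\<phi> c) = sw2 C c (\<lambda>c1 c2. \<phi> c1 \<otimes>\<^bsub>D,D\<^esub> \<phi> c2)"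
    and "c \<in> vcar C \<Longrightarrow> counit D (\<phi> c) = counit C c"
    and "c \<in> vcar C \<Longrightarrow> \<phi> c \<in> vcar D"
  using assms by (auto simp: coalgebra_hom_def linear_map_def)

lemma sw2_hom:
  fixes C :: "('k::field, 'a::ab_group_add, 'm) coalg_scheme"
    and D :: "('k, 'd::ab_group_add, 'n) coalg_scheme"
    and U :: "('k, 'u::ab_group_add, 'p) vspace_scheme"
  assumes "coalgebra C" "coalgebra D" "is_vspace U" "coalgebra_hom C D \<phi>" "bilinear_map D D U F" "c \<in> vcar C"
  shows "sw2 D (\<phi> c) F = sw2 C c (\<lambda>x y. F (\<phi> x) (\<phi> y))"
  using assms by (intro sw2_expand[of C D c U F]) (auto simp: coalgebra_homD)

lemma sw3_hom:
  fixes C :: "('k::field, 'a::ab_group_add, 'm) coalg_scheme"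
    and D :: "('k, 'd::ab_group_add, 'n) coalg_scheme"
    and U :: "('k, 'u::ab_group_add, 'p) vspace_scheme"
  assumes "coalgebra C" "coalgebra D" "is_vspace U" "coalgebra_hom C D \<phi>" "trilinear_map D U F" "c \<in> vcar C"
  shows "sw3 D (\<phi> c) F = sw3 C c (\<lambda>x y z. F (\<phi> x) (\<phi> y) (\<phi> z))"
proof -
  have "sw3 D (\<phi> c) F = sw2 C c (\<lambda>x d. sw2 D (\<phi> d) (F (\<phi> x)))"
    unfolding sw3_def
    by (rule sw2_hom[OF assms(1-4) bilinear_map_sw2_inner[OF assms(2,3,5)] assms(6)])
  also have "\<dots> = sw2 C c (\<lambda>x d. sw2 C d (\<lambda>y z. F (\<phi> x) (\<phi> y) (\<phi> z)))"
    by (intro sw2_cong sw2_hom[OF assms(1-4)] assms trilinear_mapD(2)[OF assms(5)] coalgebra_homD(4)[OF assms(4)])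
  finally show ?thesis by (simp add: sw3_def)
qed

text \<open>
  Compatibility with comultiplication of a map in two variables; for bilinear \<open>s\<close> it says that the
  induced map \<open>C \<otimes> C' \<rightarrow> D\<close> respects comultiplication. Stating it pointwise avoids tensor products of
  coalgebras in the domain.
\<close>
definition comultiplicative2 where
  "comultiplicative2 C C' D s \<longleftrightarrow>
    (\<forall>x\<in>vcar C. \<forall>y\<in>vcar C'. s x y \<in> vcar D \<and>
      comul D (s x y) = sw2 C x (\<lambda>x1 x2. sw2 C' y (\<lambda>y1 y2. s x1 y1 \<otimes>\<^bsub>D,D\<^esub> s x2 y2)))"

lemma sw2_comultiplicative2:
  fixes C :: "('k::field, 'a::ab_group_add, 'm) coalg_scheme"
    and C' :: "('k, 'b::ab_group_add, 'o) coalg_scheme"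
    and D :: "('k, 'd::ab_group_add, 'n) coalg_scheme"
    and U :: "('k, 'u::ab_group_add, 'p) vspace_scheme"
  assumes "coalgebra C" "coalgebra C'" "coalgebra D" "is_vspace U" "comultiplicative2 C C' D s" "bilinear_map D D U F"
    "c \<in> vcar C" "c' \<in> vcar C'"
  shows "sw2 D (s c c') F = sw2 C c (\<lambda>x1 x2. sw2 C' c' (\<lambda>y1 y2. F (s x1 y1) (s x2 y2)))"
  using assms by (intro sw2_expand2[of C C' D c c' U F]) (auto simp: comultiplicative2_def)

lemma sw3_comultiplicative2:
  fixes C :: "('k::field, 'a::ab_group_add, 'm) coalg_scheme"
    and C' :: "('k, 'b::ab_group_add, 'o) coalg_scheme"
    and D :: "('k, 'd::ab_group_add, 'n) coalg_scheme"
    and U :: "('k, 'u::ab_group_add, 'p) vspace_scheme"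
  assumes "coalgebra C" "coalgebra C'" "coalgebra D" "is_vspace U" "comultiplicative2 C C' D s" "trilinear_map D U F"
    "c \<in> vcar C" "c' \<in> vcar C'"
  shows "sw3 D (s c c') F = sw3 C c (\<lambda>x1 x2 x3. sw3 C' c' (\<lambda>y1 y2 y3. F (s x1 y1) (s x2 y2) (s x3 y3)))"
proof -
  have s: "s x y \<in> vcar D" if "x \<in> vcar C" "y \<in> vcar C'" for x y
    using assms(5) that by (auto simp: comultiplicative2_def)
  have "sw3 D (s c c') F = sw2 C c (\<lambda>x1 x'. sw2 C' c' (\<lambda>y1 y'. sw2 D (s x' y') (F (s x1 y1))))"
    unfolding sw3_def
    by (rule sw2_comultiplicative2[OF assms(1-5) bilinear_map_sw2_inner[OF assms(3,4,6)] assms(7,8)])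
  also have "\<dots> = sw2 C c (\<lambda>x1 x'. sw2 C' c' (\<lambda>y1 y'. sw2 C x' (\<lambda>x2 x3. sw2 C' y' (\<lambda>y2 y3. F (s x1 y1) (s x2 y2) (s x3 y3)))))"
    by (intro sw2_cong sw2_comultiplicative2[OF assms(1-5)] assms trilinear_mapD(2)[OF assms(6)] s)
  also have "\<dots> = sw2 C c (\<lambda>x1 x'. sw2 C x' (\<lambda>x2 x3. sw2 C' c' (\<lambda>y1 y'. sw2 C' y' (\<lambda>y2 y3. F (s x1 y1) (s x2 y2) (s x3 y3)))))"
    by (subst sw2_swap) rule
  finally show ?thesis by (simp add: sw3_def)
qed

lemma comultiplicative2_cong:
  assumes "coalgebra C" "coalgebra D" "comultiplicative2 C D E s"
    "\<And>x y. x \<in> vcar C \<Longrightarrow> y \<in> vcar D \<Longrightarrow> s x y = t x y"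
  shows "comultiplicative2 C D E t"
proof -
  have "sw2 C x (\<lambda>x1 x2. sw2 D y (\<lambda>y1 y2. s x1 y1 \<otimes>\<^bsub>E,E\<^esub> s x2 y2)) = sw2 C x (\<lambda>x1 x2. sw2 D y (\<lambda>y1 y2. t x1 y1 \<otimes>\<^bsub>E,E\<^esub> t x2 y2))"
    if "x \<in> vcar C" "y \<in> vcar D" for x y
    by (intro sw2_cong assms that) (simp add: assms)
  thus ?thesis using assms(3,4) by (simp add: comultiplicative2_def)
qed

lemma comultiplicative2_hom:
  fixes C :: "('k::field, 'a::ab_group_add, 'm) coalg_scheme"
    and C' :: "('k, 'b::ab_group_add, 'o) coalg_scheme"
    and D :: "('k, 'd::ab_group_add, 'n) coalg_scheme"
    and E :: "('k, 'e::ab_group_add, 'p) coalg_scheme"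
  assumes "coalgebra C" "coalgebra C'" "coalgebra D" "coalgebra E" 
    "comultiplicative2 C C' D s" "coalgebra_hom D E \<phi>"
  shows "comultiplicative2 C C' E (\<lambda>x y. \<phi> (s x y))"
  unfolding comultiplicative2_def
proof (intro ballI conjI)
  fix x y assume xy: "x \<in> vcar C" "y \<in> vcar C'"
  have s: "s x y \<in> vcar D" using assms(5) xy by (auto simp: comultiplicative2_def)
  thus "\<phi> (s x y) \<in> vcar E" by (rule coalgebra_homD(4)[OF assms(6)])
  note [lin] = linear_map_comp[OF _ coalgebra_homD(1)[OF assms(6)]] coalgebra_homD(4)[OF assms(6)]
  have "comul E (\<phi> (s x y)) = sw2 D (s x y) (\<lambda>c1 c2. \<phi> c1 \<otimes>\<^bsub>E,E\<^esub> \<phi> c2)"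
    by (rule coalgebra_homD(2)[OF assms(6) s])
  also have "\<dots> = sw2 C x (\<lambda>x1 x2. sw2 C' y (\<lambda>y1 y2. \<phi> (s x1 y1) \<otimes>\<^bsub>E,E\<^esub> \<phi> (s x2 y2)))"
    by (rule sw2_comultiplicative2[OF assms(1-3) is_vspace_tensor_space[of E E] assms(5) _ xy]) (intro lin)
  finally show "comul E (\<phi> (s x y)) = \<dots>" .
qed

lemma comultiplicative2_comp:
  fixes C :: "('k::field, 'a::ab_group_add, 'm) coalg_scheme"
    and C' :: "('k, 'b::ab_group_add, 'o) coalg_scheme"
    and D :: "('k, 'd::ab_group_add, 'n) coalg_scheme"
    and D' :: "('k, 'f::ab_group_add, 'q) coalg_scheme"
    and E :: "('k, 'e::ab_group_add, 'p) coalg_scheme"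
  assumes co: "coalgebra C" "coalgebra C'" "coalgebra D" "coalgebra D'"
    and s: "comultiplicative2 D D' E s" and bil: "bilinear_map D D' E s"
    and hom: "coalgebra_hom C D \<phi>" "coalgebra_hom C' D' \<psi>"
  shows "comultiplicative2 C C' E (\<lambda>x y. s (\<phi> x) (\<psi> y))"
  unfolding comultiplicative2_def
proof (intro ballI conjI)
  fix x y assume xy: "x \<in> vcar C" "y \<in> vcar C'"
  note [lin] = coalgebra_homD(4)[OF hom(1)] coalgebra_homD(4)[OF hom(2)]
    bilinear_map_left[OF bil] bilinear_map_right[OF bil] bilinear_mapD(3)[OF bil]
  show "s (\<phi> x) (\<psi> y) \<in> vcar E" by (intro lin xy)
  have "comul E (s (\<phi> x) (\<psi> y)) = sw2 D (\<phi> x) (\<lambda>x1 x2. sw2 D' (\<psi> y) (\<lambda>y1 y2. s x1 y1 \<otimes>\<^bsub>E,E\<^esub> s x2 y2))"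
    using s xy by (simp add: comultiplicative2_def coalgebra_homD[OF hom(1)] coalgebra_homD[OF hom(2)])
  also have "\<dots> = sw2 C x (\<lambda>x1 x2. sw2 D' (\<psi> y) (\<lambda>y1 y2. s (\<phi> x1) y1 \<otimes>\<^bsub>E,E\<^esub> s (\<phi> x2) y2))"
    by (rule sw2_hom[OF co(1,3) is_vspace_tensor_space[of E E] hom(1) _ xy(1)]) (intro lin co xy)
  also have "\<dots> = sw2 C x (\<lambda>x1 x2. sw2 C' y (\<lambda>y1 y2. s (\<phi> x1) (\<psi> y1) \<otimes>\<^bsub>E,E\<^esub> s (\<phi> x2) (\<psi> y2)))"
    by (intro sw2_cong co xy sw2_hom[OF co(2,4) is_vspace_tensor_space[of E E] hom(2) _ xy(2)]) (intro lin co xy)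
  finally show "comul E (s (\<phi> x) (\<psi> y)) = \<dots>" .
qed

lemma coalgebra_hom_comp:
  fixes C :: "('k::field, 'a::ab_group_add, 'm) coalg_scheme"
    and D :: "('k, 'd::ab_group_add, 'n) coalg_scheme"
    and E :: "('k, 'e::ab_group_add, 'p) coalg_scheme"
  assumes co: "coalgebra C" "coalgebra D" "coalgebra E"
    and hom: "coalgebra_hom C D \<phi>" "coalgebra_hom D E \<psi>"
  shows "coalgebra_hom C E (\<lambda>x. \<psi> (\<phi> x))"
  unfolding coalgebra_hom_def
proof (intro ballI conjI)
  note [lin] = coalgebra_homD(4)[OF hom(1)] coalgebra_homD(4)[OF hom(2)]
    linear_map_comp[OF _ coalgebra_homD(1)[OF hom(1)]] linear_map_comp[OF _ coalgebra_homD(1)[OF hom(2)]]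
  show "linear_map C E (\<lambda>x. \<psi> (\<phi> x))" by (intro lin)
  fix c assume c: "c \<in> vcar C"
  show "counit E (\<psi> (\<phi> c)) = counit C c"
    using c by (simp add: coalgebra_homD[OF hom(1)] coalgebra_homD[OF hom(2)])
  have "comul E (\<psi> (\<phi> c)) = sw2 D (\<phi> c) (\<lambda>x y. \<psi> x \<otimes>\<^bsub>E,E\<^esub> \<psi> y)"
    using c by (intro coalgebra_homD(2)[OF hom(2)] lin)
  also have "\<dots> = sw2 C c (\<lambda>x y. \<psi> (\<phi> x) \<otimes>\<^bsub>E,E\<^esub> \<psi> (\<phi> y))"
    by (rule sw2_hom[OF co(1,2) is_vspace_tensor_space[of E E] hom(1) _ c]) (intro lin)
  finally show "comul E (\<psi> (\<phi> c)) = \<dots>" .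
qed

lemma coalgebra_hom_cong:
  assumes "coalgebra C" "coalgebra_hom C D \<phi>" "\<And>x. x \<in> vcar C \<Longrightarrow> \<phi> x = \<psi> x"
  shows "coalgebra_hom C D \<psi>"
proof -
  note V = is_vspaceD[OF coalgebraD(1)[OF assms(1)]]
  have "linear_map C D \<psi>"
    using coalgebra_homD(1)[OF assms(2)] assms(3) V by (auto simp: linear_map_def Pi_iff)
  moreover have "sw2 C c (\<lambda>x y. \<psi> x \<otimes>\<^bsub>D,D\<^esub> \<psi> y) = sw2 C c (\<lambda>x y. \<phi> x \<otimes>\<^bsub>D,D\<^esub> \<phi> y)" if "c \<in> vcar C" for c
    by (rule sw2_cong) (auto simp: assms that)
  ultimately show ?thesis
    using assms(2,3) by (simp add: coalgebra_hom_def)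
qed

section \<open>Bialgebras\<close>

locale bialg =
  fixes B :: "('k::field, 'a::ab_group_add, 'm) bialg_scheme"
  assumes bialgebra: "bialgebra B"
begin

lemma coalg [lin]: "coalgebra B"
  using bialgebra by (simp add: bialgebra_def)

lemma algebra: "algebra B"
  using bialgebra by (simp add: bialgebra_def)

lemma vsp [lin]: "is_vspace B"
  using coalg by (rule coalgebraD)

lemma bilinear_mul: "bilinear_map B B B (mul B)"
  using algebra by (simp add: algebra_def)

lemmas linear_map_mul [lin] = bilinear_map_left[OF bilinear_mul] bilinear_map_right[OF bilinear_mul]
lemmas mul_closed [lin] = bilinear_mapD(3)[OF bilinear_mul]

lemma one_closed [lin]: "\<one>\<^bsub>B\<^esub> \<in> vcar B"
  using algebra by (simp add: algebra_def)

lemma mul_assoc: "x \<in> vcar B \<Longrightarrow> y \<in> vcar B \<Longrightarrow> z \<in> vcar B \<Longrightarrow> (x \<cdot>\<^bsub>B\<^esub> y) \<cdot>\<^bsub>B\<^esub> z = x \<cdot>\<^bsub>B\<^esub> (y \<cdot>\<^bsub>B\<^esub> z)"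
  using algebra by (simp add: algebra_def)

lemma one_mul: "x \<in> vcar B \<Longrightarrow> \<one>\<^bsub>B\<^esub> \<cdot>\<^bsub>B\<^esub> x = x" "x \<in> vcar B \<Longrightarrow> x \<cdot>\<^bsub>B\<^esub> \<one>\<^bsub>B\<^esub> = x"
  using algebra by (simp_all add: algebra_def)

lemma counit_mul: "x \<in> vcar B \<Longrightarrow> y \<in> vcar B \<Longrightarrow> counit B (x \<cdot>\<^bsub>B\<^esub> y) = counit B x * counit B y"
  and counit_one: "counit B \<one>\<^bsub>B\<^esub> = 1"
  and comul_one: "comul B \<one>\<^bsub>B\<^esub> = \<one>\<^bsub>B\<^esub> \<otimes>\<^bsub>B,B\<^esub> \<one>\<^bsub>B\<^esub>"
  using bialgebra by (simp_all add: bialgebra_def)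

lemma comultiplicative2_mul: "comultiplicative2 B B B (mul B)"
  using bialgebra mul_closed by (simp add: bialgebra_def comultiplicative2_def)

lemma sw2_one:
  fixes U :: "('k, 'u::ab_group_add, 'p) vspace_scheme"
  assumes "is_vspace U" "bilinear_map B B U F"
  shows "sw2 B \<one>\<^bsub>B\<^esub> F = F \<one>\<^bsub>B\<^esub> \<one>\<^bsub>B\<^esub>"
  unfolding sw2_def comul_one by (rule tensor_lift_tens[OF assms one_closed one_closed])

lemma vscale_mul:
  assumes "x \<in> vcar B" "y \<in> vcar B"
  shows "vscale B c x \<cdot>\<^bsub>B\<^esub> y = vscale B c (x \<cdot>\<^bsub>B\<^esub> y)" "x \<cdot>\<^bsub>B\<^esub> vscale B c y = vscale B c (x \<cdot>\<^bsub>B\<^esub> y)"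
  using linear_mapD(3)[OF bilinear_mapD(2)[OF bilinear_mul assms(2)] assms(1)]
    linear_mapD(3)[OF bilinear_mapD(1)[OF bilinear_mul assms(1)] assms(2)] by auto

lemma sw2_mul_left:
  fixes C :: "('k, 'c::ab_group_add, 'o) coalg_scheme"
  assumes "coalgebra C" "c \<in> vcar C" "\<And>x y. x \<in> vcar C \<Longrightarrow> y \<in> vcar C \<Longrightarrow> F x y \<in> vcar B" "b \<in> vcar B"
  shows "b \<cdot>\<^bsub>B\<^esub> sw2 C c F = sw2 C c (\<lambda>x y. b \<cdot>\<^bsub>B\<^esub> F x y)"
  using linear_map_sw2[OF bilinear_mapD(1)[OF bilinear_mul assms(4)] vsp assms(1-3)] .

lemma sw2_mul_right:
  fixes C :: "('k, 'c::ab_group_add, 'o) coalg_scheme"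
  assumes "coalgebra C" "c \<in> vcar C" "\<And>x y. x \<in> vcar C \<Longrightarrow> y \<in> vcar C \<Longrightarrow> F x y \<in> vcar B" "b \<in> vcar B"
  shows "sw2 C c F \<cdot>\<^bsub>B\<^esub> b = sw2 C c (\<lambda>x y. F x y \<cdot>\<^bsub>B\<^esub> b)"
  using linear_map_sw2[OF bilinear_mapD(2)[OF bilinear_mul assms(4)] vsp assms(1-3)] .

end

section \<open>Crossed products: embeddings, projections and relations\<close>

locale crossed =
  fixes A :: "('k::field, 'a::ab_group_add) bialg"
    and H :: "('k, 'h::ab_group_add) bialg"
    and act :: "('k, 'h, 'a) tensor \<Rightarrow> 'a"
    and f :: "('k, 'h, 'h) tensor \<Rightarrow> 'a"
  assumes crossed: "crossed_system A H act f"
begin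

abbreviation B where "B \<equiv> crossed_product A H act f"
abbreviation tri where "tri h a \<equiv> act (h \<otimes>\<^bsub>H,A\<^esub> a)"
abbreviation coc where "coc h g \<equiv> f (h \<otimes>\<^bsub>H,H\<^esub> g)"
abbreviation T where "T \<equiv> tensor_space A H"

sublocale A: bialg A + H: bialg H + B: bialg B
  using crossed by unfold_locales (auto simp: crossed_system_def hopf_algebra_def)

lemma linear_act: "linear_map (tensor_space H A) A act"
  and linear_f: "linear_map (tensor_space H H) A f"
  using crossed by (auto simp: crossed_system_def weak_action_def)

lemma tri_one: "h \<in> vcar H \<Longrightarrow> tri h \<one>\<^bsub>A\<^esub> = vscale A (counit H h) \<one>\<^bsub>A\<^esub>"
  and one_tri: "a \<in> vcar A \<Longrightarrow> tri \<one>\<^bsub>H\<^esub> a = a"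
  using crossed by (auto simp: crossed_system_def weak_action_def)

lemmas [lin] = linear_map_comp[OF _ linear_act] linear_map_comp[OF _ linear_f]
  linear_mapD(1)[OF linear_act] linear_mapD(1)[OF linear_f]

lemma crossed_product_simps:
  "vcar B = vcar T" "vscale B = vscale T" "\<one>\<^bsub>B\<^esub> = \<one>\<^bsub>A\<^esub> \<otimes>\<^bsub>A,H\<^esub> \<one>\<^bsub>H\<^esub>"
  "counit B = tensor_lift A H (\<lambda>a h. counit A a * counit H h)"
  "mul B = (\<lambda>s t.
        tensor_lift A H (\<lambda>a h. tensor_lift A H (\<lambda>c g.
          sw3 H h (\<lambda>h1 h2 h3. sw2 H g (\<lambda>g1 g2.
            (a \<cdot>\<^bsub>A\<^esub> tri h1 c \<cdot>\<^bsub>A\<^esub> coc h2 g1) \<otimes>\<^bsub>A,H\<^esub> (h3 \<cdot>\<^bsub>H\<^esub> g2)))) t) s)"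
  "comul B = tensor_lift A H (\<lambda>a h.
        sw2 A a (\<lambda>a1 a2. sw2 H h (\<lambda>h1 h2.
          (a1 \<otimes>\<^bsub>A,H\<^esub> h1) \<otimes>\<^bsub>T,T\<^esub> (a2 \<otimes>\<^bsub>A,H\<^esub> h2))))"
  by (simp_all add: crossed_product_def)

lemma tens_B: "tens B B = tens T T"
  by (rule tens_carrier_cong) (simp_all add: crossed_product_simps)

lemma linear_map_B_iff:
  "linear_map X B g \<longleftrightarrow> linear_map X T g" "linear_map B U \<phi> \<longleftrightarrow> linear_map T U \<phi>"
  unfolding linear_map_def by (simp_all add: crossed_product_simps)

lemma bilinear_map_tens_B: "bilinear_map A H B (\<lambda>a h. a \<otimes>\<^bsub>A,H\<^esub> h)"
  using bilinear_map_tens[of A H] by (simp add: bilinear_map_def linear_map_B_iff)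

lemmas linear_map_tens_B [lin] = bilinear_map_left[OF bilinear_map_tens_B] bilinear_map_right[OF bilinear_map_tens_B]
lemmas tens_B_closed [lin] = bilinear_mapD(3)[OF bilinear_map_tens_B]

lemma linear_map_lift_B [lin]:
  fixes U :: "('k, 'u::ab_group_add, 'p) vspace_scheme"
    and X :: "('k, 'x::ab_group_add, 'q) vspace_scheme"
  assumes "is_vspace U" "bilinear_map A H U \<beta>" "linear_map X B g"
  shows "linear_map X U (\<lambda>z. tensor_lift A H \<beta> (g z))"
  using linear_map_tensor_lift_comp[OF A.vsp assms(1,2)] assms(3) by (simp add: linear_map_B_iff)

lemma B_eqI:
  fixes U :: "('k, 'u::ab_group_add, 'p) vspace_scheme"
  assumes "linear_map B U \<phi>" "linear_map B U \<psi>"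
    and "\<And>a h. a \<in> vcar A \<Longrightarrow> h \<in> vcar H \<Longrightarrow> \<phi> (a \<otimes>\<^bsub>A,H\<^esub> h) = \<psi> (a \<otimes>\<^bsub>A,H\<^esub> h)"
    and "b \<in> vcar B"
  shows "\<phi> b = \<psi> b"
  using assms by (intro tensor_space_eqI[of A H U \<phi> \<psi> b])
    (auto simp: linear_map_B_iff crossed_product_simps A.vsp)

lemma counit_tens:
  assumes "a \<in> vcar A" "h \<in> vcar H"
  shows "counit B (a \<otimes>\<^bsub>A,H\<^esub> h) = counit A a * counit H h"
  unfolding crossed_product_simps
  by (rule tensor_lift_tens[OF is_vspace_ground _ assms]) (intro lin)

lemma comultiplicative2_tens: "comultiplicative2 A H B (tens A H)"
  unfolding comultiplicative2_def
proof (intro ballI conjI lin)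
  fix a h assume ah: "a \<in> vcar A" "h \<in> vcar H"
  show "comul B (a \<otimes>\<^bsub>A,H\<^esub> h) = sw2 A a (\<lambda>a1 a2. sw2 H h (\<lambda>h1 h2. (a1 \<otimes>\<^bsub>A,H\<^esub> h1) \<otimes>\<^bsub>B,B\<^esub> (a2 \<otimes>\<^bsub>A,H\<^esub> h2)))"
    unfolding tens_B unfolding crossed_product_simps
    by (rule tensor_lift_tens[OF is_vspace_tensor_space[of T T] _ ah]) (intro lin)
qed

lemma sw2_tens_B:
  fixes U :: "('k, 'u::ab_group_add, 'p) vspace_scheme"
  assumes "is_vspace U" "bilinear_map B B U F" "a \<in> vcar A" "h \<in> vcar H"
  shows "sw2 B (a \<otimes>\<^bsub>A,H\<^esub> h) F = sw2 A a (\<lambda>a1 a2. sw2 H h (\<lambda>h1 h2. F (a1 \<otimes>\<^bsub>A,H\<^esub> h1) (a2 \<otimes>\<^bsub>A,H\<^esub> h2)))"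
  by (rule sw2_comultiplicative2[OF A.coalg H.coalg B.coalg assms(1) comultiplicative2_tens assms(2-)])

lemma mul_tens:
  assumes "a \<in> vcar A" "h \<in> vcar H" "c \<in> vcar A" "g \<in> vcar H"
  shows "(a \<otimes>\<^bsub>A,H\<^esub> h) \<cdot>\<^bsub>B\<^esub> (c \<otimes>\<^bsub>A,H\<^esub> g) =
    sw3 H h (\<lambda>h1 h2 h3. sw2 H g (\<lambda>g1 g2.
      (a \<cdot>\<^bsub>A\<^esub> tri h1 c \<cdot>\<^bsub>A\<^esub> coc h2 g1) \<otimes>\<^bsub>A,H\<^esub> (h3 \<cdot>\<^bsub>H\<^esub> g2)))"
proof -
  let ?\<beta> = "\<lambda>a h c g. sw3 H h (\<lambda>h1 h2 h3. sw2 H g (\<lambda>g1 g2.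
      (a \<cdot>\<^bsub>A\<^esub> tri h1 c \<cdot>\<^bsub>A\<^esub> coc h2 g1) \<otimes>\<^bsub>A,H\<^esub> (h3 \<cdot>\<^bsub>H\<^esub> g2)))"
  have inner: "bilinear_map A H B (?\<beta> a h)" if "a \<in> vcar A" "h \<in> vcar H" for a h
    by (intro lin that)
  have outer: "bilinear_map A H B (\<lambda>a h. tensor_lift A H (?\<beta> a h) (c \<otimes>\<^bsub>A,H\<^esub> g))"
    by (intro lin assms)
  show ?thesis
    unfolding crossed_product_simps tensor_lift_tens[OF B.vsp outer assms(1,2)]
    by (rule tensor_lift_tens[OF B.vsp inner[OF assms(1,2)] assms(3,4)])
qed

text \<open>
  The embeddings of \<open>A\<close> and \<open>H\<close> into \<open>A # H\<close>, and the projections \<open>id \<otimes> \<epsilon>\<close> and \<open>\<epsilon> \<otimes> id\<close> back.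
  All four are coalgebra maps; \<open>iA\<close> and \<open>piH\<close> are also multiplicative, \<open>iH\<close> and \<open>piA\<close> in general
  are not.
\<close>
definition iA where "iA a = a \<otimes>\<^bsub>A,H\<^esub> \<one>\<^bsub>H\<^esub>"
definition iH where "iH h = \<one>\<^bsub>A\<^esub> \<otimes>\<^bsub>A,H\<^esub> h"
definition piA where "piA = tensor_lift A H (\<lambda>a h. vscale A (counit H h) a)"
definition piH where "piH = tensor_lift A H (\<lambda>a h. vscale H (counit A a) h)"

lemma piA_tens: "a \<in> vcar A \<Longrightarrow> h \<in> vcar H \<Longrightarrow> piA (a \<otimes>\<^bsub>A,H\<^esub> h) = vscale A (counit H h) a"
  unfolding piA_def by (rule tensor_lift_tens[OF A.vsp]) (intro lin)

lemma piH_tens: "a \<in> vcar A \<Longrightarrow> h \<in> vcar H \<Longrightarrow> piH (a \<otimes>\<^bsub>A,H\<^esub> h) = vscale H (counit A a) h"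
  unfolding piH_def by (rule tensor_lift_tens[OF H.vsp]) (intro lin)

lemma linear_piA: "linear_map B A piA"
  unfolding piA_def by (rule linear_map_lift_B[OF _ _ linear_map_id]) (intro lin)+

lemma linear_piH: "linear_map B H piH"
  unfolding piH_def by (rule linear_map_lift_B[OF _ _ linear_map_id]) (intro lin)+

lemmas [lin] = linear_map_comp[OF _ linear_piA] linear_map_comp[OF _ linear_piH]
  linear_mapD(1)[OF linear_piA] linear_mapD(1)[OF linear_piH]

lemma tens_scale:
  assumes "a \<in> vcar A" "h \<in> vcar H"
  shows "vscale A k a \<otimes>\<^bsub>A,H\<^esub> h = vscale B k (a \<otimes>\<^bsub>A,H\<^esub> h)" "a \<otimes>\<^bsub>A,H\<^esub> vscale H k h = vscale B k (a \<otimes>\<^bsub>A,H\<^esub> h)"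
  using linear_mapD(3)[OF bilinear_mapD(2)[OF bilinear_map_tens_B assms(2)] assms(1)]
    linear_mapD(3)[OF bilinear_mapD(1)[OF bilinear_map_tens_B assms(1)] assms(2)] by auto

lemma coalgebra_hom_piA: "coalgebra_hom B A piA"
  unfolding coalgebra_hom_def
proof (intro conjI ballI linear_piA)
  let ?TA = "tensor_space A A"
  note [lin] = linear_map_comp[OF _ coalgebraD(2)[OF A.coalg]] comul_closed[OF A.coalg] is_vspaceD(4)[OF A.vsp]
  fix b assume b: "b \<in> vcar B"
  show "counit A (piA b) = counit B b"
  proof (rule B_eqI[OF _ _ _ b])
    show "linear_map B ground (\<lambda>b. counit A (piA b))" "linear_map B ground (counit B)" by (intro lin)+
    fix a h assume ah: "a \<in> vcar A" "h \<in> vcar H"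
    thus "counit A (piA (a \<otimes>\<^bsub>A,H\<^esub> h)) = counit B (a \<otimes>\<^bsub>A,H\<^esub> h)"
      by (simp add: piA_tens counit_tens counit_scale[OF A.coalg] mult.commute)
  qed
  show "comul A (piA b) = sw2 B b (\<lambda>c1 c2. piA c1 \<otimes>\<^bsub>A,A\<^esub> piA c2)"
  proof (rule B_eqI[OF _ _ _ b])
    show "linear_map B ?TA (\<lambda>b. comul A (piA b))"
      "linear_map B ?TA (\<lambda>b. sw2 B b (\<lambda>c1 c2. piA c1 \<otimes>\<^bsub>A,A\<^esub> piA c2))" by (intro lin)+
    fix a h assume ah: "a \<in> vcar A" "h \<in> vcar H"
    have "sw2 B (a \<otimes>\<^bsub>A,H\<^esub> h) (\<lambda>c1 c2. piA c1 \<otimes>\<^bsub>A,A\<^esub> piA c2) =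
       sw2 A a (\<lambda>a1 a2. sw2 H h (\<lambda>h1 h2. piA (a1 \<otimes>\<^bsub>A,H\<^esub> h1) \<otimes>\<^bsub>A,A\<^esub> piA (a2 \<otimes>\<^bsub>A,H\<^esub> h2)))"
      by (rule sw2_tens_B[OF is_vspace_tensor_space[of A A] _ ah]) (intro lin)
    also have "\<dots> = sw2 A a (\<lambda>a1 a2. sw2 H h (\<lambda>h1 h2. vscale ?TA (counit H h2) (vscale ?TA (counit H h1) (a1 \<otimes>\<^bsub>A,A\<^esub> a2))))"
      by (intro sw2_cong lin ah) (simp add: piA_tens scaled_tens[OF _ _ A.vsp])
    also have "\<dots> = sw2 A a (\<lambda>a1 a2. vscale ?TA (counit H h) (a1 \<otimes>\<^bsub>A,A\<^esub> a2))"
      by (intro sw2_cong lin ah sw2_counit(2)[OF H.coalg])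
    also have "\<dots> = vscale ?TA (counit H h) (sw2 A a (\<lambda>a1 a2. (a1 \<otimes>\<^bsub>A,A\<^esub> a2)))"
      by (rule linear_map_sw2[symmetric, OF linear_map_vscale[OF is_vspace_tensor_space linear_map_id] is_vspace_tensor_space]) (intro lin ah; assumption)+
    also have "\<dots> = vscale ?TA (counit H h) (comul A a)"
      by (simp add: sw2_tens[OF A.coalg ah(1)])
    also have "\<dots> = comul A (piA (a \<otimes>\<^bsub>A,H\<^esub> h))"
      by (simp add: piA_tens ah linear_mapD(3)[OF coalgebraD(2)[OF A.coalg]])
    finally show "comul A (piA (a \<otimes>\<^bsub>A,H\<^esub> h)) = sw2 B (a \<otimes>\<^bsub>A,H\<^esub> h) (\<lambda>c1 c2. piA c1 \<otimes>\<^bsub>A,A\<^esub> piA c2)" ..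
  qed
qed

lemma coalgebra_hom_piH: "coalgebra_hom B H piH"
  unfolding coalgebra_hom_def
proof (intro conjI ballI linear_piH)
  let ?TA = "tensor_space H H"
  note [lin] = linear_map_comp[OF _ coalgebraD(2)[OF H.coalg]] comul_closed[OF H.coalg] is_vspaceD(4)[OF H.vsp]
  fix b assume b: "b \<in> vcar B"
  show "counit H (piH b) = counit B b"
  proof (rule B_eqI[OF _ _ _ b])
    show "linear_map B ground (\<lambda>b. counit H (piH b))" "linear_map B ground (counit B)" by (intro lin)+
    fix a h assume ah: "a \<in> vcar A" "h \<in> vcar H"
    thus "counit H (piH (a \<otimes>\<^bsub>A,H\<^esub> h)) = counit B (a \<otimes>\<^bsub>A,H\<^esub> h)"
      by (simp add: piH_tens counit_tens counit_scale[OF H.coalg] mult.commute)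
  qed
  show "comul H (piH b) = sw2 B b (\<lambda>c1 c2. piH c1 \<otimes>\<^bsub>H,H\<^esub> piH c2)"
  proof (rule B_eqI[OF _ _ _ b])
    show "linear_map B ?TA (\<lambda>b. comul H (piH b))"
      "linear_map B ?TA (\<lambda>b. sw2 B b (\<lambda>c1 c2. piH c1 \<otimes>\<^bsub>H,H\<^esub> piH c2))" by (intro lin)+
    fix a h assume ah: "a \<in> vcar A" "h \<in> vcar H"
    have "sw2 B (a \<otimes>\<^bsub>A,H\<^esub> h) (\<lambda>c1 c2. piH c1 \<otimes>\<^bsub>H,H\<^esub> piH c2) =
       sw2 A a (\<lambda>a1 a2. sw2 H h (\<lambda>h1 h2. piH (a1 \<otimes>\<^bsub>A,H\<^esub> h1) \<otimes>\<^bsub>H,H\<^esub> piH (a2 \<otimes>\<^bsub>A,H\<^esub> h2)))"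
      by (rule sw2_tens_B[OF is_vspace_tensor_space[of H H] _ ah]) (intro lin)
    also have "\<dots> = sw2 H h (\<lambda>h1 h2. sw2 A a (\<lambda>a1 a2. piH (a1 \<otimes>\<^bsub>A,H\<^esub> h1) \<otimes>\<^bsub>H,H\<^esub> piH (a2 \<otimes>\<^bsub>A,H\<^esub> h2)))"
      by (rule sw2_swap)
    also have "\<dots> = sw2 H h (\<lambda>h1 h2. sw2 A a (\<lambda>a1 a2. vscale ?TA (counit A a2) (vscale ?TA (counit A a1) (h1 \<otimes>\<^bsub>H,H\<^esub> h2))))"
      by (intro sw2_cong lin ah) (simp add: piH_tens scaled_tens[OF _ _ H.vsp])
    also have "\<dots> = sw2 H h (\<lambda>h1 h2. vscale ?TA (counit A a) (h1 \<otimes>\<^bsub>H,H\<^esub> h2))"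
      by (intro sw2_cong lin ah sw2_counit(2)[OF A.coalg])
    also have "\<dots> = vscale ?TA (counit A a) (sw2 H h (\<lambda>h1 h2. (h1 \<otimes>\<^bsub>H,H\<^esub> h2)))"
      by (rule linear_map_sw2[symmetric, OF linear_map_vscale[OF is_vspace_tensor_space linear_map_id] is_vspace_tensor_space]) (intro lin ah; assumption)+
    also have "\<dots> = vscale ?TA (counit A a) (comul H h)"
      by (simp add: sw2_tens[OF H.coalg ah(2)])
    also have "\<dots> = comul H (piH (a \<otimes>\<^bsub>A,H\<^esub> h))"
      by (simp add: piH_tens ah linear_mapD(3)[OF coalgebraD(2)[OF H.coalg]])
    finally show "comul H (piH (a \<otimes>\<^bsub>A,H\<^esub> h)) = sw2 B (a \<otimes>\<^bsub>A,H\<^esub> h) (\<lambda>c1 c2. piH c1 \<otimes>\<^bsub>H,H\<^esub> piH c2)" ..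
  qed
qed

text \<open>
  An element of \<open>A \<otimes> H\<close> is recovered from its two projections: \<open>b = \<pi>\<^sub>A b\<^sub>1 # \<pi>\<^sub>H b\<^sub>2\<close>, and the two
  components may be exchanged. On pure tensors both identities follow from the counit laws. The
  comparison of maps into \<open>A # H\<close> by components rests on this lemma.
\<close>
lemma components:
  assumes b: "b \<in> vcar B"
  shows "sw2 B b (\<lambda>x y. piA x \<otimes>\<^bsub>A,H\<^esub> piH y) = b"
    and "sw2 B b (\<lambda>x y. piA y \<otimes>\<^bsub>A,H\<^esub> piH x) = b"
proof -
  note [lin] = is_vspaceD(4)[OF A.vsp] is_vspaceD(4)[OF B.vsp]
  note [simp] = piA_tens piH_tens tens_scale vscale_laws(3)[OF B.vsp] mult.commute is_vspaceD(4)[OF A.vsp] is_vspaceD(4)[OF H.vsp]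
  show "sw2 B b (\<lambda>x y. piA x \<otimes>\<^bsub>A,H\<^esub> piH y) = b"
  proof (rule B_eqI[OF _ linear_map_id _ b])
    show "linear_map B B (\<lambda>b. sw2 B b (\<lambda>x y. piA x \<otimes>\<^bsub>A,H\<^esub> piH y))" by (intro lin)
    fix a h assume ah: "a \<in> vcar A" "h \<in> vcar H"
    have "sw2 B (a \<otimes>\<^bsub>A,H\<^esub> h) (\<lambda>x y. piA x \<otimes>\<^bsub>A,H\<^esub> piH y) =
        sw2 A a (\<lambda>a1 a2. sw2 H h (\<lambda>h1 h2. piA (a1 \<otimes>\<^bsub>A,H\<^esub> h1) \<otimes>\<^bsub>A,H\<^esub> piH (a2 \<otimes>\<^bsub>A,H\<^esub> h2)))"
      by (rule sw2_tens_B[OF B.vsp _ ah]) (intro lin)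
    also have "\<dots> = sw2 A a (\<lambda>a1 a2. sw2 H h (\<lambda>h1 h2. vscale B (counit H h1) (vscale B (counit A a2) (a1 \<otimes>\<^bsub>A,H\<^esub> h2))))"
      by (intro sw2_cong lin ah) simp
    also have "\<dots> = sw2 A a (\<lambda>a1 a2. vscale B (counit A a2) (a1 \<otimes>\<^bsub>A,H\<^esub> h))"
      by (intro sw2_cong lin ah sw2_counit(1)[OF H.coalg])
    also have "\<dots> = a \<otimes>\<^bsub>A,H\<^esub> h"
      by (intro lin ah sw2_counit(2)[OF A.coalg])
    finally show "sw2 B (a \<otimes>\<^bsub>A,H\<^esub> h) (\<lambda>x y. piA x \<otimes>\<^bsub>A,H\<^esub> piH y) = a \<otimes>\<^bsub>A,H\<^esub> h" .
  qed
  show "sw2 B b (\<lambda>x y. piA y \<otimes>\<^bsub>A,H\<^esub> piH x) = b"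
  proof (rule B_eqI[OF _ linear_map_id _ b])
    show "linear_map B B (\<lambda>b. sw2 B b (\<lambda>x y. piA y \<otimes>\<^bsub>A,H\<^esub> piH x))" by (intro lin)
    fix a h assume ah: "a \<in> vcar A" "h \<in> vcar H"
    have "sw2 B (a \<otimes>\<^bsub>A,H\<^esub> h) (\<lambda>x y. piA y \<otimes>\<^bsub>A,H\<^esub> piH x) =
        sw2 A a (\<lambda>a1 a2. sw2 H h (\<lambda>h1 h2. piA (a2 \<otimes>\<^bsub>A,H\<^esub> h2) \<otimes>\<^bsub>A,H\<^esub> piH (a1 \<otimes>\<^bsub>A,H\<^esub> h1)))"
      by (rule sw2_tens_B[OF B.vsp _ ah]) (intro lin)
    also have "\<dots> = sw2 A a (\<lambda>a1 a2. sw2 H h (\<lambda>h1 h2. vscale B (counit H h2) (vscale B (counit A a1) (a2 \<otimes>\<^bsub>A,H\<^esub> h1))))"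
      by (intro sw2_cong lin ah) simp
    also have "\<dots> = sw2 A a (\<lambda>a1 a2. vscale B (counit A a1) (a2 \<otimes>\<^bsub>A,H\<^esub> h))"
      by (intro sw2_cong lin ah sw2_counit(2)[OF H.coalg])
    also have "\<dots> = a \<otimes>\<^bsub>A,H\<^esub> h"
      by (intro lin ah sw2_counit(1)[OF A.coalg])
    finally show "sw2 B (a \<otimes>\<^bsub>A,H\<^esub> h) (\<lambda>x y. piA y \<otimes>\<^bsub>A,H\<^esub> piH x) = a \<otimes>\<^bsub>A,H\<^esub> h" .
  qed
qed

text \<open>
  Variants of the rules in \<open>lin\<close> for use by the simplifier.
\<close>
lemma tri_closed: "h \<in> vcar H \<Longrightarrow> a \<in> vcar A \<Longrightarrow> tri h a \<in> vcar A"
  and coc_closed: "h \<in> vcar H \<Longrightarrow> g \<in> vcar H \<Longrightarrow> coc h g \<in> vcar A"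
  by (intro lin; assumption)+

lemma iA_closed [lin]: "a \<in> vcar A \<Longrightarrow> iA a \<in> vcar B"
  and iH_closed [lin]: "h \<in> vcar H \<Longrightarrow> iH h \<in> vcar B"
  unfolding iA_def iH_def by (intro lin; assumption)+

lemma linear_map_iA [lin]: "linear_map X A g \<Longrightarrow> linear_map X B (\<lambda>x. iA (g x))"
  and linear_map_iH [lin]: "linear_map X H g' \<Longrightarrow> linear_map X B (\<lambda>x. iH (g' x))"
  unfolding iA_def iH_def by (intro lin; assumption)+

lemma iA_one: "iA \<one>\<^bsub>A\<^esub> = \<one>\<^bsub>B\<^esub>" and iH_one: "iH \<one>\<^bsub>H\<^esub> = \<one>\<^bsub>B\<^esub>"
  by (simp_all add: iA_def iH_def crossed_product_simps)

lemma piA_iA: "a \<in> vcar A \<Longrightarrow> piA (iA a) = a"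
  and piH_iA: "a \<in> vcar A \<Longrightarrow> piH (iA a) = vscale H (counit A a) \<one>\<^bsub>H\<^esub>"
  and piA_iH: "h \<in> vcar H \<Longrightarrow> piA (iH h) = vscale A (counit H h) \<one>\<^bsub>A\<^esub>"
  and piH_iH: "h \<in> vcar H \<Longrightarrow> piH (iH h) = h"
  by (simp_all add: iA_def iH_def piA_tens piH_tens A.one_closed H.one_closed A.counit_one
      H.counit_one vscale_laws(4)[OF A.vsp] vscale_laws(4)[OF H.vsp])

lemma piA_one: "piA \<one>\<^bsub>B\<^esub> = \<one>\<^bsub>A\<^esub>" and piH_one: "piH \<one>\<^bsub>B\<^esub> = \<one>\<^bsub>H\<^esub>"
  using piA_iA[OF A.one_closed] piH_iH[OF H.one_closed] by (simp_all add: iA_one iH_one)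

lemma coalgebra_hom_iA: "coalgebra_hom A B iA"
  unfolding coalgebra_hom_def
proof (intro conjI ballI)
  show "linear_map A B iA" by (intro lin)
  fix a assume a: "a \<in> vcar A"
  show "counit B (iA a) = counit A a"
    by (simp add: iA_def counit_tens a H.one_closed H.counit_one)
  have "comul B (iA a) = sw2 A a (\<lambda>a1 a2. sw2 H \<one>\<^bsub>H\<^esub> (\<lambda>h1 h2. (a1 \<otimes>\<^bsub>A,H\<^esub> h1) \<otimes>\<^bsub>B,B\<^esub> (a2 \<otimes>\<^bsub>A,H\<^esub> h2)))"
    using comultiplicative2_tens a H.one_closed by (auto simp: comultiplicative2_def iA_def)
  also have "\<dots> = sw2 A a (\<lambda>a1 a2. iA a1 \<otimes>\<^bsub>B,B\<^esub> iA a2)"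
    unfolding iA_def by (intro sw2_cong lin a H.sw2_one[OF is_vspace_tensor_space[of B B]])
  finally show "comul B (iA a) = \<dots>" .
qed

lemma coalgebra_hom_iH: "coalgebra_hom H B iH"
  unfolding coalgebra_hom_def
proof (intro conjI ballI)
  show "linear_map H B iH" by (intro lin)
  fix h assume h: "h \<in> vcar H"
  show "counit B (iH h) = counit H h"
    by (simp add: iH_def counit_tens h A.one_closed A.counit_one)
  have "comul B (iH h) = sw2 A \<one>\<^bsub>A\<^esub> (\<lambda>a1 a2. sw2 H h (\<lambda>h1 h2. (a1 \<otimes>\<^bsub>A,H\<^esub> h1) \<otimes>\<^bsub>B,B\<^esub> (a2 \<otimes>\<^bsub>A,H\<^esub> h2)))"
    using comultiplicative2_tens h A.one_closed by (auto simp: comultiplicative2_def iH_def)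
  also have "\<dots> = sw2 H h (\<lambda>h1 h2. iH h1 \<otimes>\<^bsub>B,B\<^esub> iH h2)"
    unfolding iH_def by (intro lin h A.sw2_one[OF is_vspace_tensor_space[of B B]])
  finally show "comul B (iH h) = \<dots>" .
qed

text \<open>
  The factor \<open>h\<^sub>1 \<triangleright> 1 = \<epsilon>(h\<^sub>1) 1\<close> of the product \<open>(1 # h)(1 # g)\<close> is absorbed by the counit law.
\<close>
lemma mul_iH_iH:
  assumes hg: "h \<in> vcar H" "g \<in> vcar H"
  shows "iH h \<cdot>\<^bsub>B\<^esub> iH g = sw2 H h (\<lambda>h1 h2. sw2 H g (\<lambda>g1 g2. coc h1 g1 \<otimes>\<^bsub>A,H\<^esub> (h2 \<cdot>\<^bsub>H\<^esub> g2)))"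
proof -
  let ?G = "\<lambda>h'. sw2 H h' (\<lambda>h2 h3. sw2 H g (\<lambda>g1 g2. coc h2 g1 \<otimes>\<^bsub>A,H\<^esub> (h3 \<cdot>\<^bsub>H\<^esub> g2)))"
  have "iH h \<cdot>\<^bsub>B\<^esub> iH g = sw3 H h (\<lambda>h1 h2 h3. sw2 H g (\<lambda>g1 g2.
      (\<one>\<^bsub>A\<^esub> \<cdot>\<^bsub>A\<^esub> tri h1 \<one>\<^bsub>A\<^esub> \<cdot>\<^bsub>A\<^esub> coc h2 g1) \<otimes>\<^bsub>A,H\<^esub> (h3 \<cdot>\<^bsub>H\<^esub> g2)))"
    unfolding iH_def by (intro mul_tens lin hg)
  also have "\<dots> = sw2 H h (\<lambda>h1 h'. sw2 H h' (\<lambda>h2 h3. sw2 H g (\<lambda>g1 g2.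
      vscale B (counit H h1) (coc h2 g1 \<otimes>\<^bsub>A,H\<^esub> (h3 \<cdot>\<^bsub>H\<^esub> g2)))))"
    unfolding sw3_def
    by (intro sw2_cong lin hg)
      (simp_all add: tri_one A.one_mul A.vscale_mul tens_scale coc_closed A.one_closed H.mul_closed is_vspaceD(4)[OF A.vsp])
  also have "\<dots> = sw2 H h (\<lambda>h1 h'. sw2 H h' (\<lambda>h2 h3. 
      vscale B (counit H h1) (sw2 H g (\<lambda>g1 g2. coc h2 g1 \<otimes>\<^bsub>A,H\<^esub> (h3 \<cdot>\<^bsub>H\<^esub> g2)))))"
    by (intro sw2_cong sw2_vscale lin hg)
  also have "\<dots> = sw2 H h (\<lambda>h1 h'. vscale B (counit H h1) (?G h'))"
    by (intro sw2_cong sw2_vscale lin hg)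
  also have "\<dots> = ?G h"
    by (intro sw2_counit(1)[OF H.coalg] lin hg)
  finally show ?thesis .
qed

text \<open>
  The cocycle is normalized because \<open>1 # 1\<close> is a unit: apply \<open>\<pi>\<^sub>A\<close> to \<open>(1 # h)(1 # 1) = 1 # h\<close>, and to
  \<open>(1 # 1)(1 # h) = 1 # h\<close> for the other side.
\<close>
lemma coc_one_right:
  assumes h: "h \<in> vcar H"
  shows "coc h \<one>\<^bsub>H\<^esub> = vscale A (counit H h) \<one>\<^bsub>A\<^esub>"
proof -
  have "iH h = iH h \<cdot>\<^bsub>B\<^esub> iH \<one>\<^bsub>H\<^esub>" by (simp add: iH_one B.one_mul lin h)
  also have "\<dots> = sw2 H h (\<lambda>h1 h2. sw2 H \<one>\<^bsub>H\<^esub> (\<lambda>g1 g2. coc h1 g1 \<otimes>\<^bsub>A,H\<^esub> (h2 \<cdot>\<^bsub>H\<^esub> g2)))"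
    by (intro mul_iH_iH lin h)
  also have "\<dots> = sw2 H h (\<lambda>h1 h2. coc h1 \<one>\<^bsub>H\<^esub> \<otimes>\<^bsub>A,H\<^esub> (h2 \<cdot>\<^bsub>H\<^esub> \<one>\<^bsub>H\<^esub>))"
    by (intro sw2_cong lin h H.sw2_one[OF B.vsp])
  also have "\<dots> = sw2 H h (\<lambda>h1 h2. coc h1 \<one>\<^bsub>H\<^esub> \<otimes>\<^bsub>A,H\<^esub> h2)"
    by (intro sw2_cong lin h) (simp_all add: H.one_mul)
  finally have "piA (iH h) = piA \<dots>" by simp
  also have "\<dots> = sw2 H h (\<lambda>h1 h2. piA (coc h1 \<one>\<^bsub>H\<^esub> \<otimes>\<^bsub>A,H\<^esub> h2))"
    by (intro linear_map_sw2[OF linear_piA] lin h)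
  also have "\<dots> = sw2 H h (\<lambda>h1 h2. vscale A (counit H h2) (coc h1 \<one>\<^bsub>H\<^esub>))"
    by (intro sw2_cong piA_tens lin h)
  also have "\<dots> = coc h \<one>\<^bsub>H\<^esub>"
    by (intro sw2_counit(2)[OF H.coalg] lin h)
  finally show ?thesis by (simp add: piA_iH h)
qed

lemma coc_one_left:
  assumes h: "h \<in> vcar H"
  shows "coc \<one>\<^bsub>H\<^esub> h = vscale A (counit H h) \<one>\<^bsub>A\<^esub>"
proof -
  have "iH h = iH \<one>\<^bsub>H\<^esub> \<cdot>\<^bsub>B\<^esub> iH h" by (simp add: iH_one B.one_mul lin h)
  also have "\<dots> = sw2 H \<one>\<^bsub>H\<^esub> (\<lambda>g1 g2. sw2 H h (\<lambda>h1 h2. coc g1 h1 \<otimes>\<^bsub>A,H\<^esub> (g2 \<cdot>\<^bsub>H\<^esub> h2)))"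
    by (intro mul_iH_iH lin h)
  also have "\<dots> = sw2 H h (\<lambda>h1 h2. coc \<one>\<^bsub>H\<^esub> h1 \<otimes>\<^bsub>A,H\<^esub> (\<one>\<^bsub>H\<^esub> \<cdot>\<^bsub>H\<^esub> h2))"
    by (intro lin h H.sw2_one[OF B.vsp])
  also have "\<dots> = sw2 H h (\<lambda>h1 h2. coc \<one>\<^bsub>H\<^esub> h1 \<otimes>\<^bsub>A,H\<^esub> h2)"
    by (intro sw2_cong lin h) (simp_all add: H.one_mul)
  finally have "piA (iH h) = piA \<dots>" by simp
  also have "\<dots> = sw2 H h (\<lambda>h1 h2. piA (coc \<one>\<^bsub>H\<^esub> h1 \<otimes>\<^bsub>A,H\<^esub> h2))"
    by (intro linear_map_sw2[OF linear_piA] lin h)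
  also have "\<dots> = sw2 H h (\<lambda>h1 h2. vscale A (counit H h2) (coc \<one>\<^bsub>H\<^esub> h1))"
    by (intro sw2_cong piA_tens lin h)
  also have "\<dots> = coc \<one>\<^bsub>H\<^esub> h"
    by (intro sw2_counit(2)[OF H.coalg] lin h)
  finally show ?thesis by (simp add: piA_iH h)
qed

lemma mul_iA_tens:
  assumes a: "a \<in> vcar A" "c \<in> vcar A" "g \<in> vcar H"
  shows "iA a \<cdot>\<^bsub>B\<^esub> (c \<otimes>\<^bsub>A,H\<^esub> g) = (a \<cdot>\<^bsub>A\<^esub> c) \<otimes>\<^bsub>A,H\<^esub> g"
proof -
  let ?F = "\<lambda>h1 h2 h3. sw2 H g (\<lambda>g1 g2. (a \<cdot>\<^bsub>A\<^esub> tri h1 c \<cdot>\<^bsub>A\<^esub> coc h2 g1) \<otimes>\<^bsub>A,H\<^esub> (h3 \<cdot>\<^bsub>H\<^esub> g2))"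
  have "iA a \<cdot>\<^bsub>B\<^esub> (c \<otimes>\<^bsub>A,H\<^esub> g) = sw3 H \<one>\<^bsub>H\<^esub> ?F"
    unfolding iA_def by (intro mul_tens lin a)
  also have "\<dots> = sw2 H \<one>\<^bsub>H\<^esub> (?F \<one>\<^bsub>H\<^esub>)"
    unfolding sw3_def by (intro H.sw2_one[OF B.vsp] lin a)
  also have "\<dots> = ?F \<one>\<^bsub>H\<^esub> \<one>\<^bsub>H\<^esub> \<one>\<^bsub>H\<^esub>"
    by (intro H.sw2_one[OF B.vsp] lin a)
  also have "\<dots> = sw2 H g (\<lambda>g1 g2. vscale B (counit H g1) ((a \<cdot>\<^bsub>A\<^esub> c) \<otimes>\<^bsub>A,H\<^esub> g2))"
    by (intro sw2_cong lin a)
      (simp_all add: one_tri coc_one_left A.one_mul H.one_mul A.vscale_mul tens_scale lin a)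
  also have "\<dots> = (a \<cdot>\<^bsub>A\<^esub> c) \<otimes>\<^bsub>A,H\<^esub> g"
    by (intro sw2_counit(1)[OF H.coalg] lin a)
  finally show ?thesis .
qed

lemma mul_iA_iA: "a \<in> vcar A \<Longrightarrow> b \<in> vcar A \<Longrightarrow> iA a \<cdot>\<^bsub>B\<^esub> iA b = iA (a \<cdot>\<^bsub>A\<^esub> b)"
  using mul_iA_tens[OF _ _ H.one_closed] by (simp add: iA_def)

lemma mul_iA_iH: "a \<in> vcar A \<Longrightarrow> h \<in> vcar H \<Longrightarrow> iA a \<cdot>\<^bsub>B\<^esub> iH h = a \<otimes>\<^bsub>A,H\<^esub> h"
  using mul_iA_tens[OF _ A.one_closed] by (simp add: iH_def A.one_mul)

lemma mul_iH_iA: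
  assumes ha: "h \<in> vcar H" "a \<in> vcar A"
  shows "iH h \<cdot>\<^bsub>B\<^esub> iA a = sw2 H h (\<lambda>h1 h2. tri h1 a \<otimes>\<^bsub>A,H\<^esub> h2)"
proof -
  have "iH h \<cdot>\<^bsub>B\<^esub> iA a = sw3 H h (\<lambda>h1 h2 h3. sw2 H \<one>\<^bsub>H\<^esub> (\<lambda>g1 g2.
      (\<one>\<^bsub>A\<^esub> \<cdot>\<^bsub>A\<^esub> tri h1 a \<cdot>\<^bsub>A\<^esub> coc h2 g1) \<otimes>\<^bsub>A,H\<^esub> (h3 \<cdot>\<^bsub>H\<^esub> g2)))"
    unfolding iH_def iA_def by (intro mul_tens lin ha)
  also have "\<dots> = sw3 H h (\<lambda>h1 h2 h3.
      (\<one>\<^bsub>A\<^esub> \<cdot>\<^bsub>A\<^esub> tri h1 a \<cdot>\<^bsub>A\<^esub> coc h2 \<one>\<^bsub>H\<^esub>) \<otimes>\<^bsub>A,H\<^esub> (h3 \<cdot>\<^bsub>H\<^esub> \<one>\<^bsub>H\<^esub>))"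
    by (intro sw3_cong lin ha H.sw2_one[OF B.vsp])
  also have "\<dots> = sw2 H h (\<lambda>h1 h'. sw2 H h' (\<lambda>h2 h3. vscale B (counit H h2) (tri h1 a \<otimes>\<^bsub>A,H\<^esub> h3)))"
    unfolding sw3_def
    by (intro sw2_cong lin ha)
      (simp_all add: coc_one_right A.one_mul H.one_mul A.vscale_mul tens_scale tri_closed A.one_closed ha)
  also have "\<dots> = sw2 H h (\<lambda>h1 h2. tri h1 a \<otimes>\<^bsub>A,H\<^esub> h2)"
    by (intro sw2_cong sw2_counit(1)[OF H.coalg] lin ha)
  finally show ?thesis .
qed

lemma piA_mul_iH_iA:
  assumes ha: "h \<in> vcar H" "a \<in> vcar A"
  shows "piA (iH h \<cdot>\<^bsub>B\<^esub> iA a) = tri h a"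
proof -
  have "piA (iH h \<cdot>\<^bsub>B\<^esub> iA a) = sw2 H h (\<lambda>h1 h2. piA (tri h1 a \<otimes>\<^bsub>A,H\<^esub> h2))"
    unfolding mul_iH_iA[OF ha] by (intro linear_map_sw2[OF linear_piA] lin ha)
  also have "\<dots> = sw2 H h (\<lambda>h1 h2. vscale A (counit H h2) (tri h1 a))"
    by (intro sw2_cong piA_tens lin ha)
  also have "\<dots> = tri h a"
    by (intro sw2_counit(2)[OF H.coalg] lin ha)
  finally show ?thesis .
qed

lemma piA_mul_iH_iH:
  assumes hg: "h \<in> vcar H" "g \<in> vcar H"
  shows "piA (iH h \<cdot>\<^bsub>B\<^esub> iH g) = coc h g"
proof -
  have "piA (iH h \<cdot>\<^bsub>B\<^esub> iH g) = sw2 H h (\<lambda>h1 h2. piA (sw2 H g (\<lambda>g1 g2. coc h1 g1 \<otimes>\<^bsub>A,H\<^esub> (h2 \<cdot>\<^bsub>H\<^esub> g2))))"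
    unfolding mul_iH_iH[OF hg] by (intro linear_map_sw2[OF linear_piA] lin hg)
  also have "\<dots> = sw2 H h (\<lambda>h1 h2. sw2 H g (\<lambda>g1 g2. piA (coc h1 g1 \<otimes>\<^bsub>A,H\<^esub> (h2 \<cdot>\<^bsub>H\<^esub> g2))))"
    by (intro sw2_cong linear_map_sw2[OF linear_piA] lin hg)
  also have "\<dots> = sw2 H h (\<lambda>h1 h2. sw2 H g (\<lambda>g1 g2. vscale A (counit H g2) (vscale A (counit H h2) (coc h1 g1))))"
    by (intro sw2_cong lin hg) (simp_all add: piA_tens lin H.counit_mul vscale_laws(3)[OF A.vsp] mult.commute)
  also have "\<dots> = sw2 H h (\<lambda>h1 h2. vscale A (counit H h2) (coc h1 g))"
    by (intro sw2_cong sw2_counit(2)[OF H.coalg] lin hg)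
  also have "\<dots> = coc h g"
    by (intro sw2_counit(2)[OF H.coalg] lin hg)
  finally show ?thesis .
qed

text \<open>
  The action and the cocycle are compatible with comultiplication because they are the \<open>A\<close>-components
  of products in the bialgebra \<open>A # H\<close>: \<open>h \<triangleright> a = \<pi>\<^sub>A (i\<^sub>H h \<cdot> i\<^sub>A a)\<close> and \<open>f(h, g) = \<pi>\<^sub>A (i\<^sub>H h \<cdot> i\<^sub>H g)\<close>.
\<close>
lemma comultiplicative2_tri: "comultiplicative2 H A A (\<lambda>h a. tri h a)"
  by (rule comultiplicative2_cong[OF H.coalg A.coalg
        comultiplicative2_hom[OF H.coalg A.coalg B.coalg A.coalg
          comultiplicative2_comp[OF H.coalg A.coalg B.coalg B.coalg B.comultiplicative2_mul B.bilinear_mul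
            coalgebra_hom_iH coalgebra_hom_iA] coalgebra_hom_piA]])
    (rule piA_mul_iH_iA)

lemma comultiplicative2_coc: "comultiplicative2 H H A (\<lambda>h g. coc h g)"
  by (rule comultiplicative2_cong[OF H.coalg H.coalg
        comultiplicative2_hom[OF H.coalg H.coalg B.coalg A.coalg
          comultiplicative2_comp[OF H.coalg H.coalg B.coalg B.coalg B.comultiplicative2_mul B.bilinear_mul
            coalgebra_hom_iH coalgebra_hom_iH] coalgebra_hom_piA]])
    (rule piA_mul_iH_iH)

lemma counit_tri: "h \<in> vcar H \<Longrightarrow> a \<in> vcar A \<Longrightarrow> counit A (tri h a) = counit H h * counit A a"
  unfolding piA_mul_iH_iA[symmetric]
  by (simp add: coalgebra_homD(3)[OF coalgebra_hom_piA] lin B.counit_mul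
      coalgebra_homD(3)[OF coalgebra_hom_iA] coalgebra_homD(3)[OF coalgebra_hom_iH])

lemma counit_coc: "h \<in> vcar H \<Longrightarrow> g \<in> vcar H \<Longrightarrow> counit A (coc h g) = counit H h * counit H g"
  unfolding piA_mul_iH_iH[symmetric]
  by (simp add: coalgebra_homD(3)[OF coalgebra_hom_piA] lin B.counit_mul
      coalgebra_homD(3)[OF coalgebra_hom_iH])

text \<open>
  The counits remove the \<open>H\<close>-part \<open>y\<^sub>3 w\<^sub>2\<close> of the product.
\<close>
lemma piA_mul:
  assumes xyzw: "x \<in> vcar A" "y \<in> vcar H" "z \<in> vcar A" "w \<in> vcar H"
  shows "piA ((x \<otimes>\<^bsub>A,H\<^esub> y) \<cdot>\<^bsub>B\<^esub> (z \<otimes>\<^bsub>A,H\<^esub> w)) = sw2 H y (\<lambda>y1 y2. x \<cdot>\<^bsub>A\<^esub> tri y1 z \<cdot>\<^bsub>A\<^esub> coc y2 w)"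
proof -
  have "piA ((x \<otimes>\<^bsub>A,H\<^esub> y) \<cdot>\<^bsub>B\<^esub> (z \<otimes>\<^bsub>A,H\<^esub> w)) = 
    sw2 H y (\<lambda>y1 y'. sw2 H y' (\<lambda>y2 y3. sw2 H w (\<lambda>w1 w2.
      piA ((x \<cdot>\<^bsub>A\<^esub> tri y1 z \<cdot>\<^bsub>A\<^esub> coc y2 w1) \<otimes>\<^bsub>A,H\<^esub> (y3 \<cdot>\<^bsub>H\<^esub> w2)))))"
    unfolding mul_tens[OF xyzw] sw3_def[symmetric]
    by (subst linear_map_sw3[OF linear_piA B.vsp H.coalg xyzw(2)])
      (intro lin sw3_cong linear_map_sw2[OF linear_piA] xyzw; assumption)+
  also have "\<dots> = sw2 H y (\<lambda>y1 y'. sw2 H y' (\<lambda>y2 y3. sw2 H w (\<lambda>w1 w2.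
      vscale A (counit H w2) (vscale A (counit H y3) (x \<cdot>\<^bsub>A\<^esub> tri y1 z \<cdot>\<^bsub>A\<^esub> coc y2 w1)))))"
    by (intro sw2_cong lin xyzw) (simp_all add: piA_tens lin xyzw H.counit_mul vscale_laws(3)[OF A.vsp] mult.commute)
  also have "\<dots> = sw2 H y (\<lambda>y1 y'. sw2 H y' (\<lambda>y2 y3.
      (vscale A (counit H y3) (x \<cdot>\<^bsub>A\<^esub> tri y1 z \<cdot>\<^bsub>A\<^esub> coc y2 w))))"
    by (intro sw2_cong sw2_counit(2)[OF H.coalg] lin xyzw)
  also have "\<dots> = sw2 H y (\<lambda>y1 y2. x \<cdot>\<^bsub>A\<^esub> tri y1 z \<cdot>\<^bsub>A\<^esub> coc y2 w)"
    by (intro sw2_cong sw2_counit(2)[OF H.coalg] lin xyzw)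
  finally show ?thesis .
qed

text \<open>
  The action and the cocycle preserve counits, so the \<open>A\<close>-part of the product contributes a scalar.
\<close>
lemma piH_mul_tens:
  assumes xyzw: "x \<in> vcar A" "y \<in> vcar H" "z \<in> vcar A" "w \<in> vcar H"
  shows "piH ((x \<otimes>\<^bsub>A,H\<^esub> y) \<cdot>\<^bsub>B\<^esub> (z \<otimes>\<^bsub>A,H\<^esub> w)) = vscale H (counit A x * counit A z) (y \<cdot>\<^bsub>H\<^esub> w)"
proof -
  let ?k = "counit A x * counit A z"
  have "piH ((x \<otimes>\<^bsub>A,H\<^esub> y) \<cdot>\<^bsub>B\<^esub> (z \<otimes>\<^bsub>A,H\<^esub> w)) = 
    sw2 H y (\<lambda>y1 y'. sw2 H y' (\<lambda>y2 y3. sw2 H w (\<lambda>w1 w2.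
      piH ((x \<cdot>\<^bsub>A\<^esub> tri y1 z \<cdot>\<^bsub>A\<^esub> coc y2 w1) \<otimes>\<^bsub>A,H\<^esub> (y3 \<cdot>\<^bsub>H\<^esub> w2)))))"
    unfolding mul_tens[OF xyzw] sw3_def[symmetric]
    by (subst linear_map_sw3[OF linear_piH B.vsp H.coalg xyzw(2)])
      (intro lin sw3_cong linear_map_sw2[OF linear_piH] xyzw; assumption)+
  also have "\<dots> = sw2 H y (\<lambda>y1 y'. sw2 H y' (\<lambda>y2 y3. sw2 H w (\<lambda>w1 w2.
      vscale H (counit H w1) (vscale H (counit H y2) (vscale H (counit H y1) (vscale H ?k (y3 \<cdot>\<^bsub>H\<^esub> w2)))))))"
    by (intro sw2_cong lin xyzw)
      (simp_all add: piH_tens lin xyzw A.counit_mul counit_tri counit_coc vscale_laws(3)[OF H.vsp] ac_simps)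
  also have "\<dots> = sw2 H y (\<lambda>y1 y'. sw2 H y' (\<lambda>y2 y3.
      vscale H (counit H y2) (vscale H (counit H y1) (vscale H ?k (y3 \<cdot>\<^bsub>H\<^esub> w)))))"
    by (intro sw2_cong sw2_counit(1)[OF H.coalg] lin xyzw)
  also have "\<dots> = sw2 H y (\<lambda>y1 y3. vscale H (counit H y1) (vscale H ?k (y3 \<cdot>\<^bsub>H\<^esub> w)))"
    by (intro sw2_cong sw2_counit(1)[OF H.coalg] lin xyzw)
  also have "\<dots> = vscale H ?k (y \<cdot>\<^bsub>H\<^esub> w)"
    by (intro sw2_counit(1)[OF H.coalg] lin xyzw)
  finally show ?thesis .
qed

lemma piH_mul:
  assumes st: "s \<in> vcar B" "t \<in> vcar B"
  shows "piH (s \<cdot>\<^bsub>B\<^esub> t) = piH s \<cdot>\<^bsub>H\<^esub> piH t"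
proof (rule B_eqI[OF _ _ _ st(1)])
  show "linear_map B H (\<lambda>s. piH (s \<cdot>\<^bsub>B\<^esub> t))" "linear_map B H (\<lambda>s. piH s \<cdot>\<^bsub>H\<^esub> piH t)"
    by (intro lin st)+
  fix x y assume xy: "x \<in> vcar A" "y \<in> vcar H"
  let ?s = "x \<otimes>\<^bsub>A,H\<^esub> y"
  show "piH (?s \<cdot>\<^bsub>B\<^esub> t) = piH ?s \<cdot>\<^bsub>H\<^esub> piH t"
  proof (rule B_eqI[OF _ _ _ st(2)])
    show "linear_map B H (\<lambda>t. piH (?s \<cdot>\<^bsub>B\<^esub> t))" "linear_map B H (\<lambda>t. piH ?s \<cdot>\<^bsub>H\<^esub> piH t)"
      by (intro lin xy)+
    fix z w assume zw: "z \<in> vcar A" "w \<in> vcar H"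
    show "piH (?s \<cdot>\<^bsub>B\<^esub> (z \<otimes>\<^bsub>A,H\<^esub> w)) = piH ?s \<cdot>\<^bsub>H\<^esub> piH (z \<otimes>\<^bsub>A,H\<^esub> w)"
      by (simp add: piH_mul_tens piH_tens xy zw H.vscale_mul is_vspaceD(4)[OF H.vsp] vscale_laws(3)[OF H.vsp] mult.commute)
  qed
qed

text \<open>
  By \<open>components\<close>, \<open>s x y = \<pi>\<^sub>A (s x\<^sub>1 y\<^sub>1) # \<pi>\<^sub>H (s x\<^sub>2 y\<^sub>2)\<close>, so \<open>s\<close> is determined by its two
  components.
\<close>
lemma comultiplicative2_eqI:
  fixes C :: "('k, 'c::ab_group_add, 'm) coalg_scheme" and D :: "('k, 'd::ab_group_add, 'n) coalg_scheme"
  assumes co: "coalgebra C" "coalgebra D"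
    and st: "comultiplicative2 C D B s" "comultiplicative2 C D B t"
    and eq: "\<And>x y. x \<in> vcar C \<Longrightarrow> y \<in> vcar D \<Longrightarrow> piA (s x y) = piA (t x y)"
      "\<And>x y. x \<in> vcar C \<Longrightarrow> y \<in> vcar D \<Longrightarrow> piH (s x y) = piH (t x y)"
    and xy: "x \<in> vcar C" "y \<in> vcar D"
  shows "s x y = t x y"
proof -
  have *: "s x y = sw2 C x (\<lambda>x1 x2. sw2 D y (\<lambda>y1 y2. piA (s x1 y1) \<otimes>\<^bsub>A,H\<^esub> piH (s x2 y2)))"
    if "comultiplicative2 C D B s" for s
  proof -
    have "s x y \<in> vcar B" using that xy by (auto simp: comultiplicative2_def)
    hence "s x y = sw2 B (s x y) (\<lambda>x y. piA x \<otimes>\<^bsub>A,H\<^esub> piH y)" by (rule components(1)[symmetric])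
    also have "\<dots> = sw2 C x (\<lambda>x1 x2. sw2 D y (\<lambda>y1 y2. piA (s x1 y1) \<otimes>\<^bsub>A,H\<^esub> piH (s x2 y2)))"
      by (rule sw2_comultiplicative2[OF co B.coalg B.vsp that _ xy]) (intro lin)
    finally show ?thesis .
  qed
  show ?thesis unfolding *[OF st(1)] *[OF st(2)]
    by (intro sw2_cong co xy) (simp add: eq)
qed

section \<open>Coalgebra maps into a crossed product\<close>

text \<open>
  The map \<open>c \<mapsto> x(c\<^sub>1) # y(c\<^sub>2)\<close>, and the condition under which it is a coalgebra map for coalgebra
  maps \<open>x\<close> and \<open>y\<close>. For \<open>(u, p)\<close> and \<open>(r, v)\<close> this is the first, respectively second, compatibility
  condition of a quadruple.
\<close>
definition pair :: "('k, 'c::ab_group_add, 'm) coalg_scheme \<Rightarrow> ('c \<Rightarrow> 'a) \<Rightarrow> ('c \<Rightarrow> 'h) \<Rightarrow> 'c \<Rightarrow> ('k, 'a, 'h) tensor"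
  where "pair C x y c = sw2 C c (\<lambda>c1 c2. x c1 \<otimes>\<^bsub>A,H\<^esub> y c2)"

definition cocommuting :: "('k, 'c::ab_group_add, 'm) coalg_scheme \<Rightarrow> ('c \<Rightarrow> 'a) \<Rightarrow> ('c \<Rightarrow> 'h) \<Rightarrow> bool"
  where "cocommuting C x y \<longleftrightarrow>
    (\<forall>c\<in>vcar C. sw2 C c (\<lambda>c1 c2. x c1 \<otimes>\<^bsub>A,H\<^esub> y c2) = sw2 C c (\<lambda>c1 c2. x c2 \<otimes>\<^bsub>A,H\<^esub> y c1))"

lemma pair_cong:
  assumes "coalgebra C" "c \<in> vcar C" "\<And>d. d \<in> vcar C \<Longrightarrow> x d = x' d" "\<And>d. d \<in> vcar C \<Longrightarrow> y d = y' d"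
  shows "pair C x y c = pair C x' y' c"
  unfolding pair_def using assms by (intro sw2_cong) auto

lemma cocommuting_cong:
  assumes "cocommuting C x y" "coalgebra C"
    and eq: "\<And>d. d \<in> vcar C \<Longrightarrow> x d = x' d" "\<And>d. d \<in> vcar C \<Longrightarrow> y d = y' d"
  shows "cocommuting C x' y'"
proof -
  have "sw2 C c (\<lambda>c1 c2. x c1 \<otimes>\<^bsub>A,H\<^esub> y c2) = sw2 C c (\<lambda>c1 c2. x' c1 \<otimes>\<^bsub>A,H\<^esub> y' c2)"
    "sw2 C c (\<lambda>c1 c2. x c2 \<otimes>\<^bsub>A,H\<^esub> y c1) = sw2 C c (\<lambda>c1 c2. x' c2 \<otimes>\<^bsub>A,H\<^esub> y' c1)"
    if "c \<in> vcar C" for c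
    using assms(2) that by (intro sw2_cong; simp add: eq)+
  thus ?thesis using assms(1) by (simp add: cocommuting_def)
qed

text \<open>
  The condition is stated for pure tensors and extends to bilinear maps by the universal property.
\<close>
lemma sw2_cocommuting:
  fixes C :: "('k, 'c::ab_group_add, 'm) coalg_scheme"
    and U :: "('k, 'u::ab_group_add, 'p) vspace_scheme"
  assumes C: "coalgebra C" and x: "linear_map C A x" and y: "linear_map C H y" and co: "cocommuting C x y"
    and U: "is_vspace U" and \<beta>: "bilinear_map A H U \<beta>" and c: "c \<in> vcar C"
  shows "sw2 C c (\<lambda>c1 c2. \<beta> (x c1) (y c2)) = sw2 C c (\<lambda>c1 c2. \<beta> (x c2) (y c1))"
proof -
  note [lin] = linear_mapD(1)[OF x] linear_mapD(1)[OF y]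
  have L: "linear_map B U (tensor_lift A H \<beta>)"
    by (rule linear_map_lift_B[OF U \<beta> linear_map_id])
  have "sw2 C c (\<lambda>c1 c2. \<beta> (x c1) (y c2)) = sw2 C c (\<lambda>c1 c2. tensor_lift A H \<beta> (x c1 \<otimes>\<^bsub>A,H\<^esub> y c2))"
    by (intro sw2_cong C c tensor_lift_tens[OF U \<beta>, symmetric] lin)
  also have "\<dots> = tensor_lift A H \<beta> (sw2 C c (\<lambda>c1 c2. x c1 \<otimes>\<^bsub>A,H\<^esub> y c2))"
    by (intro linear_map_sw2[OF L, symmetric] lin C c)
  also have "\<dots> = tensor_lift A H \<beta> (sw2 C c (\<lambda>c1 c2. x c2 \<otimes>\<^bsub>A,H\<^esub> y c1))"
    using co c by (simp add: cocommuting_def)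
  also have "\<dots> = sw2 C c (\<lambda>c1 c2. tensor_lift A H \<beta> (x c2 \<otimes>\<^bsub>A,H\<^esub> y c1))"
    by (intro linear_map_sw2[OF L] lin C c)
  also have "\<dots> = sw2 C c (\<lambda>c1 c2. \<beta> (x c2) (y c1))"
    by (intro sw2_cong C c tensor_lift_tens[OF U \<beta>] lin)
  finally show ?thesis .
qed

text \<open>
  The two sides of the comultiplication law are \<open>x(c\<^sub>1) # y(c\<^sub>3) \<otimes> x(c\<^sub>2) # y(c\<^sub>4)\<close> and
  \<open>x(c\<^sub>1) # y(c\<^sub>2) \<otimes> x(c\<^sub>3) # y(c\<^sub>4)\<close>; they differ by an exchange of the two middle components, which is
  what cocommuting maps allow.
\<close>
lemma coalgebra_hom_pair:
  fixes C :: "('k, 'c::ab_group_add, 'm) coalg_scheme"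
  assumes C: "coalgebra C" and x: "coalgebra_hom C A x" and y: "coalgebra_hom C H y"
    and co: "cocommuting C x y"
  shows "coalgebra_hom C B (pair C x y)"
  unfolding coalgebra_hom_def
proof (intro conjI ballI)
  let ?TB = "tensor_space B B"
  note hx = coalgebra_homD[OF x] and hy = coalgebra_homD[OF y]
  note [lin] = linear_map_comp[OF _ hx(1)] linear_map_comp[OF _ hy(1)] hx(4) hy(4)
  show "linear_map C B (pair C x y)"
    unfolding pair_def by (intro lin C)
  fix c assume c: "c \<in> vcar C"
  have "counit B (pair C x y c) = sw2 C c (\<lambda>c1 c2. counit B (x c1 \<otimes>\<^bsub>A,H\<^esub> y c2))"
    unfolding pair_def by (intro linear_map_sw2[OF coalgebraD(3)[OF B.coalg]] lin C c)
  also have "\<dots> = sw2 C c (\<lambda>c1 c2. vscale ground (counit C c1) (counit C c2))"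
    by (intro sw2_cong C c) (simp add: counit_tens hx hy ground_def)
  also have "\<dots> = counit C c"
    by (intro sw2_counit(1)[OF C] c coalgebraD C)
  finally show "counit B (pair C x y c) = counit C c" .
  have "comul B (pair C x y c) = sw2 C c (\<lambda>c' c''. comul B (x c' \<otimes>\<^bsub>A,H\<^esub> y c''))"
    unfolding pair_def by (intro linear_map_sw2[OF coalgebraD(2)[OF B.coalg]] lin C c)
  also have "\<dots> = sw2 C c (\<lambda>c' c''. sw2 A (x c') (\<lambda>a1 a2. sw2 H (y c'') (\<lambda>h1 h2.
      (a1 \<otimes>\<^bsub>A,H\<^esub> h1) \<otimes>\<^bsub>B,B\<^esub> (a2 \<otimes>\<^bsub>A,H\<^esub> h2))))"
    using comultiplicative2_tens by (intro sw2_cong C c) (simp add: comultiplicative2_def hx hy)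
  also have "\<dots> = sw2 C c (\<lambda>c' c''. sw2 C c' (\<lambda>c1 c2. sw2 H (y c'') (\<lambda>h1 h2.
      (x c1 \<otimes>\<^bsub>A,H\<^esub> h1) \<otimes>\<^bsub>B,B\<^esub> (x c2 \<otimes>\<^bsub>A,H\<^esub> h2))))"
    by (intro sw2_cong C c sw2_hom[OF C A.coalg is_vspace_tensor_space[of B B] x] lin)
  also have "\<dots> = sw2 C c (\<lambda>c' c''. sw2 C c' (\<lambda>c1 c2. sw2 C c'' (\<lambda>c3 c4.
      (x c1 \<otimes>\<^bsub>A,H\<^esub> y c3) \<otimes>\<^bsub>B,B\<^esub> (x c2 \<otimes>\<^bsub>A,H\<^esub> y c4))))"
    by (intro sw2_cong C c sw2_hom[OF C H.coalg is_vspace_tensor_space[of B B] y] lin)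
  \<comment> \<open>Make the two middle components the halves of one element \<open>e\<close>, exchange them, and regroup back.\<close>
  also have "\<dots> = sw2 C c (\<lambda>c1 d. sw2 C d (\<lambda>e c4. sw2 C e (\<lambda>c2 c3.
      (x c1 \<otimes>\<^bsub>A,H\<^esub> y c3) \<otimes>\<^bsub>B,B\<^esub> (x c2 \<otimes>\<^bsub>A,H\<^esub> y c4))))"
    by (intro sw4_regroup_middle[OF C c is_vspace_tensor_space[of B B]] lin C)
  also have "\<dots> = sw2 C c (\<lambda>c1 d. sw2 C d (\<lambda>e c4. sw2 C e (\<lambda>c2 c3.
      (x c1 \<otimes>\<^bsub>A,H\<^esub> y c2) \<otimes>\<^bsub>B,B\<^esub> (x c3 \<otimes>\<^bsub>A,H\<^esub> y c4))))"
    by (intro sw2_cong C c sw2_cocommuting[OF C hx(1) hy(1) co is_vspace_tensor_space[of B B]] lin)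
  also have "\<dots> = sw2 C c (\<lambda>c' c''. sw2 C c' (\<lambda>c1 c2. sw2 C c'' (\<lambda>c3 c4.
      (x c1 \<otimes>\<^bsub>A,H\<^esub> y c2) \<otimes>\<^bsub>B,B\<^esub> (x c3 \<otimes>\<^bsub>A,H\<^esub> y c4))))"
    by (intro sw4_regroup_middle[OF C c is_vspace_tensor_space[of B B], symmetric] lin C)
  also have "\<dots> = sw2 C c (\<lambda>c' c''. sw2 C c' (\<lambda>c1 c2. (x c1 \<otimes>\<^bsub>A,H\<^esub> y c2) \<otimes>\<^bsub>B,B\<^esub> pair C x y c''))"
    unfolding pair_def
    by (intro sw2_cong C c linear_map_sw2[OF linear_map_tens_right[OF linear_map_id], symmetric] lin)
  also have "\<dots> = sw2 C c (\<lambda>c' c''. pair C x y c' \<otimes>\<^bsub>B,B\<^esub> pair C x y c'')"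
    unfolding pair_def
    by (intro sw2_cong C c linear_map_sw2[OF linear_map_tens_left[OF linear_map_id], symmetric] lin)
  finally show "comul B (pair C x y c) = \<dots>" .
qed

lemma piA_pair:
  fixes C :: "('k, 'c::ab_group_add, 'm) coalg_scheme"
  assumes C: "coalgebra C" and x: "coalgebra_hom C A x" and y: "coalgebra_hom C H y" and c: "c \<in> vcar C"
  shows "piA (pair C x y c) = x c"
proof -
  note hx = coalgebra_homD[OF x] and hy = coalgebra_homD[OF y]
  have "piA (pair C x y c) = sw2 C c (\<lambda>c1 c2. piA (x c1 \<otimes>\<^bsub>A,H\<^esub> y c2))"
    unfolding pair_def by (intro linear_map_sw2[OF linear_piA] lin C c hx hy)
  also have "\<dots> = sw2 C c (\<lambda>c1 c2. vscale A (counit C c2) (x c1))"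
    by (intro sw2_cong C c) (simp add: piA_tens hx hy)
  also have "\<dots> = x c" by (intro sw2_counit(2)[OF C c] hx)
  finally show ?thesis .
qed

lemma piH_pair:
  fixes C :: "('k, 'c::ab_group_add, 'm) coalg_scheme"
  assumes C: "coalgebra C" and x: "coalgebra_hom C A x" and y: "coalgebra_hom C H y" and c: "c \<in> vcar C"
  shows "piH (pair C x y c) = y c"
proof -
  note hx = coalgebra_homD[OF x] and hy = coalgebra_homD[OF y]
  have "piH (pair C x y c) = sw2 C c (\<lambda>c1 c2. piH (x c1 \<otimes>\<^bsub>A,H\<^esub> y c2))"
    unfolding pair_def by (intro linear_map_sw2[OF linear_piH] lin C c hx hy)
  also have "\<dots> = sw2 C c (\<lambda>c1 c2. vscale H (counit C c1) (y c2))"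
    by (intro sw2_cong C c) (simp add: piH_tens hx hy)
  also have "\<dots> = y c" by (intro sw2_counit(1)[OF C c] hy)
  finally show ?thesis .
qed

text \<open>
  Conversely, every coalgebra map into \<open>A # H\<close> is the pair of its components, and these cocommute:
  both statements are \<open>components\<close> for \<open>b = \<phi> c\<close>.
\<close>
lemma pair_components:
  fixes C :: "('k, 'c::ab_group_add, 'm) coalg_scheme"
  assumes C: "coalgebra C" and \<phi>: "coalgebra_hom C B \<phi>"
  shows "c \<in> vcar C \<Longrightarrow> pair C (\<lambda>x. piA (\<phi> x)) (\<lambda>x. piH (\<phi> x)) c = \<phi> c"
    and "cocommuting C (\<lambda>x. piA (\<phi> x)) (\<lambda>x. piH (\<phi> x))"
proof -
  have 1: "sw2 C c (\<lambda>c1 c2. piA (\<phi> c1) \<otimes>\<^bsub>A,H\<^esub> piH (\<phi> c2)) = \<phi> c" if c: "c \<in> vcar C" for c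
  proof -
    have "sw2 C c (\<lambda>c1 c2. piA (\<phi> c1) \<otimes>\<^bsub>A,H\<^esub> piH (\<phi> c2)) = sw2 B (\<phi> c) (\<lambda>x y. piA x \<otimes>\<^bsub>A,H\<^esub> piH y)"
      by (rule sw2_hom[OF C B.coalg B.vsp \<phi> _ c, symmetric]) (intro lin)
    thus ?thesis by (simp add: components coalgebra_homD(4)[OF \<phi> c])
  qed
  have 2: "sw2 C c (\<lambda>c1 c2. piA (\<phi> c2) \<otimes>\<^bsub>A,H\<^esub> piH (\<phi> c1)) = \<phi> c" if c: "c \<in> vcar C" for c
  proof -
    have "sw2 C c (\<lambda>c1 c2. piA (\<phi> c2) \<otimes>\<^bsub>A,H\<^esub> piH (\<phi> c1)) = sw2 B (\<phi> c) (\<lambda>x y. piA y \<otimes>\<^bsub>A,H\<^esub> piH x)"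
      by (rule sw2_hom[OF C B.coalg B.vsp \<phi> _ c, symmetric]) (intro lin)
    thus ?thesis by (simp add: components coalgebra_homD(4)[OF \<phi> c])
  qed
  show "c \<in> vcar C \<Longrightarrow> pair C (\<lambda>x. piA (\<phi> x)) (\<lambda>x. piH (\<phi> x)) c = \<phi> c"
    by (simp add: pair_def 1)
  show "cocommuting C (\<lambda>x. piA (\<phi> x)) (\<lambda>x. piH (\<phi> x))"
    by (simp add: cocommuting_def 1 2)
qed

lemma pair_mul_pair_raw:
  fixes C :: "('k, 'c::ab_group_add, 'm) coalg_scheme" and D :: "('k, 'd::ab_group_add, 'n) coalg_scheme"
  assumes CD: "coalgebra C" "coalgebra D"
    and x: "coalgebra_hom C A x" and y: "coalgebra_hom C H y"
    and z: "coalgebra_hom D A z" and w: "coalgebra_hom D H w" and cd: "c \<in> vcar C" "d \<in> vcar D"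
  shows "pair C x y c \<cdot>\<^bsub>B\<^esub> pair D z w d =
    sw2 C c (\<lambda>c1 c'. sw2 D d (\<lambda>d1 d'. (x c1 \<otimes>\<^bsub>A,H\<^esub> y c') \<cdot>\<^bsub>B\<^esub> (z d1 \<otimes>\<^bsub>A,H\<^esub> w d')))"
proof -
  note [lin] = CD cd coalgebra_homD(4)[OF x] coalgebra_homD(4)[OF y] coalgebra_homD(4)[OF z] coalgebra_homD(4)[OF w]
  have "pair C x y c \<cdot>\<^bsub>B\<^esub> pair D z w d = sw2 C c (\<lambda>c1 c'. (x c1 \<otimes>\<^bsub>A,H\<^esub> y c') \<cdot>\<^bsub>B\<^esub> pair D z w d)"
    unfolding pair_def by (intro B.sw2_mul_right lin)
  also have "\<dots> = sw2 C c (\<lambda>c1 c'. sw2 D d (\<lambda>d1 d'. (x c1 \<otimes>\<^bsub>A,H\<^esub> y c') \<cdot>\<^bsub>B\<^esub> (z d1 \<otimes>\<^bsub>A,H\<^esub> w d')))"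
    unfolding pair_def by (intro sw2_cong B.sw2_mul_left lin)
  finally show ?thesis .
qed

text \<open>
  With \<open>(u, p)\<close> and \<open>(r, v)\<close> for the two pairs, this is the formula for the morphism associated with a
  quadruple.
\<close>
lemma pair_mul_pair:
  fixes C :: "('k, 'c::ab_group_add, 'm) coalg_scheme" and D :: "('k, 'd::ab_group_add, 'n) coalg_scheme"
  assumes CD: "coalgebra C" "coalgebra D"
    and x: "coalgebra_hom C A x" and y: "coalgebra_hom C H y"
    and z: "coalgebra_hom D A z" and w: "coalgebra_hom D H w" and cd: "c \<in> vcar C" "d \<in> vcar D"
  shows "pair C x y c \<cdot>\<^bsub>B\<^esub> pair D z w d =
    sw4 C c (\<lambda>c1 c2 c3 c4. sw3 D d (\<lambda>d1 d2 d3.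
      (x c1 \<cdot>\<^bsub>A\<^esub> tri (y c2) (z d1) \<cdot>\<^bsub>A\<^esub> coc (y c3) (w d2)) \<otimes>\<^bsub>A,H\<^esub> (y c4 \<cdot>\<^bsub>H\<^esub> w d3)))"
proof -
  note [lin] = CD cd coalgebra_homD(4)[OF x] coalgebra_homD(4)[OF y] coalgebra_homD(4)[OF z] coalgebra_homD(4)[OF w]
    linear_map_comp[OF _ coalgebra_homD(1)[OF x]] linear_map_comp[OF _ coalgebra_homD(1)[OF y]]
    linear_map_comp[OF _ coalgebra_homD(1)[OF z]] linear_map_comp[OF _ coalgebra_homD(1)[OF w]]
  have "pair C x y c \<cdot>\<^bsub>B\<^esub> pair D z w d =
    sw2 C c (\<lambda>c1 c'. sw2 D d (\<lambda>d1 d'. (x c1 \<otimes>\<^bsub>A,H\<^esub> y c') \<cdot>\<^bsub>B\<^esub> (z d1 \<otimes>\<^bsub>A,H\<^esub> w d')))"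
    by (rule pair_mul_pair_raw[OF assms])
  also have "\<dots> = sw2 C c (\<lambda>c1 c'. sw2 D d (\<lambda>d1 d'. sw3 H (y c') (\<lambda>h1 h2 h3. sw2 H (w d') (\<lambda>g1 g2.
      (x c1 \<cdot>\<^bsub>A\<^esub> tri h1 (z d1) \<cdot>\<^bsub>A\<^esub> coc h2 g1) \<otimes>\<^bsub>A,H\<^esub> (h3 \<cdot>\<^bsub>H\<^esub> g2)))))"
    by (intro sw2_cong mul_tens lin)
  also have "\<dots> = sw2 C c (\<lambda>c1 c'. sw2 D d (\<lambda>d1 d'. sw3 C c' (\<lambda>c2 c3 c4. sw2 H (w d') (\<lambda>g1 g2.
      (x c1 \<cdot>\<^bsub>A\<^esub> tri (y c2) (z d1) \<cdot>\<^bsub>A\<^esub> coc (y c3) g1) \<otimes>\<^bsub>A,H\<^esub> (y c4 \<cdot>\<^bsub>H\<^esub> g2)))))"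
    by (intro sw2_cong sw3_hom[OF CD(1) H.coalg B.vsp y] lin)
  also have "\<dots> = sw2 C c (\<lambda>c1 c'. sw2 D d (\<lambda>d1 d'. sw3 C c' (\<lambda>c2 c3 c4. sw2 D d' (\<lambda>d2 d3.
      (x c1 \<cdot>\<^bsub>A\<^esub> tri (y c2) (z d1) \<cdot>\<^bsub>A\<^esub> coc (y c3) (w d2)) \<otimes>\<^bsub>A,H\<^esub> (y c4 \<cdot>\<^bsub>H\<^esub> w d3)))))"
    by (intro sw2_cong sw3_cong sw2_hom[OF CD(2) H.coalg B.vsp w] lin)
  also have "\<dots> = sw2 C c (\<lambda>c1 c'. sw3 C c' (\<lambda>c2 c3 c4. sw2 D d (\<lambda>d1 d'. sw2 D d' (\<lambda>d2 d3.
      (x c1 \<cdot>\<^bsub>A\<^esub> tri (y c2) (z d1) \<cdot>\<^bsub>A\<^esub> coc (y c3) (w d2)) \<otimes>\<^bsub>A,H\<^esub> (y c4 \<cdot>\<^bsub>H\<^esub> w d3)))))"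
    by (simp only: sw3_swap)
  finally show ?thesis by (simp only: sw4_def sw3_def[of D])
qed

text \<open>
  With \<open>(x, y)\<close> and \<open>(z, w)\<close> chosen among \<open>(u, p)\<close> and \<open>(r, v)\<close>, this is the source of all products
  of an action term and a cocycle term in the compatibility conditions with values in \<open>A'\<close>.
\<close>
lemma piA_pair_mul_pair:
  fixes C :: "('k, 'c::ab_group_add, 'm) coalg_scheme" and D :: "('k, 'd::ab_group_add, 'n) coalg_scheme"
  assumes CD: "coalgebra C" "coalgebra D"
    and x: "coalgebra_hom C A x" and y: "coalgebra_hom C H y"
    and z: "coalgebra_hom D A z" and w: "coalgebra_hom D H w" and cd: "c \<in> vcar C" "d \<in> vcar D"
  shows "piA (pair C x y c \<cdot>\<^bsub>B\<^esub> pair D z w d) =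
    sw3 C c (\<lambda>c1 c2 c3. sw2 D d (\<lambda>d1 d2.
      x c1 \<cdot>\<^bsub>A\<^esub> tri (y c2) (z d1) \<cdot>\<^bsub>A\<^esub> coc (y c3) (w d2)))"
proof -
  note [lin] = CD cd coalgebra_homD(4)[OF x] coalgebra_homD(4)[OF y] coalgebra_homD(4)[OF z] coalgebra_homD(4)[OF w]
    linear_map_comp[OF _ coalgebra_homD(1)[OF x]] linear_map_comp[OF _ coalgebra_homD(1)[OF y]]
    linear_map_comp[OF _ coalgebra_homD(1)[OF z]] linear_map_comp[OF _ coalgebra_homD(1)[OF w]]
  have "piA (pair C x y c \<cdot>\<^bsub>B\<^esub> pair D z w d) =
    sw2 C c (\<lambda>c1 c'. piA (sw2 D d (\<lambda>d1 d'. (x c1 \<otimes>\<^bsub>A,H\<^esub> y c') \<cdot>\<^bsub>B\<^esub> (z d1 \<otimes>\<^bsub>A,H\<^esub> w d'))))"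
    unfolding pair_mul_pair_raw[OF assms] by (intro linear_map_sw2[OF linear_piA] lin)
  also have "\<dots> = sw2 C c (\<lambda>c1 c'. sw2 D d (\<lambda>d1 d'. piA ((x c1 \<otimes>\<^bsub>A,H\<^esub> y c') \<cdot>\<^bsub>B\<^esub> (z d1 \<otimes>\<^bsub>A,H\<^esub> w d'))))"
    by (intro sw2_cong linear_map_sw2[OF linear_piA] lin)
  also have "\<dots> = sw2 C c (\<lambda>c1 c'. sw2 D d (\<lambda>d1 d'. sw2 H (y c') (\<lambda>h1 h2.
      x c1 \<cdot>\<^bsub>A\<^esub> tri h1 (z d1) \<cdot>\<^bsub>A\<^esub> coc h2 (w d'))))"
    by (intro sw2_cong piA_mul lin)
  also have "\<dots> = sw2 C c (\<lambda>c1 c'. sw2 D d (\<lambda>d1 d'. sw2 C c' (\<lambda>c2 c3.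
      x c1 \<cdot>\<^bsub>A\<^esub> tri (y c2) (z d1) \<cdot>\<^bsub>A\<^esub> coc (y c3) (w d'))))"
    by (intro sw2_cong sw2_hom[OF CD(1) H.coalg A.vsp y] lin)
  also have "\<dots> = sw2 C c (\<lambda>c1 c'. sw2 C c' (\<lambda>c2 c3. sw2 D d (\<lambda>d1 d'.
      x c1 \<cdot>\<^bsub>A\<^esub> tri (y c2) (z d1) \<cdot>\<^bsub>A\<^esub> coc (y c3) (w d'))))"
    by (subst sw2_swap[of C _ D d]) (rule refl)
  finally show ?thesis by (simp only: sw3_def)
qed

end

section \<open>The morphism of a quadruple\<close>

locale crossed_pair =
  S: crossed A H act f + T: crossed A' H' act' f'
  for A :: "('k::field, 'a::ab_group_add) bialg"
    and H :: "('k, 'h::ab_group_add) bialg"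
    and act :: "('k, 'h, 'a) tensor \<Rightarrow> 'a"
    and f :: "('k, 'h, 'h) tensor \<Rightarrow> 'a"
    and A' :: "('k, 'c::ab_group_add) bialg"
    and H' :: "('k, 'd::ab_group_add) bialg"
    and act' :: "('k, 'd, 'c) tensor \<Rightarrow> 'c"
    and f' :: "('k, 'd, 'd) tensor \<Rightarrow> 'c"

text \<open>
  A quadruple that satisfies the two commutation conditions. That suffices to define a unitary coalgebra
  map \<open>psi\<close> on \<open>A # H\<close>; the other conditions say that \<open>psi\<close> is multiplicative.
\<close>
locale quadruple = crossed_pair A H act f A' H' act' f'
  for A :: "('k::field, 'a::ab_group_add) bialg"
    and H :: "('k, 'h::ab_group_add) bialg"
    and act :: "('k, 'h, 'a) tensor \<Rightarrow> 'a"
    and f :: "('k, 'h, 'h) tensor \<Rightarrow> 'a"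
    and A' :: "('k, 'c::ab_group_add) bialg"
    and H' :: "('k, 'd::ab_group_add) bialg"
    and act' :: "('k, 'd, 'c) tensor \<Rightarrow> 'c"
    and f' :: "('k, 'd, 'd) tensor \<Rightarrow> 'c" +
  fixes u :: "'a \<Rightarrow> 'c" and p :: "'a \<Rightarrow> 'd" and r :: "'h \<Rightarrow> 'c" and v :: "'h \<Rightarrow> 'd"
  assumes u: "coalgebra_hom A A' u" and p: "coalgebra_hom A H' p"
    and r: "coalgebra_hom H A' r" and v: "coalgebra_hom H H' v"
    and u1: "u \<one>\<^bsub>A\<^esub> = \<one>\<^bsub>A'\<^esub>" and p1: "p \<one>\<^bsub>A\<^esub> = \<one>\<^bsub>H'\<^esub>"
    and r1: "r \<one>\<^bsub>H\<^esub> = \<one>\<^bsub>A'\<^esub>" and v1: "v \<one>\<^bsub>H\<^esub> = \<one>\<^bsub>H'\<^esub>"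
    and up: "T.cocommuting A u p" and rv: "T.cocommuting H r v"
begin

definition alpha where "alpha = T.pair A u p"
definition beta where "beta = T.pair H r v"
definition psi where "psi = tensor_lift A H (\<lambda>a h. alpha a \<cdot>\<^bsub>T.B\<^esub> beta h)"

lemma coalgebra_hom_alpha: "coalgebra_hom A T.B alpha"
  unfolding alpha_def by (rule T.coalgebra_hom_pair[OF S.A.coalg u p up])

lemma coalgebra_hom_beta: "coalgebra_hom H T.B beta"
  unfolding beta_def by (rule T.coalgebra_hom_pair[OF S.H.coalg r v rv])

lemmas [lin] = coalgebra_homD(4)[OF u] coalgebra_homD(4)[OF p] coalgebra_homD(4)[OF r] coalgebra_homD(4)[OF v]
  linear_map_comp[OF _ coalgebra_homD(1)[OF u]] linear_map_comp[OF _ coalgebra_homD(1)[OF p]]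
  linear_map_comp[OF _ coalgebra_homD(1)[OF r]] linear_map_comp[OF _ coalgebra_homD(1)[OF v]]
  coalgebra_homD(4)[OF coalgebra_hom_alpha] coalgebra_homD(4)[OF coalgebra_hom_beta]
  linear_map_comp[OF _ coalgebra_homD(1)[OF coalgebra_hom_alpha]]
  linear_map_comp[OF _ coalgebra_homD(1)[OF coalgebra_hom_beta]]

lemma components_alpha_beta:
  "a \<in> vcar A \<Longrightarrow> T.piA (alpha a) = u a" "a \<in> vcar A \<Longrightarrow> T.piH (alpha a) = p a"
  "h \<in> vcar H \<Longrightarrow> T.piA (beta h) = r h" "h \<in> vcar H \<Longrightarrow> T.piH (beta h) = v h"
  by (simp_all add: alpha_def beta_def T.piA_pair T.piH_pair S.A.coalg S.H.coalg u p r v)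

lemma alpha_one: "alpha \<one>\<^bsub>A\<^esub> = \<one>\<^bsub>T.B\<^esub>"
  unfolding alpha_def T.pair_def T.crossed_product_simps u1[symmetric] p1[symmetric]
  by (rule S.A.sw2_one[OF is_vspace_tensor_space[of A' H']]) (intro lin)

lemma beta_one: "beta \<one>\<^bsub>H\<^esub> = \<one>\<^bsub>T.B\<^esub>"
  unfolding beta_def T.pair_def T.crossed_product_simps r1[symmetric] v1[symmetric]
  by (rule S.H.sw2_one[OF is_vspace_tensor_space[of A' H']]) (intro lin)

lemma psi_tens: "a \<in> vcar A \<Longrightarrow> h \<in> vcar H \<Longrightarrow> psi (a \<otimes>\<^bsub>A,H\<^esub> h) = alpha a \<cdot>\<^bsub>T.B\<^esub> beta h"
  unfolding psi_def by (rule tensor_lift_tens[OF T.B.vsp]) (intro lin)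

lemma linear_psi: "linear_map S.B T.B psi"
  unfolding psi_def by (rule S.linear_map_lift_B[OF _ _ linear_map_id]) (intro lin)+

lemma psi_iA: "a \<in> vcar A \<Longrightarrow> psi (S.iA a) = alpha a"
  by (simp add: S.iA_def psi_tens S.H.one_closed beta_one T.B.one_mul lin)

lemma psi_iH: "h \<in> vcar H \<Longrightarrow> psi (S.iH h) = beta h"
  by (simp add: S.iH_def psi_tens S.A.one_closed alpha_one T.B.one_mul lin)

lemma psi_one: "psi \<one>\<^bsub>S.B\<^esub> = \<one>\<^bsub>T.B\<^esub>"
  using psi_iA[OF S.A.one_closed] by (simp add: S.iA_one alpha_one)

lemma comultiplicative2_alpha_beta: "comultiplicative2 A H T.B (\<lambda>a h. alpha a \<cdot>\<^bsub>T.B\<^esub> beta h)"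
  by (rule comultiplicative2_comp[OF S.A.coalg S.H.coalg T.B.coalg T.B.coalg T.B.comultiplicative2_mul
        T.B.bilinear_mul coalgebra_hom_alpha coalgebra_hom_beta])

text \<open>
  The map \<open>psi\<close> sends \<open>a # h\<close> to \<open>\<alpha> a \<cdot> \<beta> h\<close>, a product of coalgebra maps in a bialgebra.
\<close>
lemma coalgebra_hom_psi: "coalgebra_hom S.B T.B psi"
  unfolding coalgebra_hom_def
proof (intro conjI ballI linear_psi)
  note psi = linear_map_comp[OF _ linear_psi]
  note [lin] = psi linear_mapD(1)[OF linear_psi]
  fix b assume b: "b \<in> vcar S.B"
  show "counit T.B (psi b) = counit S.B b"
  proof (rule S.B_eqI[OF _ _ _ b])
    show "linear_map S.B ground (\<lambda>b. counit T.B (psi b))" "linear_map S.B ground (counit S.B)"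
      by (intro lin)+
    fix a h assume ah: "a \<in> vcar A" "h \<in> vcar H"
    show "counit T.B (psi (a \<otimes>\<^bsub>A,H\<^esub> h)) = counit S.B (a \<otimes>\<^bsub>A,H\<^esub> h)"
      by (simp add: psi_tens ah T.B.counit_mul lin S.counit_tens
          coalgebra_homD(3)[OF coalgebra_hom_alpha] coalgebra_homD(3)[OF coalgebra_hom_beta])
  qed
  show "comul T.B (psi b) = sw2 S.B b (\<lambda>x y. psi x \<otimes>\<^bsub>T.B,T.B\<^esub> psi y)"
  proof (rule S.B_eqI[where \<phi> = "\<lambda>b. comul T.B (psi b)" and U = "tensor_space T.B T.B", OF _ _ _ b])
    show "linear_map S.B (tensor_space T.B T.B) (\<lambda>b. comul T.B (psi b))"
      by (intro linear_map_comp[OF linear_psi] coalgebraD T.B.coalg)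
    show "linear_map S.B (tensor_space T.B T.B) (\<lambda>b. sw2 S.B b (\<lambda>x y. psi x \<otimes>\<^bsub>T.B,T.B\<^esub> psi y))"
      by (intro lin)
    fix a h assume ah: "a \<in> vcar A" "h \<in> vcar H"
    have "comul T.B (psi (a \<otimes>\<^bsub>A,H\<^esub> h)) = sw2 A a (\<lambda>a1 a2. sw2 H h (\<lambda>h1 h2.
        (alpha a1 \<cdot>\<^bsub>T.B\<^esub> beta h1) \<otimes>\<^bsub>T.B,T.B\<^esub> (alpha a2 \<cdot>\<^bsub>T.B\<^esub> beta h2)))"
      using comultiplicative2_alpha_beta ah by (simp add: comultiplicative2_def psi_tens)
    also have "\<dots> = sw2 A a (\<lambda>a1 a2. sw2 H h (\<lambda>h1 h2.
        psi (a1 \<otimes>\<^bsub>A,H\<^esub> h1) \<otimes>\<^bsub>T.B,T.B\<^esub> psi (a2 \<otimes>\<^bsub>A,H\<^esub> h2)))"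
      by (intro sw2_cong lin ah) (simp add: psi_tens)
    also have "\<dots> = sw2 S.B (a \<otimes>\<^bsub>A,H\<^esub> h) (\<lambda>x y. psi x \<otimes>\<^bsub>T.B,T.B\<^esub> psi y)"
      by (rule S.sw2_tens_B[OF is_vspace_tensor_space[of T.B T.B] _ ah, symmetric]) (intro lin)
    finally show "comul T.B (psi (a \<otimes>\<^bsub>A,H\<^esub> h)) = \<dots>" .
  qed
qed

lemma quadruple_value_eq:
  assumes "a \<in> vcar A" "h \<in> vcar H"
  shows "quadruple_value A H A' H' act' f' (u, p, r, v) a h = psi (a \<otimes>\<^bsub>A,H\<^esub> h)"
  unfolding psi_tens[OF assms] alpha_def beta_def
    T.pair_mul_pair[OF S.A.coalg S.H.coalg u p r v assms]
  by (simp add: quadruple_value_def)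

lemmas [lin] = linear_map_comp[OF _ linear_psi] linear_mapD(1)[OF linear_psi]

lemma psi_mul_iH_iH:
  assumes hg: "h \<in> vcar H" "g \<in> vcar H"
  shows "psi (S.iH h \<cdot>\<^bsub>S.B\<^esub> S.iH g) =
    sw2 H h (\<lambda>h1 h2. sw2 H g (\<lambda>g1 g2. alpha (S.coc h1 g1) \<cdot>\<^bsub>T.B\<^esub> beta (h2 \<cdot>\<^bsub>H\<^esub> g2)))"
proof -
  have "psi (S.iH h \<cdot>\<^bsub>S.B\<^esub> S.iH g) =
    sw2 H h (\<lambda>h1 h2. psi (sw2 H g (\<lambda>g1 g2. S.coc h1 g1 \<otimes>\<^bsub>A,H\<^esub> (h2 \<cdot>\<^bsub>H\<^esub> g2))))"
    unfolding S.mul_iH_iH[OF hg] by (intro linear_map_sw2[OF linear_psi] lin hg)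
  also have "\<dots> = sw2 H h (\<lambda>h1 h2. sw2 H g (\<lambda>g1 g2. psi (S.coc h1 g1 \<otimes>\<^bsub>A,H\<^esub> (h2 \<cdot>\<^bsub>H\<^esub> g2))))"
    by (intro sw2_cong linear_map_sw2[OF linear_psi] lin hg)
  also have "\<dots> = sw2 H h (\<lambda>h1 h2. sw2 H g (\<lambda>g1 g2. alpha (S.coc h1 g1) \<cdot>\<^bsub>T.B\<^esub> beta (h2 \<cdot>\<^bsub>H\<^esub> g2)))"
    by (intro sw2_cong psi_tens lin hg)
  finally show ?thesis .
qed

lemma psi_mul_iH_iA:
  assumes ha: "h \<in> vcar H" "a \<in> vcar A"
  shows "psi (S.iH h \<cdot>\<^bsub>S.B\<^esub> S.iA a) = sw2 H h (\<lambda>h1 h2. alpha (S.tri h1 a) \<cdot>\<^bsub>T.B\<^esub> beta h2)"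
proof -
  have "psi (S.iH h \<cdot>\<^bsub>S.B\<^esub> S.iA a) = sw2 H h (\<lambda>h1 h2. psi (S.tri h1 a \<otimes>\<^bsub>A,H\<^esub> h2))"
    unfolding S.mul_iH_iA[OF ha] by (intro linear_map_sw2[OF linear_psi] lin ha)
  also have "\<dots> = sw2 H h (\<lambda>h1 h2. alpha (S.tri h1 a) \<cdot>\<^bsub>T.B\<^esub> beta h2)"
    by (intro sw2_cong psi_tens lin ha)
  finally show ?thesis .
qed

lemma piH_psi_mul_iH_iH:
  assumes hg: "h \<in> vcar H" "g \<in> vcar H"
  shows "T.piH (psi (S.iH h \<cdot>\<^bsub>S.B\<^esub> S.iH g)) =
    sw2 H h (\<lambda>h1 h2. sw2 H g (\<lambda>g1 g2. p (S.coc h1 g1) \<cdot>\<^bsub>H'\<^esub> v (h2 \<cdot>\<^bsub>H\<^esub> g2)))"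
proof -
  have "T.piH (psi (S.iH h \<cdot>\<^bsub>S.B\<^esub> S.iH g)) =
    sw2 H h (\<lambda>h1 h2. T.piH (sw2 H g (\<lambda>g1 g2. alpha (S.coc h1 g1) \<cdot>\<^bsub>T.B\<^esub> beta (h2 \<cdot>\<^bsub>H\<^esub> g2))))"
    unfolding psi_mul_iH_iH[OF hg] by (intro linear_map_sw2[OF T.linear_piH] lin hg)
  also have "\<dots> = sw2 H h (\<lambda>h1 h2. sw2 H g (\<lambda>g1 g2. T.piH (alpha (S.coc h1 g1) \<cdot>\<^bsub>T.B\<^esub> beta (h2 \<cdot>\<^bsub>H\<^esub> g2))))"
    by (intro sw2_cong linear_map_sw2[OF T.linear_piH] lin hg)
  also have "\<dots> = sw2 H h (\<lambda>h1 h2. sw2 H g (\<lambda>g1 g2. p (S.coc h1 g1) \<cdot>\<^bsub>H'\<^esub> v (h2 \<cdot>\<^bsub>H\<^esub> g2)))"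
    by (intro sw2_cong lin hg) (simp_all add: T.piH_mul components_alpha_beta S.coc_closed S.H.mul_closed
        coalgebra_homD(4)[OF coalgebra_hom_alpha] coalgebra_homD(4)[OF coalgebra_hom_beta])
  finally show ?thesis .
qed

lemma piH_psi_mul_iH_iA:
  assumes ha: "h \<in> vcar H" "a \<in> vcar A"
  shows "T.piH (psi (S.iH h \<cdot>\<^bsub>S.B\<^esub> S.iA a)) = sw2 H h (\<lambda>h1 h2. p (S.tri h1 a) \<cdot>\<^bsub>H'\<^esub> v h2)"
proof -
  have "T.piH (psi (S.iH h \<cdot>\<^bsub>S.B\<^esub> S.iA a)) =
    sw2 H h (\<lambda>h1 h2. T.piH (alpha (S.tri h1 a) \<cdot>\<^bsub>T.B\<^esub> beta h2))"
    unfolding psi_mul_iH_iA[OF ha] by (intro linear_map_sw2[OF T.linear_piH] lin ha)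
  also have "\<dots> = sw2 H h (\<lambda>h1 h2. p (S.tri h1 a) \<cdot>\<^bsub>H'\<^esub> v h2)"
    by (intro sw2_cong lin ha) (simp_all add: T.piH_mul components_alpha_beta S.tri_closed ha
        coalgebra_homD(4)[OF coalgebra_hom_alpha] coalgebra_homD(4)[OF coalgebra_hom_beta])
  finally show ?thesis .
qed

lemma piA_alpha_beta:
  assumes ah: "a \<in> vcar A" "h \<in> vcar H"
  shows "T.piA (alpha a \<cdot>\<^bsub>T.B\<^esub> beta h) = sw3 A a (\<lambda>a1 a2 a3. sw2 H h (\<lambda>h1 h2.
    u a1 \<cdot>\<^bsub>A'\<^esub> T.tri (p a2) (r h1) \<cdot>\<^bsub>A'\<^esub> T.coc (p a3) (v h2)))"
  unfolding alpha_def beta_def by (rule T.piA_pair_mul_pair[OF S.A.coalg S.H.coalg u p r v ah])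

text \<open>
  The product \<open>\<alpha> (f(h\<^sub>1, g\<^sub>1)) \<cdot> \<beta> (h\<^sub>2 g\<^sub>2)\<close> is expanded by \<open>piA_alpha_beta\<close>. The first factor needs three
  components of \<open>f(h\<^sub>1, g\<^sub>1)\<close> and the second needs two of \<open>h\<^sub>2 g\<^sub>2\<close>; they become components of \<open>h\<close> and
  \<open>g\<close> because the cocycle and the multiplication of \<open>H\<close> respect comultiplication.
\<close>
lemma piA_psi_mul_iH_iH:
  assumes hg: "h \<in> vcar H" "g \<in> vcar H"
  shows "T.piA (psi (S.iH h \<cdot>\<^bsub>S.B\<^esub> S.iH g)) =
    sw5 H h (\<lambda>h1 h2 h3 h4 h5. sw5 H g (\<lambda>g1 g2 g3 g4 g5.
      u (S.coc h1 g1) \<cdot>\<^bsub>A'\<^esub> T.tri (p (S.coc h2 g2)) (r (h4 \<cdot>\<^bsub>H\<^esub> g4))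
        \<cdot>\<^bsub>A'\<^esub> T.coc (p (S.coc h3 g3)) (v (h5 \<cdot>\<^bsub>H\<^esub> g5))))"
proof -
  let ?K = "\<lambda>a1 a2 a3 k1 k2. u a1 \<cdot>\<^bsub>A'\<^esub> T.tri (p a2) (r k1) \<cdot>\<^bsub>A'\<^esub> T.coc (p a3) (v k2)"
  let ?L = "\<lambda>h1 h2 h3 h4 h5 g1 g2 g3 g4 g5.
    ?K (S.coc h1 g1) (S.coc h2 g2) (S.coc h3 g3) (h4 \<cdot>\<^bsub>H\<^esub> g4) (h5 \<cdot>\<^bsub>H\<^esub> g5)"
  have "T.piA (psi (S.iH h \<cdot>\<^bsub>S.B\<^esub> S.iH g)) =
    sw2 H h (\<lambda>h1 h2. T.piA (sw2 H g (\<lambda>g1 g2. alpha (S.coc h1 g1) \<cdot>\<^bsub>T.B\<^esub> beta (h2 \<cdot>\<^bsub>H\<^esub> g2))))"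
    unfolding psi_mul_iH_iH[OF hg] by (intro linear_map_sw2[OF T.linear_piA] lin hg)
  also have "\<dots> = sw2 H h (\<lambda>h1 h2. sw2 H g (\<lambda>g1 g2. T.piA (alpha (S.coc h1 g1) \<cdot>\<^bsub>T.B\<^esub> beta (h2 \<cdot>\<^bsub>H\<^esub> g2))))"
    by (intro sw2_cong linear_map_sw2[OF T.linear_piA] lin hg)
  also have "\<dots> = sw2 H h (\<lambda>h' h''. sw2 H g (\<lambda>g' g''.
      sw3 A (S.coc h' g') (\<lambda>a1 a2 a3. sw2 H (h'' \<cdot>\<^bsub>H\<^esub> g'') (?K a1 a2 a3))))"
    by (intro sw2_cong piA_alpha_beta lin hg)
  also have "\<dots> = sw2 H h (\<lambda>h' h''. sw2 H g (\<lambda>g' g''.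
      sw3 A (S.coc h' g') (\<lambda>a1 a2 a3. sw2 H h'' (\<lambda>h4 h5. sw2 H g'' (\<lambda>g4 g5.
        ?K a1 a2 a3 (h4 \<cdot>\<^bsub>H\<^esub> g4) (h5 \<cdot>\<^bsub>H\<^esub> g5))))))"
    by (intro sw2_cong sw3_cong
        sw2_comultiplicative2[OF S.H.coalg S.H.coalg S.H.coalg T.A.vsp S.H.comultiplicative2_mul] lin hg)
  also have "\<dots> = sw2 H h (\<lambda>h' h''. sw2 H g (\<lambda>g' g''.
      sw3 H h' (\<lambda>h1 h2 h3. sw3 H g' (\<lambda>g1 g2 g3. sw2 H h'' (\<lambda>h4 h5. sw2 H g'' (\<lambda>g4 g5.
        ?L h1 h2 h3 h4 h5 g1 g2 g3 g4 g5))))))"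
    by (intro sw2_cong
        sw3_comultiplicative2[OF S.H.coalg S.H.coalg S.A.coalg T.A.vsp S.comultiplicative2_coc] lin hg)
  \<comment> \<open>Collect the sums over parts of \<open>h\<close> on the outside and those over parts of \<open>g\<close> inside.\<close>
  also have "\<dots> = sw2 H h (\<lambda>h' h''. sw2 H g (\<lambda>g' g''.
      sw3 H h' (\<lambda>h1 h2 h3. sw2 H h'' (\<lambda>h4 h5. sw3 H g' (\<lambda>g1 g2 g3. sw2 H g'' (\<lambda>g4 g5.
        ?L h1 h2 h3 h4 h5 g1 g2 g3 g4 g5))))))"
    by (intro sw2_cong sw3_cong sw3_swap lin hg)
  also have "\<dots> = sw2 H h (\<lambda>h' h''. sw3 H h' (\<lambda>h1 h2 h3. sw2 H g (\<lambda>g' g''.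
      sw2 H h'' (\<lambda>h4 h5. sw3 H g' (\<lambda>g1 g2 g3. sw2 H g'' (\<lambda>g4 g5.
        ?L h1 h2 h3 h4 h5 g1 g2 g3 g4 g5))))))"
    by (intro sw2_cong sw3_swap[symmetric] lin hg)
  also have "\<dots> = sw2 H h (\<lambda>h' h''. sw3 H h' (\<lambda>h1 h2 h3. sw2 H h'' (\<lambda>h4 h5.
      sw2 H g (\<lambda>g' g''. sw3 H g' (\<lambda>g1 g2 g3. sw2 H g'' (\<lambda>g4 g5.
        ?L h1 h2 h3 h4 h5 g1 g2 g3 g4 g5))))))"
    by (intro sw2_cong sw3_cong sw2_swap lin hg)
  also have "\<dots> = sw2 H h (\<lambda>h' h''. sw3 H h' (\<lambda>h1 h2 h3. sw2 H h'' (\<lambda>h4 h5.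
      sw5 H g (?L h1 h2 h3 h4 h5))))"
    by (intro sw2_cong sw3_cong sw5_regroup[OF S.H.coalg _ T.A.vsp] lin hg)
  also have "\<dots> = sw5 H h (\<lambda>h1 h2 h3 h4 h5. sw5 H g (?L h1 h2 h3 h4 h5))"
    by (intro sw5_regroup[OF S.H.coalg _ T.A.vsp] lin hg)
  finally show ?thesis .
qed

lemma piA_psi_mul_iH_iA:
  assumes ha: "h \<in> vcar H" "a \<in> vcar A"
  shows "T.piA (psi (S.iH h \<cdot>\<^bsub>S.B\<^esub> S.iA a)) =
    sw5 H h (\<lambda>h1 h2 h3 h4 h5. sw3 A a (\<lambda>a1 a2 a3.
      u (S.tri h1 a1) \<cdot>\<^bsub>A'\<^esub> T.tri (p (S.tri h2 a2)) (r h4)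
        \<cdot>\<^bsub>A'\<^esub> T.coc (p (S.tri h3 a3)) (v h5)))"
proof -
  let ?K = "\<lambda>a1 a2 a3 k1 k2. u a1 \<cdot>\<^bsub>A'\<^esub> T.tri (p a2) (r k1) \<cdot>\<^bsub>A'\<^esub> T.coc (p a3) (v k2)"
  let ?L = "\<lambda>h1 h2 h3 h4 h5 a1 a2 a3. ?K (S.tri h1 a1) (S.tri h2 a2) (S.tri h3 a3) h4 h5"
  have "T.piA (psi (S.iH h \<cdot>\<^bsub>S.B\<^esub> S.iA a)) =
    sw2 H h (\<lambda>h1 h2. T.piA (alpha (S.tri h1 a) \<cdot>\<^bsub>T.B\<^esub> beta h2))"
    unfolding psi_mul_iH_iA[OF ha] by (intro linear_map_sw2[OF T.linear_piA] lin ha)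
  also have "\<dots> = sw2 H h (\<lambda>h' h''. sw3 A (S.tri h' a) (\<lambda>a1 a2 a3. sw2 H h'' (?K a1 a2 a3)))"
    by (intro sw2_cong piA_alpha_beta lin ha)
  also have "\<dots> = sw2 H h (\<lambda>h' h''. sw3 H h' (\<lambda>h1 h2 h3. sw3 A a (\<lambda>a1 a2 a3. sw2 H h'' (\<lambda>h4 h5.
      ?L h1 h2 h3 h4 h5 a1 a2 a3))))"
    by (intro sw2_cong
        sw3_comultiplicative2[OF S.H.coalg S.A.coalg S.A.coalg T.A.vsp S.comultiplicative2_tri] lin ha)
  also have "\<dots> = sw2 H h (\<lambda>h' h''. sw3 H h' (\<lambda>h1 h2 h3. sw2 H h'' (\<lambda>h4 h5. sw3 A a (\<lambda>a1 a2 a3.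
      ?L h1 h2 h3 h4 h5 a1 a2 a3))))"
    by (intro sw2_cong sw3_cong sw3_swap lin ha)
  also have "\<dots> = sw5 H h (\<lambda>h1 h2 h3 h4 h5. sw3 A a (?L h1 h2 h3 h4 h5))"
    by (intro sw5_regroup[OF S.H.coalg _ T.A.vsp] lin ha)
  finally show ?thesis .
qed

text \<open>
  The compatibility conditions that involve the multiplications, the one for \<open>p\<close> included.
\<close>
definition compatible where
  "compatible \<longleftrightarrow>
    (\<forall>a\<in>vcar A. \<forall>b\<in>vcar A. p (a \<cdot>\<^bsub>A\<^esub> b) = p a \<cdot>\<^bsub>H'\<^esub> p b) \<and>
    (\<forall>a\<in>vcar A. \<forall>b\<in>vcar A. u (a \<cdot>\<^bsub>A\<^esub> b) =
       sw3 A a (\<lambda>a1 a2 a3. sw2 A b (\<lambda>b1 b2.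
         u a1 \<cdot>\<^bsub>A'\<^esub> T.tri (p a2) (u b1) \<cdot>\<^bsub>A'\<^esub> T.coc (p a3) (p b2)))) \<and>
    (\<forall>h\<in>vcar H. \<forall>g\<in>vcar H. v h \<cdot>\<^bsub>H'\<^esub> v g =
       sw2 H h (\<lambda>h1 h2. sw2 H g (\<lambda>g1 g2. p (S.coc h1 g1) \<cdot>\<^bsub>H'\<^esub> v (h2 \<cdot>\<^bsub>H\<^esub> g2)))) \<and>
    (\<forall>h\<in>vcar H. \<forall>a\<in>vcar A. v h \<cdot>\<^bsub>H'\<^esub> p a = sw2 H h (\<lambda>h1 h2. p (S.tri h1 a) \<cdot>\<^bsub>H'\<^esub> v h2)) \<and>
    (\<forall>h\<in>vcar H. \<forall>g\<in>vcar H.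
       sw3 H h (\<lambda>h1 h2 h3. sw2 H g (\<lambda>g1 g2.
         r h1 \<cdot>\<^bsub>A'\<^esub> T.tri (v h2) (r g1) \<cdot>\<^bsub>A'\<^esub> T.coc (v h3) (v g2))) =
       sw5 H h (\<lambda>h1 h2 h3 h4 h5. sw5 H g (\<lambda>g1 g2 g3 g4 g5.
         u (S.coc h1 g1) \<cdot>\<^bsub>A'\<^esub> T.tri (p (S.coc h2 g2)) (r (h4 \<cdot>\<^bsub>H\<^esub> g4))
           \<cdot>\<^bsub>A'\<^esub> T.coc (p (S.coc h3 g3)) (v (h5 \<cdot>\<^bsub>H\<^esub> g5))))) \<and>
    (\<forall>h\<in>vcar H. \<forall>a\<in>vcar A.
       sw3 H h (\<lambda>h1 h2 h3. sw2 A a (\<lambda>a1 a2.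
         r h1 \<cdot>\<^bsub>A'\<^esub> T.tri (v h2) (u a1) \<cdot>\<^bsub>A'\<^esub> T.coc (v h3) (p a2))) =
       sw5 H h (\<lambda>h1 h2 h3 h4 h5. sw3 A a (\<lambda>a1 a2 a3.
         u (S.tri h1 a1) \<cdot>\<^bsub>A'\<^esub> T.tri (p (S.tri h2 a2)) (r h4)
           \<cdot>\<^bsub>A'\<^esub> T.coc (p (S.tri h3 a3)) (v h5))))"

text \<open>
  The conditions correspond one by one to the equations on the right: each side of a condition is a
  component, in \<open>A'\<close> or in \<open>H'\<close>, of the corresponding element of \<open>A' # H'\<close>.
\<close>
lemma compatible_iff_components:
  "compatible \<longleftrightarrow>
    (\<forall>a\<in>vcar A. \<forall>b\<in>vcar A. T.piH (alpha (a \<cdot>\<^bsub>A\<^esub> b)) = T.piH (alpha a \<cdot>\<^bsub>T.B\<^esub> alpha b)) \<and>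
    (\<forall>a\<in>vcar A. \<forall>b\<in>vcar A. T.piA (alpha (a \<cdot>\<^bsub>A\<^esub> b)) = T.piA (alpha a \<cdot>\<^bsub>T.B\<^esub> alpha b)) \<and>
    (\<forall>h\<in>vcar H. \<forall>g\<in>vcar H. T.piH (beta h \<cdot>\<^bsub>T.B\<^esub> beta g) = T.piH (psi (S.iH h \<cdot>\<^bsub>S.B\<^esub> S.iH g))) \<and>
    (\<forall>h\<in>vcar H. \<forall>a\<in>vcar A. T.piH (beta h \<cdot>\<^bsub>T.B\<^esub> alpha a) = T.piH (psi (S.iH h \<cdot>\<^bsub>S.B\<^esub> S.iA a))) \<and>
    (\<forall>h\<in>vcar H. \<forall>g\<in>vcar H. T.piA (beta h \<cdot>\<^bsub>T.B\<^esub> beta g) = T.piA (psi (S.iH h \<cdot>\<^bsub>S.B\<^esub> S.iH g))) \<and>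
    (\<forall>h\<in>vcar H. \<forall>a\<in>vcar A. T.piA (beta h \<cdot>\<^bsub>T.B\<^esub> alpha a) = T.piA (psi (S.iH h \<cdot>\<^bsub>S.B\<^esub> S.iA a)))"
proof -
  have piA: "T.piA (alpha a \<cdot>\<^bsub>T.B\<^esub> alpha b) = sw3 A a (\<lambda>a1 a2 a3. sw2 A b (\<lambda>b1 b2.
         u a1 \<cdot>\<^bsub>A'\<^esub> T.tri (p a2) (u b1) \<cdot>\<^bsub>A'\<^esub> T.coc (p a3) (p b2)))"
    "T.piA (beta h \<cdot>\<^bsub>T.B\<^esub> beta g) = sw3 H h (\<lambda>h1 h2 h3. sw2 H g (\<lambda>g1 g2.
         r h1 \<cdot>\<^bsub>A'\<^esub> T.tri (v h2) (r g1) \<cdot>\<^bsub>A'\<^esub> T.coc (v h3) (v g2)))"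
    "T.piA (beta h \<cdot>\<^bsub>T.B\<^esub> alpha a) = sw3 H h (\<lambda>h1 h2 h3. sw2 A a (\<lambda>a1 a2.
         r h1 \<cdot>\<^bsub>A'\<^esub> T.tri (v h2) (u a1) \<cdot>\<^bsub>A'\<^esub> T.coc (v h3) (p a2)))"
    if "a \<in> vcar A" "b \<in> vcar A" "h \<in> vcar H" "g \<in> vcar H" for a b h g
    unfolding alpha_def beta_def
    by (intro T.piA_pair_mul_pair[OF S.A.coalg S.A.coalg u p u p that(1,2)]
        T.piA_pair_mul_pair[OF S.H.coalg S.H.coalg r v r v that(3,4)]
        T.piA_pair_mul_pair[OF S.H.coalg S.A.coalg r v u p that(3,1)])+
  \<comment> \<open>Units serve as values of the variables that do not occur in the respective formula.\<close>
  note [simp] = components_alpha_beta T.piH_mul S.A.mul_closed S.A.one_closed S.H.one_closed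
    coalgebra_homD(4)[OF coalgebra_hom_alpha] coalgebra_homD(4)[OF coalgebra_hom_beta]
    piA(1)[OF _ _ S.H.one_closed S.H.one_closed] piA(2)[OF S.A.one_closed S.A.one_closed]
    piA(3)[OF _ S.A.one_closed _ S.H.one_closed]
    piA_psi_mul_iH_iH piA_psi_mul_iH_iA piH_psi_mul_iH_iH piH_psi_mul_iH_iA
  show ?thesis unfolding compatible_def by (simp cong: ball_cong_simp)
qed

text \<open>
  The equations between components combine, because both sides of each relation are compatible with
  comultiplication.
\<close>
lemma compatible_iff_relations:
  "compatible \<longleftrightarrow>
    (\<forall>a\<in>vcar A. \<forall>b\<in>vcar A. alpha (a \<cdot>\<^bsub>A\<^esub> b) = alpha a \<cdot>\<^bsub>T.B\<^esub> alpha b) \<and>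
    (\<forall>h\<in>vcar H. \<forall>g\<in>vcar H. beta h \<cdot>\<^bsub>T.B\<^esub> beta g = psi (S.iH h \<cdot>\<^bsub>S.B\<^esub> S.iH g)) \<and>
    (\<forall>h\<in>vcar H. \<forall>a\<in>vcar A. beta h \<cdot>\<^bsub>T.B\<^esub> alpha a = psi (S.iH h \<cdot>\<^bsub>S.B\<^esub> S.iA a))"
proof
  note mulT = comultiplicative2_comp[OF _ _ T.B.coalg T.B.coalg T.B.comultiplicative2_mul T.B.bilinear_mul]
  note mulS = comultiplicative2_hom[OF _ _ S.B.coalg T.B.coalg
    comultiplicative2_comp[OF _ _ S.B.coalg S.B.coalg S.B.comultiplicative2_mul S.B.bilinear_mul] coalgebra_hom_psi]
  note homs = coalgebra_hom_alpha coalgebra_hom_beta S.coalgebra_hom_iA S.coalgebra_hom_iH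
  assume "compatible"
  note comp = this[unfolded compatible_iff_components]
  have "alpha (a \<cdot>\<^bsub>A\<^esub> b) = alpha a \<cdot>\<^bsub>T.B\<^esub> alpha b" if "a \<in> vcar A" "b \<in> vcar A" for a b
    by (rule T.comultiplicative2_eqI[OF S.A.coalg S.A.coalg
          comultiplicative2_hom[OF S.A.coalg S.A.coalg S.A.coalg T.B.coalg S.A.comultiplicative2_mul coalgebra_hom_alpha]
          mulT[OF S.A.coalg S.A.coalg homs(1) homs(1)] _ _ that])
      (use comp in auto)
  moreover have "beta h \<cdot>\<^bsub>T.B\<^esub> beta g = psi (S.iH h \<cdot>\<^bsub>S.B\<^esub> S.iH g)" if "h \<in> vcar H" "g \<in> vcar H" for h g
    by (rule T.comultiplicative2_eqI[OF S.H.coalg S.H.coalg mulT[OF S.H.coalg S.H.coalg homs(2) homs(2)]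
          mulS[OF S.H.coalg S.H.coalg S.H.coalg S.H.coalg homs(4) homs(4)] _ _ that])
      (use comp in auto)
  moreover have "beta h \<cdot>\<^bsub>T.B\<^esub> alpha a = psi (S.iH h \<cdot>\<^bsub>S.B\<^esub> S.iA a)" if "h \<in> vcar H" "a \<in> vcar A" for h a
    by (rule T.comultiplicative2_eqI[OF S.H.coalg S.A.coalg mulT[OF S.H.coalg S.A.coalg homs(2) homs(1)]
          mulS[OF S.H.coalg S.A.coalg S.H.coalg S.A.coalg homs(4) homs(3)] _ _ that])
      (use comp in auto)
  ultimately show "(\<forall>a\<in>vcar A. \<forall>b\<in>vcar A. alpha (a \<cdot>\<^bsub>A\<^esub> b) = alpha a \<cdot>\<^bsub>T.B\<^esub> alpha b) \<and>
    (\<forall>h\<in>vcar H. \<forall>g\<in>vcar H. beta h \<cdot>\<^bsub>T.B\<^esub> beta g = psi (S.iH h \<cdot>\<^bsub>S.B\<^esub> S.iH g)) \<and>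
    (\<forall>h\<in>vcar H. \<forall>a\<in>vcar A. beta h \<cdot>\<^bsub>T.B\<^esub> alpha a = psi (S.iH h \<cdot>\<^bsub>S.B\<^esub> S.iA a))"
    by blast
qed (simp add: compatible_iff_components)

text \<open>
  By \<open>a # h = i\<^sub>A a \<cdot> i\<^sub>H h\<close>, a product \<open>(a # h)(c # g)\<close> is brought into normal form by moving \<open>h\<close> past
  \<open>c\<close> and then multiplying the result with \<open>g\<close>. The formula for the product performs both steps, and
  the two relations undo them in the image.
\<close>
lemma psi_mul:
  assumes compatible and st: "s \<in> vcar S.B" "t \<in> vcar S.B"
  shows "psi (s \<cdot>\<^bsub>S.B\<^esub> t) = psi s \<cdot>\<^bsub>T.B\<^esub> psi t"
proof (rule S.B_eqI[OF _ _ _ st(1)])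
  have rel: "alpha (a \<cdot>\<^bsub>A\<^esub> b) = alpha a \<cdot>\<^bsub>T.B\<^esub> alpha b"
    "psi (S.iH h \<cdot>\<^bsub>S.B\<^esub> S.iH g) = beta h \<cdot>\<^bsub>T.B\<^esub> beta g"
    "psi (S.iH h \<cdot>\<^bsub>S.B\<^esub> S.iA a) = beta h \<cdot>\<^bsub>T.B\<^esub> alpha a"
    if "a \<in> vcar A" "b \<in> vcar A" "h \<in> vcar H" "g \<in> vcar H" for a b h g
    using \<open>compatible\<close> that unfolding compatible_iff_relations by auto
  show "linear_map S.B T.B (\<lambda>s. psi (s \<cdot>\<^bsub>S.B\<^esub> t))" "linear_map S.B T.B (\<lambda>s. psi s \<cdot>\<^bsub>T.B\<^esub> psi t)"
    by (intro lin st)+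
  fix a h assume ah: "a \<in> vcar A" "h \<in> vcar H"
  let ?s = "a \<otimes>\<^bsub>A,H\<^esub> h"
  show "psi (?s \<cdot>\<^bsub>S.B\<^esub> t) = psi ?s \<cdot>\<^bsub>T.B\<^esub> psi t"
  proof (rule S.B_eqI[OF _ _ _ st(2)])
    show "linear_map S.B T.B (\<lambda>t. psi (?s \<cdot>\<^bsub>S.B\<^esub> t))" "linear_map S.B T.B (\<lambda>t. psi ?s \<cdot>\<^bsub>T.B\<^esub> psi t)"
      by (intro lin ah)+
    fix c g assume cg: "c \<in> vcar A" "g \<in> vcar H"
    note closed = ah cg S.tri_closed S.coc_closed S.A.mul_closed S.H.mul_closed T.B.mul_closed
      coalgebra_homD(4)[OF coalgebra_hom_alpha] coalgebra_homD(4)[OF coalgebra_hom_beta]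
    \<comment> \<open>The last two of the three components of \<open>h\<close> form the relation for \<open>h' \<cdot> g\<close>.\<close>
    let ?G = "\<lambda>h'. sw2 H h' (\<lambda>h2 h3. sw2 H g (\<lambda>g1 g2. alpha (S.coc h2 g1) \<cdot>\<^bsub>T.B\<^esub> beta (h3 \<cdot>\<^bsub>H\<^esub> g2)))"
    have G: "?G h' = beta h' \<cdot>\<^bsub>T.B\<^esub> beta g" if "h' \<in> vcar H" for h'
      using psi_mul_iH_iH[OF that cg(2)] rel(2)[OF cg(1) cg(1) that cg(2)] by simp
    have E: "psi ((a \<cdot>\<^bsub>A\<^esub> S.tri h1 c \<cdot>\<^bsub>A\<^esub> S.coc h2 g1) \<otimes>\<^bsub>A,H\<^esub> (h3 \<cdot>\<^bsub>H\<^esub> g2)) =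
        (alpha a \<cdot>\<^bsub>T.B\<^esub> alpha (S.tri h1 c)) \<cdot>\<^bsub>T.B\<^esub> (alpha (S.coc h2 g1) \<cdot>\<^bsub>T.B\<^esub> beta (h3 \<cdot>\<^bsub>H\<^esub> g2))"
      if "h1 \<in> vcar H" "h2 \<in> vcar H" "h3 \<in> vcar H" "g1 \<in> vcar H" "g2 \<in> vcar H" for h1 h2 h3 g1 g2
      using that by (simp add: psi_tens closed rel(1)[OF _ _ that(1) that(1)] T.B.mul_assoc)
    have "psi (?s \<cdot>\<^bsub>S.B\<^esub> (c \<otimes>\<^bsub>A,H\<^esub> g)) = sw3 H h (\<lambda>h1 h2 h3. sw2 H g (\<lambda>g1 g2.
        psi ((a \<cdot>\<^bsub>A\<^esub> S.tri h1 c \<cdot>\<^bsub>A\<^esub> S.coc h2 g1) \<otimes>\<^bsub>A,H\<^esub> (h3 \<cdot>\<^bsub>H\<^esub> g2))))"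
      unfolding S.mul_tens[OF ah cg]
      by (subst linear_map_sw3[OF linear_psi S.B.vsp S.H.coalg ah(2)])
        (intro lin sw3_cong linear_map_sw2[OF linear_psi] ah cg; assumption)+
    also have "\<dots> = sw2 H h (\<lambda>h1 h'. sw2 H h' (\<lambda>h2 h3. sw2 H g (\<lambda>g1 g2.
        (alpha a \<cdot>\<^bsub>T.B\<^esub> alpha (S.tri h1 c)) \<cdot>\<^bsub>T.B\<^esub> (alpha (S.coc h2 g1) \<cdot>\<^bsub>T.B\<^esub> beta (h3 \<cdot>\<^bsub>H\<^esub> g2)))))"
      unfolding sw3_def by (intro sw2_cong E lin ah cg)
    also have "\<dots> = sw2 H h (\<lambda>h1 h'. sw2 H h' (\<lambda>h2 h3.
        (alpha a \<cdot>\<^bsub>T.B\<^esub> alpha (S.tri h1 c)) \<cdot>\<^bsub>T.B\<^esub> (sw2 H g (\<lambda>g1 g2. alpha (S.coc h2 g1) \<cdot>\<^bsub>T.B\<^esub> beta (h3 \<cdot>\<^bsub>H\<^esub> g2)))))"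
      by (intro sw2_cong T.B.sw2_mul_left[symmetric] lin ah cg)
    also have "\<dots> = sw2 H h (\<lambda>h1 h'. (alpha a \<cdot>\<^bsub>T.B\<^esub> alpha (S.tri h1 c)) \<cdot>\<^bsub>T.B\<^esub> ?G h')"
      by (intro sw2_cong T.B.sw2_mul_left[symmetric] lin ah cg)
    \<comment> \<open>What remains is the relation for \<open>h \<cdot> c\<close>.\<close>
    also have "\<dots> = sw2 H h (\<lambda>h1 h'. alpha a \<cdot>\<^bsub>T.B\<^esub> ((alpha (S.tri h1 c) \<cdot>\<^bsub>T.B\<^esub> beta h') \<cdot>\<^bsub>T.B\<^esub> beta g))"
      by (intro sw2_cong lin ah cg) (simp_all add: G closed T.B.mul_assoc)
    also have "\<dots> = alpha a \<cdot>\<^bsub>T.B\<^esub> sw2 H h (\<lambda>h1 h'. (alpha (S.tri h1 c) \<cdot>\<^bsub>T.B\<^esub> beta h') \<cdot>\<^bsub>T.B\<^esub> beta g)"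
      by (intro T.B.sw2_mul_left[symmetric] lin ah cg)
    also have "\<dots> = alpha a \<cdot>\<^bsub>T.B\<^esub> (sw2 H h (\<lambda>h1 h'. alpha (S.tri h1 c) \<cdot>\<^bsub>T.B\<^esub> beta h') \<cdot>\<^bsub>T.B\<^esub> beta g)"
      by (intro arg_cong[where f = "\<lambda>z. alpha a \<cdot>\<^bsub>T.B\<^esub> z"] T.B.sw2_mul_right[symmetric] lin ah cg)
    also have "\<dots> = alpha a \<cdot>\<^bsub>T.B\<^esub> ((beta h \<cdot>\<^bsub>T.B\<^esub> alpha c) \<cdot>\<^bsub>T.B\<^esub> beta g)"
      using psi_mul_iH_iA[OF ah(2) cg(1)] rel(3)[OF cg(1) cg(1) ah(2) ah(2)] by simp
    also have "\<dots> = psi ?s \<cdot>\<^bsub>T.B\<^esub> psi (c \<otimes>\<^bsub>A,H\<^esub> g)"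
      by (simp add: psi_tens closed T.B.mul_assoc)
    finally show "psi (?s \<cdot>\<^bsub>S.B\<^esub> (c \<otimes>\<^bsub>A,H\<^esub> g)) = psi ?s \<cdot>\<^bsub>T.B\<^esub> psi (c \<otimes>\<^bsub>A,H\<^esub> g)" .
  qed
qed

lemma tensor_lift_quadruple_value:
  assumes "b \<in> vcar S.B"
  shows "tensor_lift A H (quadruple_value A H A' H' act' f' (u, p, r, v)) b = psi b"
  unfolding psi_def
  using assms by (intro tensor_lift_cong S.A.vsp) (simp_all add: S.crossed_product_simps quadruple_value_eq psi_tens)

lemma hopf_hom_psi:
  assumes compatible
  shows "hopf_hom S.B T.B psi"
  using psi_mul[OF assms] by (simp add: hopf_hom_def unitary_def coalgebra_hom_psi psi_one)

end

section \<open>The bijection\<close>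

lemma restrict_eqI:
  assumes "w \<in> extensional D" "\<And>x. x \<in> D \<Longrightarrow> g x = w x"
  shows "restrict g D = w"
  by (rule extensionalityI[OF restrict_extensional assms(1)]) (simp add: assms(2))

lemma hopf_hom_cong:
  assumes "bialgebra A" "hopf_hom A B \<phi>" "\<And>x. x \<in> vcar A \<Longrightarrow> \<phi> x = \<psi> x"
  shows "hopf_hom A B \<psi>"
proof -
  interpret A: bialg A using assms(1) by unfold_locales
  note \<phi> = assms(2)[unfolded hopf_hom_def unitary_def]
  have "coalgebra_hom A B \<psi>"
    by (rule coalgebra_hom_cong[OF A.coalg _ assms(3)]) (use \<phi> in simp_all)
  thus ?thesis
    using \<phi> by (simp add: hopf_hom_def unitary_def assms(3)[symmetric] A.one_closed A.mul_closed)
qed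

context crossed_pair
begin

abbreviation quadruples where "quadruples \<equiv> compatible_quadruples A H act f A' H' act' f'"

lemma compatible_quadruples_iff:
  "(u, p, r, v) \<in> quadruples \<longleftrightarrow>
    u \<in> extensional (vcar A) \<and> p \<in> extensional (vcar A) \<and> r \<in> extensional (vcar H) \<and> v \<in> extensional (vcar H) \<and>
    quadruple A H act f A' H' act' f' u p r v \<and> quadruple.compatible A H act f A' H' act' f' u p r v"
  (is "?L \<longleftrightarrow> ?R")
proof
  assume ?L
  note L = this[unfolded compatible_quadruples_def Let_def mem_Collect_eq case_prod_conv
      hopf_homs_def unitary_coalgebra_homs_def hopf_hom_def unitary_def]
  interpret quadruple A H act f A' H' act' f' u p r v
    using L by unfold_locales (simp_all add: T.cocommuting_def)
  show ?R using L by (simp add: compatible_def quadruple_axioms)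
next
  assume R: ?R
  interpret quadruple A H act f A' H' act' f' u p r v using R by simp
  show ?L
    unfolding compatible_quadruples_def Let_def mem_Collect_eq case_prod_conv
      hopf_homs_def unitary_coalgebra_homs_def hopf_hom_def unitary_def
    using R up[unfolded T.cocommuting_def] rv[unfolded T.cocommuting_def]
    by (simp add: compatible_def u p r v u1 p1 r1 v1)
qed

text \<open>
  The two directions of the bijection. Restriction to the carriers makes equality of functions the
  equality of maps, as in the sets of morphisms under consideration.
\<close>
definition morphism_of where
  "morphism_of q = restrict (tensor_lift A H (quadruple_value A H A' H' act' f' q)) (vcar S.B)"

definition quadruple_of where
  "quadruple_of \<phi> =
    (restrict (\<lambda>a. T.piA (\<phi> (S.iA a))) (vcar A), restrict (\<lambda>a. T.piH (\<phi> (S.iA a))) (vcar A),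
     restrict (\<lambda>h. T.piA (\<phi> (S.iH h))) (vcar H), restrict (\<lambda>h. T.piH (\<phi> (S.iH h))) (vcar H))"

lemma morphism_of_quadruple:
  assumes "q \<in> quadruples"
  shows "morphism_of q \<in> hopf_homs S.B T.B"
    and "quadruple_of (morphism_of q) = q"
    and "a \<in> vcar A \<Longrightarrow> h \<in> vcar H \<Longrightarrow>
      morphism_of q (a \<otimes>\<^bsub>A,H\<^esub> h) = quadruple_value A H A' H' act' f' q a h"
proof -
  obtain u p r v where q: "q = (u, p, r, v)" by (cases q)
  note m = assms[unfolded q compatible_quadruples_iff]
  interpret quadruple A H act f A' H' act' f' u p r v using m by simp
  have psi: "morphism_of q b = psi b" if "b \<in> vcar S.B" for b
    using that by (simp add: morphism_of_def q tensor_lift_quadruple_value)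
  have "hopf_hom S.B T.B (morphism_of q)"
    using hopf_hom_cong[OF S.B.bialgebra hopf_hom_psi] m by (simp add: psi)
  thus "morphism_of q \<in> hopf_homs S.B T.B"
    by (simp add: hopf_homs_def) (simp add: morphism_of_def)
  show "quadruple_of (morphism_of q) = q"
    unfolding quadruple_of_def q prod.inject unfolding q[symmetric]
    using m by (intro conjI restrict_eqI)
      (simp_all add: psi S.iA_closed S.iH_closed psi_iA psi_iH components_alpha_beta)
  show "a \<in> vcar A \<Longrightarrow> h \<in> vcar H \<Longrightarrow>
      morphism_of q (a \<otimes>\<^bsub>A,H\<^esub> h) = quadruple_value A H A' H' act' f' q a h"
    by (simp add: psi S.tens_B_closed quadruple_value_eq q[symmetric]) (simp add: q quadruple_value_eq)
qed

lemma quadruple_of_morphism: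
  assumes "\<phi> \<in> hopf_homs S.B T.B"
  shows "quadruple_of \<phi> \<in> quadruples" and "morphism_of (quadruple_of \<phi>) = \<phi>"
proof -
  have ext: "\<phi> \<in> extensional (vcar S.B)" and hom: "coalgebra_hom S.B T.B \<phi>"
    and one: "\<phi> \<one>\<^bsub>S.B\<^esub> = \<one>\<^bsub>T.B\<^esub>"
    and mul: "x \<in> vcar S.B \<Longrightarrow> y \<in> vcar S.B \<Longrightarrow> \<phi> (x \<cdot>\<^bsub>S.B\<^esub> y) = \<phi> x \<cdot>\<^bsub>T.B\<^esub> \<phi> y" for x y
    using assms by (auto simp: hopf_homs_def hopf_hom_def unitary_def)
  obtain u p r v where q: "quadruple_of \<phi> = (u, p, r, v)" by (cases "quadruple_of \<phi>")
  have val: "a \<in> vcar A \<Longrightarrow> T.piA (\<phi> (S.iA a)) = u a" "a \<in> vcar A \<Longrightarrow> T.piH (\<phi> (S.iA a)) = p a"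
    "h \<in> vcar H \<Longrightarrow> T.piA (\<phi> (S.iH h)) = r h" "h \<in> vcar H \<Longrightarrow> T.piH (\<phi> (S.iH h)) = v h" for a h
    using q by (auto simp: quadruple_of_def)
  have homA: "coalgebra_hom A T.B (\<lambda>a. \<phi> (S.iA a))"
    by (rule coalgebra_hom_comp[OF S.A.coalg S.B.coalg T.B.coalg S.coalgebra_hom_iA hom])
  have homH: "coalgebra_hom H T.B (\<lambda>h. \<phi> (S.iH h))"
    by (rule coalgebra_hom_comp[OF S.H.coalg S.B.coalg T.B.coalg S.coalgebra_hom_iH hom])
  note pairA = T.pair_components[OF S.A.coalg homA] and pairH = T.pair_components[OF S.H.coalg homH]
  interpret quadruple A H act f A' H' act' f' u p r v
  proof unfold_locales
    show "coalgebra_hom A A' u"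
      by (rule coalgebra_hom_cong[OF S.A.coalg coalgebra_hom_comp[OF S.A.coalg T.B.coalg T.A.coalg homA T.coalgebra_hom_piA]])
        (rule val)
    show "coalgebra_hom A H' p"
      by (rule coalgebra_hom_cong[OF S.A.coalg coalgebra_hom_comp[OF S.A.coalg T.B.coalg T.H.coalg homA T.coalgebra_hom_piH]])
        (rule val)
    show "coalgebra_hom H A' r"
      by (rule coalgebra_hom_cong[OF S.H.coalg coalgebra_hom_comp[OF S.H.coalg T.B.coalg T.A.coalg homH T.coalgebra_hom_piA]])
        (rule val)
    show "coalgebra_hom H H' v"
      by (rule coalgebra_hom_cong[OF S.H.coalg coalgebra_hom_comp[OF S.H.coalg T.B.coalg T.H.coalg homH T.coalgebra_hom_piH]])
        (rule val)
    show "u \<one>\<^bsub>A\<^esub> = \<one>\<^bsub>A'\<^esub>" "p \<one>\<^bsub>A\<^esub> = \<one>\<^bsub>H'\<^esub>" "r \<one>\<^bsub>H\<^esub> = \<one>\<^bsub>A'\<^esub>" "v \<one>\<^bsub>H\<^esub> = \<one>\<^bsub>H'\<^esub>"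
      by (simp_all add: val[symmetric] S.A.one_closed S.H.one_closed S.iA_one S.iH_one one T.piA_one T.piH_one)
    show "T.cocommuting A u p" by (rule T.cocommuting_cong[OF pairA(2) S.A.coalg val(1,2)])
    show "T.cocommuting H r v" by (rule T.cocommuting_cong[OF pairH(2) S.H.coalg val(3,4)])
  qed
  have alpha: "alpha a = \<phi> (S.iA a)" if "a \<in> vcar A" for a
    unfolding alpha_def pairA(1)[OF that, symmetric]
    by (rule T.pair_cong[OF S.A.coalg that]) (simp_all add: val)
  have beta: "beta h = \<phi> (S.iH h)" if "h \<in> vcar H" for h
    unfolding beta_def pairH(1)[OF that, symmetric]
    by (rule T.pair_cong[OF S.H.coalg that]) (simp_all add: val)
  have psi: "psi b = \<phi> b" if "b \<in> vcar S.B" for b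
  proof (rule S.B_eqI[OF linear_psi coalgebra_homD(1)[OF hom] _ that])
    fix a h assume "a \<in> vcar A" "h \<in> vcar H"
    thus "psi (a \<otimes>\<^bsub>A,H\<^esub> h) = \<phi> (a \<otimes>\<^bsub>A,H\<^esub> h)"
      by (simp add: psi_tens alpha beta mul[symmetric] S.iA_closed S.iH_closed S.mul_iA_iH)
  qed
  have compatible
    by (simp add: compatible_iff_relations alpha beta psi mul[symmetric] S.mul_iA_iA S.A.mul_closed
        S.iA_closed S.iH_closed S.B.mul_closed)
  moreover have "u \<in> extensional (vcar A)" "p \<in> extensional (vcar A)"
    "r \<in> extensional (vcar H)" "v \<in> extensional (vcar H)"
    using q by (auto simp: quadruple_of_def)
  ultimately show "quadruple_of \<phi> \<in> quadruples"
    unfolding q compatible_quadruples_iff using quadruple_axioms by simp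
  show "morphism_of (quadruple_of \<phi>) = \<phi>"
    unfolding q
    by (rule extensionalityI[OF _ ext]) (simp_all add: morphism_of_def tensor_lift_quadruple_value psi)
qed

end

theorem theorem2p1:
  fixes A :: "('k::field, 'a::ab_group_add) bialg"
    and H :: "('k, 'h::ab_group_add) bialg"
    and act :: "('k, 'h, 'a) tensor \<Rightarrow> 'a"
    and f :: "('k, 'h, 'h) tensor \<Rightarrow> 'a"
    and A' :: "('k, 'c::ab_group_add) bialg"
    and H' :: "('k, 'd::ab_group_add) bialg"
    and act' :: "('k, 'd, 'c) tensor \<Rightarrow> 'c"
    and f' :: "('k, 'd, 'd) tensor \<Rightarrow> 'c"
  assumes "crossed_system A H act f" and "crossed_system A' H' act' f'"
  shows "\<exists>\<Phi>. bij_betw \<Phi>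
            (compatible_quadruples A H act f A' H' act' f')
            (hopf_homs (crossed_product A H act f) (crossed_product A' H' act' f')) \<and>
          (\<forall>q \<in> compatible_quadruples A H act f A' H' act' f'.
             \<forall>a \<in> vcar A. \<forall>h \<in> vcar H.
               \<Phi> q (a \<otimes>\<^bsub>A,H\<^esub> h) = quadruple_value A H A' H' act' f' q a h)"
proof -
  interpret crossed_pair A H act f A' H' act' f'
    using assms by unfold_locales
  have "bij_betw morphism_of quadruples (hopf_homs S.B T.B)"
    by (rule bij_betw_byWitness[where f' = quadruple_of])
      (auto simp: morphism_of_quadruple quadruple_of_morphism)
  thus ?thesis using morphism_of_quadruple(3) by blast
qed

end
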